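(* Let $n \geq 3$ and let $\mathfrak{s}$ be a principal $\mathfrak{sl}_2$-subalgebra of $\mathfrak{sl}_n = \mathfrak{sl}_n(\mathbb{C})$. Let $V$ be an arbitrary finite dimensional complex irreducible representation of $\mathfrak{sl}_n$. Then there exists an integer $d$ with $0 \leq d < n$ such that, upon restriction to $\mathfrak{s}$, the representation $V$ contains the irreducible $\mathfrak{s}$-representation $F_d$ in its decomposition into irreducibles.
   Context: All Lie algebras and representations are finite dimensional over $\mathbb{C}$. For an integer $d \geq 0$, $F_d$ denotes the irreducible representation of $\mathfrak{sl}_2 = \mathfrak{sl}_2(\mathbb{C})$ of dimension $d+1$. A principal $\mathfrak{sl}_2$-subalgebra of $\mathfrak{sl}_n$ is the image of the injective homomorphism $\mathfrak{sl}_2 \to \mathrm{End}(F_{n-1}) \cong \mathfrak{gl}_n$ (for some choice of basis of $F_{n-1}$) defining the action on the $n$-dimensional irreducible representation; this image lies in $\mathfrak{sl}_n$. Equivalently, it is a subalgebra isomorphic to $\mathfrak{sl}_2$ containing a regular nilpotent element of $\mathfrak{sl}_n$. Through the isomorphism $\mathfrak{s} \cong \mathfrak{sl}_2$, $F_d$ is regarded as an $\mathfrak{s}$-representation. *)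

theory Defs
  imports "HOL-Analysis.Analysis"
begin

definition lie_bracket :: "complex^'k^'k \<Rightarrow> complex^'k^'k \<Rightarrow> complex^'k^'k" where
  "lie_bracket A B = A ** B - B ** A"

(* HOL-Analysis only provides scaling of complex matrices by reals. *)
definition smult_matrix :: "complex \<Rightarrow> complex^'k^'k \<Rightarrow> complex^'k^'k" where
  "smult_matrix c A = (\<chi> i j. c * A $ i $ j)"

definition sl :: "(complex^'k^'k) set" where
  "sl = {A. trace A = 0}"

(* A finite-dimensional representation, on the vector space given by the whole type 'v with
   scalar multiplication smul, of a Lie subalgebra L of gl_k.
   Nothing is required of rho outside L. *)
definition lie_rep ::
  "(complex^'k^'k) set \<Rightarrow> (complex \<Rightarrow> 'v::ab_group_add \<Rightarrow> 'v) \<Rightarrow> (complex^'k^'k \<Rightarrow> 'v \<Rightarrow> 'v) \<Rightarrow> bool"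
  where
  "lie_rep L smul \<rho> \<longleftrightarrow>
     (\<exists>B. finite_dimensional_vector_space smul B) \<and>
     (\<forall>X\<in>L. Vector_Spaces.linear smul smul (\<rho> X)) \<and>
     (\<forall>X\<in>L. \<forall>Y\<in>L. \<forall>v. \<rho> (X + Y) v = \<rho> X v + \<rho> Y v) \<and>
     (\<forall>X\<in>L. \<forall>c v. \<rho> (smult_matrix c X) v = smul c (\<rho> X v)) \<and>
     (\<forall>X\<in>L. \<forall>Y\<in>L. \<forall>v. \<rho> (lie_bracket X Y) v = \<rho> X (\<rho> Y v) - \<rho> Y (\<rho> X v))"

definition subrep ::
  "(complex^'k^'k) set \<Rightarrow> (complex \<Rightarrow> 'v::ab_group_add \<Rightarrow> 'v) \<Rightarrow> (complex^'k^'k \<Rightarrow> 'v \<Rightarrow> 'v) \<Rightarrow> 'v set \<Rightarrow> bool"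
  where
  "subrep L smul \<rho> W \<longleftrightarrow> module.subspace smul W \<and> (\<forall>X\<in>L. \<rho> X ` W \<subseteq> W)"

definition irreducible_subrep ::
  "(complex^'k^'k) set \<Rightarrow> (complex \<Rightarrow> 'v::ab_group_add \<Rightarrow> 'v) \<Rightarrow> (complex^'k^'k \<Rightarrow> 'v \<Rightarrow> 'v) \<Rightarrow> 'v set \<Rightarrow> bool"
  where
  "irreducible_subrep L smul \<rho> W \<longleftrightarrow>
     subrep L smul \<rho> W \<and> W \<noteq> {0} \<and>
     (\<forall>U. subrep L smul \<rho> U \<and> U \<subseteq> W \<longrightarrow> U = {0} \<or> U = W)"

definition irreducible_rep ::
  "(complex^'k^'k) set \<Rightarrow> (complex \<Rightarrow> 'v::ab_group_add \<Rightarrow> 'v) \<Rightarrow> (complex^'k^'k \<Rightarrow> 'v \<Rightarrow> 'v) \<Rightarrow> bool"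
  where
  "irreducible_rep L smul \<rho> \<longleftrightarrow> lie_rep L smul \<rho> \<and> irreducible_subrep L smul \<rho> UNIV"

(* For L isomorphic to sl_2: the subrepresentation W is a copy of F_d, the irreducible
   representation of dimension d + 1.  As F_d is determined up to isomorphism by irreducibility
   and its dimension, this does not depend on the isomorphism between L and sl_2. *)
definition is_F ::
  "nat \<Rightarrow> (complex^'k^'k) set \<Rightarrow> (complex \<Rightarrow> 'v::ab_group_add \<Rightarrow> 'v) \<Rightarrow> (complex^'k^'k \<Rightarrow> 'v \<Rightarrow> 'v) \<Rightarrow> 'v set \<Rightarrow> bool"
  where
  "is_F d L smul \<rho> W \<longleftrightarrow> irreducible_subrep L smul \<rho> W \<and> vector_space.dim smul W = d + 1"

(* phi makes C^n a copy of F_{n-1}; since phi is arbitrary with this property, all choices of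
   basis of F_{n-1} are covered.  That phi is a Lie algebra homomorphism into gl_n is the
   lie_rep condition, as phi X acts on C^n by matrix-vector multiplication. *)
definition principal_sl2 :: "(complex^'n^'n) set \<Rightarrow> bool" where
  "principal_sl2 \<ss> \<longleftrightarrow>
     (\<exists>\<phi> :: complex^2^2 \<Rightarrow> complex^'n^'n.
        inj_on \<phi> sl \<and>
        lie_rep sl (*s) (\<lambda>X v. \<phi> X *v v) \<and>
        is_F (CARD('n) - 1) sl (*s) (\<lambda>X v. \<phi> X *v v) UNIV \<and>
        \<ss> = \<phi> ` sl)"

(* The whole space is the internal direct sum of the members of WW. *)
definition direct_sum_decomposition :: "'v::ab_group_add set set \<Rightarrow> bool" where
  "direct_sum_decomposition \<W> \<longleftrightarrow>
     finite \<W> \<and> (\<forall>v. \<exists>!f. f \<in> (\<Pi>\<^sub>E W\<in>\<W>. W) \<and> (\<Sum>W\<in>\<W>. f W) = v)"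

definition contains_F_in_decomposition ::
  "nat \<Rightarrow> (complex^'k^'k) set \<Rightarrow> (complex \<Rightarrow> 'v::ab_group_add \<Rightarrow> 'v) \<Rightarrow> (complex^'k^'k \<Rightarrow> 'v \<Rightarrow> 'v) \<Rightarrow> bool"
  where
  "contains_F_in_decomposition d L smul \<rho> \<longleftrightarrow>
     (\<exists>\<W>. direct_sum_decomposition \<W> \<and>
          (\<forall>W\<in>\<W>. irreducible_subrep L smul \<rho> W) \<and>
          (\<exists>W\<in>\<W>. is_F d L smul \<rho> W))"

end

theory Submission
  imports Defs "HOL-Computational_Algebra.Fundamental_Theorem_Algebra"
begin

text \<open>
  Let e, f, h be the principal triple.  A complement of the image of e in V is spanned by the
  lowest vectors of the e-strings, so F_d occurs in V as soon as some nonzero linear functional on V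
  is killed by e and satisfies xi (h v) = - d * xi v (\<open>functional_detects_F\<close>).  Such a functional
  is a highest weight vector of weight d in the dual of V, and the task is to find one with d < n.

  The functionals come from tensors.  A highest weight vector v0 of V has the same weight as a
  product z0 of decomposable exterior powers of the first basis vectors, one factor of degree k + 1
  for each unit of the k-th coordinate of the weight.  The submodule generated by the pair (v0, z0)
  is the graph of a map from V to tensors, because a tensor that is paired with 0 is orthogonal for the
  Hermitian form to all tensors that occur, and hence to itself (\<open>rel_zero_trivial\<close>).  A coefficient tensor c therefore
  defines a functional on V.  By polarisation the tensors that occur include every product of
  exterior powers of columns A_0, A_1, ..., and so the functional is nonzero exactly if the polynomial
  \<open>val is c A\<close> in these columns is nonzero.  Only these polynomials matter.  They multiply
  when lists of degrees are concatenated, and a product of nonzero polynomials is nonzero.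

  It remains to find, for every list of degrees between 1 and n - 1, a nonzero polynomial that is a
  highest weight vector of weight less than n (\<open>small_highest\<close>).  This goes by induction on the list.
  For a single degree, products of alternating bilinear forms provide the weights 0, n - 1, i or n - i,
  depending on parities (\<open>good_factor\<close>).  For the step, let c_0, ..., c_a and d_0, ..., d_b be strings of
  highest weights a, b < n, and consider for a suitable J the J-th transvectants
    sum over j of (-1)^j (J choose j) c_(p+j) d_(q+J-j).
  If one of them is nonzero, then one of minimal p + q is a highest weight vector of weight at most
  a + b - 2 J, and J is chosen to make this less than n (\<open>transvectant_highest\<close>).  If all of them
  vanish, then so do the sums in which d is evaluated at a fixed point A1 and c is replaced by its
  leading coefficients on a line through A1 (\<open>transvectant_limit\<close>).  At a suitable A1 only the
  one or two middle terms of the string d survive, and the resulting linear equations force all leading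
  coefficients to be zero, which is absurd (\<open>vanish_even\<close>, \<open>vanish_odd\<close>, \<open>add_factor\<close>).
\<close>

section \<open>Eigenvectors\<close>

lemma (in vector_space) eigenvector_sum_zero:
  assumes T: "Vector_Spaces.linear scale scale T"
    and "finite S" "\<And>j. j \<in> S \<Longrightarrow> T (w j) = scale (\<mu> j) (w j)" "inj_on \<mu> S" "(\<Sum>j\<in>S. w j) = 0"
  shows "\<forall>j\<in>S. w j = 0"
  using assms(2-)
proof (induction S arbitrary: w rule: finite_induct)
  case empty
  then show ?case by simp
next
  case (insert i S)
  interpret T: Vector_Spaces.linear scale scale T by fact
  have sum0: "w i + (\<Sum>j\<in>S. w j) = 0" using insert by simp
  have "0 = T (w i + (\<Sum>j\<in>S. w j)) - scale (\<mu> i) (w i + (\<Sum>j\<in>S. w j))"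
    by (simp add: sum0 T.zero)
  also have "\<dots> = (\<Sum>j\<in>S. scale (\<mu> j - \<mu> i) (w j))"
    using insert.prems(1)
    by (simp add: T.add T.sum scale_right_distrib scale_sum_right scale_left_diff_distrib
        sum_subtractf)
  finally have z: "(\<Sum>j\<in>S. scale (\<mu> j - \<mu> i) (w j)) = 0" by simp
  have "\<forall>j\<in>S. scale (\<mu> j - \<mu> i) (w j) = 0"
  proof (rule insert.IH)
    show "T (scale (\<mu> j - \<mu> i) (w j)) = scale (\<mu> j) (scale (\<mu> j - \<mu> i) (w j))" if "j \<in> S" for j
      using that insert.prems(1)[of j] by (simp add: T.scale mult.commute)
    show "inj_on \<mu> S" using insert.prems(2) by simp
    show "(\<Sum>j\<in>S. scale (\<mu> j - \<mu> i) (w j)) = 0" by (rule z)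
  qed
  moreover have "\<mu> j \<noteq> \<mu> i" if "j \<in> S" for j
    using insert.prems(2) insert.hyps(2) that by (auto simp: inj_on_def)
  ultimately have "\<forall>j\<in>S. w j = 0" by auto
  then show ?case using sum0 by simp
qed

lemma (in vector_space) independent_family:
  assumes "finite I" and "\<And>c. (\<Sum>i\<in>I. scale (c i) (x i)) = 0 \<Longrightarrow> \<forall>i\<in>I. c i = 0"
  shows "inj_on x I" "independent (x ` I)"
proof -
  show inj: "inj_on x I"
  proof (rule inj_onI, rule ccontr)
    fix i j assume ij: "i \<in> I" "j \<in> I" "x i = x j" "i \<noteq> j"
    define c where "c = (\<lambda>k. if k = i then 1 else if k = j then -1 else (0::'a))"
    have "(\<Sum>k\<in>I. scale (c k) (x k)) = (\<Sum>k\<in>{i,j}. scale (c k) (x k))"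
      using ij assms(1) by (intro sum.mono_neutral_right) (auto simp: c_def)
    also have "\<dots> = 0" using ij by (simp add: c_def scale_minus_left)
    finally show False using assms(2)[of c] ij(1) by (auto simp: c_def)
  qed
  show "independent (x ` I)"
  proof
    assume "dependent (x ` I)"
    then obtain c y where c: "(\<Sum>v\<in>x ` I. scale (c v) v) = 0" "y \<in> x ` I" "c y \<noteq> 0"
      using dependent_finite[of "x ` I"] assms(1) by auto
    then have "(\<Sum>i\<in>I. scale (c (x i)) (x i)) = 0"
      by (simp only: sum.reindex[OF inj] o_def)
    then have "\<forall>i\<in>I. c (x i) = 0" by (rule assms(2))
    then show False using c(2,3) by auto
  qed
qed

lemma (in finite_dimensional_vector_space) exists_annihilating_poly:
  assumes T: "Vector_Spaces.linear scale scale T"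
  shows "\<exists>a m. (\<Sum>i\<le>m. scale (a i) ((T ^^ i) u)) = 0 \<and> (\<exists>i\<le>m. a i \<noteq> 0)"
proof -
  define m where "m = dim UNIV"
  let ?g = "\<lambda>i. (T ^^ i) u"
  show ?thesis
  proof (cases "inj_on ?g {..m}")
    case True
    have "dependent (?g ` {..m})"
    proof (rule ccontr)
      assume "\<not> dependent (?g ` {..m})"
      then have "card (?g ` {..m}) \<le> m" unfolding m_def
        by (intro independent_card_le_dim) auto
      then show False using card_image[OF True] by simp
    qed
    then obtain c x where c: "(\<Sum>v\<in>?g ` {..m}. scale (c v) v) = 0" "x \<in> ?g ` {..m}" "c x \<noteq> 0"
      using dependent_finite[of "?g ` {..m}"] by auto
    then have "(\<Sum>i\<le>m. scale (c (?g i)) (?g i)) = 0"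
      by (simp add: sum.reindex[OF True] o_def)
    then show ?thesis using c(2,3) by (intro exI[of _ "\<lambda>i. c (?g i)"] exI[of _ m]) auto
  next
    case False
    then obtain i j where ij: "i \<le> m" "j \<le> m" "i \<noteq> j" "?g i = ?g j"
      by (auto simp: inj_on_def)
    define a where "a = (\<lambda>k. if k = i then 1 else if k = j then -1 else (0::'a))"
    have "(\<Sum>k\<le>m. scale (a k) (?g k)) = (\<Sum>k\<in>{i,j}. scale (a k) (?g k))"
      using ij by (intro sum.mono_neutral_right) (auto simp: a_def)
    also have "\<dots> = 0" using ij by (simp add: a_def scale_minus_left)
    finally show ?thesis using ij by (intro exI[of _ a] exI[of _ m]) (auto simp: a_def)
  qed
qed

text \<open>If p is a polynomial of least degree that
  annihilates u, and p = (x - \<mu>) q, then q applied to u is an eigenvector, and it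
  is in every invariant subspace that contains u.\<close>

lemma exists_eigenvector:
  fixes scale :: "complex \<Rightarrow> 'v::ab_group_add \<Rightarrow> 'v"
  assumes fd: "finite_dimensional_vector_space scale Bs"
    and T: "Vector_Spaces.linear scale scale T"
    and U: "module.subspace scale U" "T ` U \<subseteq> U" "u \<in> U" "u \<noteq> 0"
  shows "\<exists>\<mu> w. w \<in> U \<and> w \<noteq> 0 \<and> T w = scale \<mu> w"
proof -
  interpret finite_dimensional_vector_space scale Bs by fact
  interpret T: Vector_Spaces.linear scale scale T by fact
  define act where "act = (\<lambda>p v. \<Sum>i\<le>degree p. scale (poly.coeff p i) ((T ^^ i) v))"
  have act_bound: "act p v = (\<Sum>i\<le>m. scale (poly.coeff p i) ((T ^^ i) v))" if "degree p \<le> m" for p v m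
    unfolding act_def using that
    by (intro sum.mono_neutral_left) (auto simp: coeff_eq_0)
  have act_pCons: "act (pCons a p) v = scale a v + T (act p v)" for a p v
  proof -
    have "act (pCons a p) v = (\<Sum>i\<le>Suc (degree p). scale (poly.coeff (pCons a p) i) ((T ^^ i) v))"
      by (rule act_bound) (simp add: degree_pCons_le)
    also have "\<dots> = scale a v + (\<Sum>i\<le>degree p. scale (poly.coeff p i) (T ((T ^^ i) v)))"
      by (subst sum.atMost_Suc_shift) simp
    also have "\<dots> = scale a v + T (act p v)"
      by (simp add: act_def T.sum T.scale)
    finally show ?thesis .
  qed
  have act_smult: "act (smult c p) v = scale c (act p v)" for c p v
  proof -
    have "act (smult c p) v = (\<Sum>i\<le>degree p. scale (poly.coeff (smult c p) i) ((T ^^ i) v))"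
      by (rule act_bound) (rule degree_smult_le)
    then show ?thesis by (simp add: act_def scale_sum_right)
  qed
  have act_add: "act (p + q) v = act p v + act q v" for p q v
  proof -
    let ?m = "max (degree p) (degree q)"
    show ?thesis
      using act_bound[of "p + q" ?m v] act_bound[of p ?m v] act_bound[of q ?m v]
      by (simp add: degree_add_le scale_left_distrib sum.distrib)
  qed
  have TU: "(T ^^ i) v \<in> U" if "v \<in> U" for i v
    using that U(2) by (induction i) auto
  have actU: "act p v \<in> U" if "v \<in> U" for p v
    unfolding act_def using that TU U(1) by (intro subspace_sum subspace_scale) auto
  obtain a m where am: "(\<Sum>i\<le>m. scale (a i) ((T ^^ i) u)) = 0" "\<exists>i\<le>m. a i \<noteq> 0"
    using exists_annihilating_poly[OF T] by blast
  define P where "P = {p. p \<noteq> 0 \<and> act p u = 0}"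
  define p0 where "p0 = (\<Sum>i\<le>m. monom (a i) i)"
  have cf: "poly.coeff p0 i = (if i \<le> m then a i else 0)" for i
    unfolding p0_def by (simp add: coeff_sum)
  have "p0 \<in> P"
  proof -
    have "p0 \<noteq> 0" using am(2) cf by (metis coeff_0)
    moreover have "degree p0 \<le> m" by (rule degree_le) (simp add: cf)
    then have "act p0 u = (\<Sum>i\<le>m. scale (poly.coeff p0 i) ((T ^^ i) u))" by (rule act_bound)
    then have "act p0 u = 0" using am(1) by (simp add: cf)
    ultimately show ?thesis by (simp add: P_def)
  qed
  then obtain p where p: "p \<in> P" "\<And>q. q \<in> P \<Longrightarrow> degree p \<le> degree q"
    using arg_min_nat_lemma[of "\<lambda>p. p \<in> P" p0 degree] by blast
  have "degree p \<noteq> 0"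
  proof
    assume "degree p = 0"
    then obtain c where "p = [:c:]" using degree_eq_zeroE by blast
    then show False using p(1) U(4) by (auto simp: P_def act_def)
  qed
  then obtain \<mu> where "poly p \<mu> = 0"
    using fundamental_theorem_of_algebra[of p] constant_degree[of p] by auto
  then obtain q where q: "p = [:- \<mu>, 1:] * q" by (metis poly_eq_0_iff_dvd dvdE)
  have pq: "act p v = T (act q v) - scale \<mu> (act q v)" for v
  proof -
    have "p = smult (- \<mu>) q + pCons 0 q" by (simp add: q)
    then have "act p v = act (smult (- \<mu>) q) v + act (pCons 0 q) v" by (simp only: act_add)
    then show ?thesis by (simp add: act_smult act_pCons scale_minus_left del: smult_minus_left)
  qed
  have "q \<noteq> 0" using p(1) q by (auto simp: P_def)
  then have "degree p = degree [:- \<mu>, 1:] + degree q" unfolding q by (intro degree_mult_eq) auto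
  then have "degree q < degree p" by simp
  then have "act q u \<noteq> 0" using p(2)[of q] \<open>q \<noteq> 0\<close> by (auto simp: P_def)
  moreover have "T (act q u) = scale \<mu> (act q u)"
    using pq[of u] p(1) by (simp add: P_def)
  ultimately show ?thesis using actU[OF U(3)] by blast
qed

section \<open>Finite-dimensional modules over the Lie algebra sl2\<close>

locale sl2_module = finite_dimensional_vector_space scale Bs
  for scale :: "complex \<Rightarrow> 'v::ab_group_add \<Rightarrow> 'v" and Bs +
  fixes e f h :: "'v \<Rightarrow> 'v"
  assumes lin_e: "Vector_Spaces.linear scale scale e"
    and lin_f: "Vector_Spaces.linear scale scale f"
    and lin_h: "Vector_Spaces.linear scale scale h"
    and ef: "e (f v) - f (e v) = h v"
    and he: "h (e v) - e (h v) = scale 2 (e v)"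
    and hf: "h (f v) - f (h v) = - scale 2 (f v)"
begin

sublocale e: Vector_Spaces.linear scale scale e by (rule lin_e)
sublocale f: Vector_Spaces.linear scale scale f by (rule lin_f)
sublocale h: Vector_Spaces.linear scale scale h by (rule lin_h)

lemma linear_funpow: "Vector_Spaces.linear scale scale T \<Longrightarrow> Vector_Spaces.linear scale scale (T ^^ k)"
  by (induction k) (auto intro: Vector_Spaces.linear_compose simp: linear_id)

lemma h_e_power: "h ((e ^^ k) v) = (e ^^ k) (h v) + scale (2 * of_nat k) ((e ^^ k) v)"
proof (induction k)
  case (Suc k)
  have "h (e ((e ^^ k) v)) = e (h ((e ^^ k) v)) + scale 2 (e ((e ^^ k) v))"
    using he[of "(e ^^ k) v"] by (simp add: algebra_simps)
  then show ?case by (simp add: Suc e.add e.scale scale_left_distrib algebra_simps)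
qed simp

text \<open>The kernels of the powers of e stabilise, so e is injective on the image of some power.  This image is
  stable under h.  If it were nonzero, then e would generate from an eigenvector of h infinitely many
  eigenvectors with distinct eigenvalues.\<close>

lemma e_nilpotent: "\<exists>M. \<forall>v. (e ^^ M) v = 0"
proof (rule ccontr)
  assume nn: "\<nexists>M. \<forall>v. (e ^^ M) v = 0"
  interpret ek: Vector_Spaces.linear scale scale "e ^^ k" for k by (rule linear_funpow[OF lin_e])
  let ?K = "\<lambda>k. {v. (e ^^ k) v = 0}"
  have sub: "subspace (?K k)" for k by (rule ek.subspace_kernel)
  have mono: "?K k \<subseteq> ?K (Suc k)" for k by (auto simp: e.zero)
  have "\<exists>N. ?K (Suc N) = ?K N"
  proof (rule ccontr)
    assume "\<nexists>N. ?K (Suc N) = ?K N"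
    then have lt: "dim (?K k) < dim (?K (Suc k))" for k
      using subspace_dim_equal[OF sub sub mono[of k]] by (metis not_less)
    have "k \<le> dim (?K k)" for k
    proof (induction k)
      case (Suc k) then show ?case using lt[of k] by linarith
    qed simp
    from this[of "Suc dimension"] show False
      using dim_subset_UNIV[of "?K (Suc dimension)"] by simp
  qed
  then obtain N where N: "?K (Suc N) = ?K N" by blast
  let ?U = "range (e ^^ N)"
  have inj: "x = 0" if x: "x \<in> ?U" "e x = 0" for x
  proof -
    obtain v where v: "x = (e ^^ N) v" using x by auto
    then have "v \<in> ?K (Suc N)" using x by simp
    then show ?thesis using N v by auto
  qed
  obtain v0 where "(e ^^ N) v0 \<noteq> 0" using nn by blast
  moreover have "h ` ?U \<subseteq> ?U"
  proof safe
    fix v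
    have "h ((e ^^ N) v) = (e ^^ N) (h v + scale (2 * of_nat N) v)"
      by (simp add: h_e_power ek.add ek.scale)
    then show "h ((e ^^ N) v) \<in> ?U" by blast
  qed
  moreover have "subspace ?U" by (rule ek.subspace_image) (rule subspace_UNIV)
  ultimately obtain \<mu> w where w: "w \<in> ?U" "w \<noteq> 0" "h w = scale \<mu> w"
    using exists_eigenvector[OF finite_dimensional_vector_space_axioms lin_h, of ?U "(e ^^ N) v0"]
    by blast
  define g where "g = (\<lambda>k. (e ^^ k) w)"
  have gU: "g k \<in> ?U" for k
  proof (induction k)
    case (Suc k)
    then obtain v where "g k = (e ^^ N) v" by auto
    then have "g (Suc k) = (e ^^ N) (e v)" by (simp add: g_def funpow_swap1)
    then show ?case by blast
  qed (simp add: g_def w)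
  have g0: "g k \<noteq> 0" for k
  proof (induction k)
    case (Suc k) then show ?case using inj[OF gU[of k]] by (auto simp: g_def)
  qed (simp add: g_def w)
  have hg: "h (g k) = scale (\<mu> + 2 * of_nat k) (g k)" for k
    by (simp add: g_def h_e_power w scale_left_distrib ek.scale)
  have lin_indep: "\<forall>k\<in>{..dimension}. c k = 0" if c: "(\<Sum>k\<in>{..dimension}. scale (c k) (g k)) = 0" for c
  proof -
    have "h (scale (c k) (g k)) = scale (\<mu> + 2 * of_nat k) (scale (c k) (g k))" for k
      by (simp add: h.scale hg mult.commute)
    moreover have "inj_on (\<lambda>k. \<mu> + 2 * of_nat k) {..dimension}" by (rule inj_onI) simp
    ultimately have "\<forall>k\<in>{..dimension}. scale (c k) (g k) = 0"
      by (intro eigenvector_sum_zero[OF lin_h finite_atMost _ _ c]) assumption+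
    then show ?thesis using g0 by simp
  qed
  have inj_g: "inj_on g {..dimension}"
    by (rule independent_family(1), simp, rule lin_indep)
  have "independent (g ` {..dimension})"
    by (rule independent_family(2), simp, rule lin_indep)
  then have "card (g ` {..dimension}) \<le> dim (UNIV :: 'v set)" by (intro independent_card_le_dim) auto
  then show False using inj_g by (simp add: card_image dimension_def)
qed


text \<open>Exchanging e with f and negating h turns statements about e into statements about f.\<close>

lemma opposite: "sl2_module scale Bs f e (\<lambda>v. - h v)"
proof -
  have "- h (x + y) = - h x + - h y" "- h (scale c x) = scale c (- h x)" for x y c
    by (simp_all add: h.add h.scale)
  then have "Vector_Spaces.linear scale scale (\<lambda>v. - h v)"
    by (intro Vector_Spaces.linear.intro vector_space_axioms module_hom.intro module_axioms
         module_hom_axioms.intro)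
  moreover have "f (e v) - e (f v) = - h v" for v
  proof -
    have "f (e v) - e (f v) = - (e (f v) - f (e v))" by simp
    then show ?thesis unfolding ef .
  qed
  moreover have "- h (f v) - f (- h v) = scale 2 (f v)" for v
  proof -
    have "- h (f v) - f (- h v) = - (h (f v) - f (h v))" by (simp add: f.neg)
    then show ?thesis unfolding hf by simp
  qed
  moreover have "- h (e v) - e (- h v) = - scale 2 (e v)" for v
  proof -
    have "- h (e v) - e (- h v) = - (h (e v) - e (h v))" by (simp add: e.neg)
    then show ?thesis unfolding he .
  qed
  ultimately show ?thesis
    using lin_e lin_f finite_dimensional_vector_space_axioms
    by (intro sl2_module.intro sl2_module_axioms.intro) assumption+
qed


end

context sl2_module begin

sublocale ek: Vector_Spaces.linear scale scale "e ^^ k" for k by (rule linear_funpow[OF lin_e])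
sublocale fk: Vector_Spaces.linear scale scale "f ^^ k" for k by (rule linear_funpow[OF lin_f])

lemma f_nilpotent: "\<exists>M. \<forall>v. (f ^^ M) v = 0"
  by (rule sl2_module.e_nilpotent[OF opposite])

lemma h_f_power: "h ((f ^^ k) v) = (f ^^ k) (h v) - scale (2 * of_nat k) ((f ^^ k) v)"
proof (induction k)
  case (Suc k)
  have "h (f ((f ^^ k) v)) = f (h ((f ^^ k) v)) - scale 2 (f ((f ^^ k) v))"
    using hf[of "(f ^^ k) v"] by (simp add: algebra_simps)
  then show ?case by (simp add: Suc f.diff f.scale scale_left_distrib algebra_simps)
qed simp

lemma e_f_power:
  "e ((f ^^ Suc k) v) = (f ^^ Suc k) (e v) + scale (of_nat (Suc k)) ((f ^^ k) (h v - scale (of_nat k) v))"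
proof (induction k)
  case 0
  then show ?case using ef[of v] by (simp add: algebra_simps)
next
  case (Suc k)
  have "e ((f ^^ Suc (Suc k)) v) = f (e ((f ^^ Suc k) v)) + h ((f ^^ Suc k) v)"
    using ef[of "(f ^^ Suc k) v"] by (simp add: algebra_simps)
  also have "f (e ((f ^^ Suc k) v))
      = f ((f ^^ Suc k) (e v) + scale (of_nat (Suc k)) ((f ^^ k) (h v - scale (of_nat k) v)))"
    using Suc by (rule arg_cong)
  also have "\<dots> = (f ^^ Suc (Suc k)) (e v)
      + (scale (of_nat (Suc k)) ((f ^^ Suc k) (h v)) - scale (of_nat (Suc k) * of_nat k) ((f ^^ Suc k) v))"
    by (simp add: f.add f.scale fk.diff fk.scale f.diff scale_right_diff_distrib)
  also have "h ((f ^^ Suc k) v) = (f ^^ Suc k) (h v) - scale (2 * of_nat (Suc k)) ((f ^^ Suc k) v)"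
    by (rule h_f_power)
  also have "(f ^^ Suc (Suc k)) (e v)
      + (scale (of_nat (Suc k)) ((f ^^ Suc k) (h v)) - scale (of_nat (Suc k) * of_nat k) ((f ^^ Suc k) v))
      + ((f ^^ Suc k) (h v) - scale (2 * of_nat (Suc k)) ((f ^^ Suc k) v)) = (f ^^ Suc (Suc k)) (e v) + (scale (of_nat (Suc k) + 1) ((f ^^ Suc k) (h v))
      - scale (of_nat (Suc k) * of_nat k + 2 * of_nat (Suc k)) ((f ^^ Suc k) v))"
    by (simp only: scale_left_distrib scale_one) (simp only: algebra_simps)
  also have "of_nat (Suc k) * of_nat k + 2 * of_nat (Suc k) = (of_nat (Suc (Suc k)) * of_nat (Suc k) :: complex)"
    by (simp add: algebra_simps)
  also have "of_nat (Suc k) + 1 = (of_nat (Suc (Suc k)) :: complex)" by simp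
  finally show ?case
    by (simp only: fk.diff fk.scale scale_right_diff_distrib scale_scale)
qed

text \<open>If d + 1 is the least power of f that kills b, then applying e to this power gives
  (d + 1) (\<mu> - d) times the nonzero vector f^d b.\<close>

lemma highest_weight_nat:
  assumes b: "e b = 0" "h b = scale \<mu> b" "b \<noteq> 0"
  shows "\<exists>d::nat. \<mu> = of_nat d \<and> (f ^^ Suc d) b = 0 \<and> (\<forall>k\<le>d. (f ^^ k) b \<noteq> 0)"
proof -
  define K where "K = (LEAST k. (f ^^ k) b = 0)"
  have ex: "\<exists>k. (f ^^ k) b = 0" using f_nilpotent by blast
  have K: "(f ^^ K) b = 0" unfolding K_def using ex by (rule LeastI_ex)
  have min: "(f ^^ k) b \<noteq> 0" if "k < K" for k using that unfolding K_def by (rule not_less_Least)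
  obtain d where d: "K = Suc d" using K b(3) by (cases K) auto
  have "scale (of_nat (Suc d) * (\<mu> - of_nat d)) ((f ^^ d) b) = 0"
    using e_f_power[of d b] K
    by (simp add: d b e.zero fk.zero fk.diff fk.scale f.zero
        flip: scale_left_diff_distrib del: of_nat_Suc)
  then have "\<mu> = of_nat d" using min[of d] by (simp add: d del: of_nat_Suc)
  then show ?thesis using K min by (auto simp: d)
qed

text \<open>The operator h (h - 1) ... (h - m + 1).  On the kernel of e the operator e^m f^m is m! times it, so it
  vanishes there for large m.  As its roots are simple, this makes h diagonalisable on the kernel of e,
  with eigenvalues in the natural numbers.\<close>

fun falling_h :: "nat \<Rightarrow> 'v \<Rightarrow> 'v" where
  "falling_h 0 v = v"
| "falling_h (Suc m) v = falling_h m (h v - scale (of_nat m) v)"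

text \<open>Partial fractions for simple roots, carried out one root at a time inside an h-stable subspace.\<close>

lemma falling_h_decompose:
  assumes "falling_h m v = 0" "subspace U" "h ` U \<subseteq> U" "v \<in> U"
  shows "\<exists>w. v = (\<Sum>j<m. w j) \<and> (\<forall>j. h (w j) = scale (of_nat j) (w j) \<and> w j \<in> U)"
  using assms(1,4)
proof (induction m arbitrary: v)
  case 0
  then show ?case using assms(2) by (intro exI[of _ "\<lambda>_. 0"]) (auto simp: h.zero subspace_0)
next
  case (Suc m)
  have "h v - scale (of_nat m) v \<in> U"
    using Suc.prems assms(2,3) by (auto intro!: subspace_diff subspace_scale)
  then obtain w where w: "h v - scale (of_nat m) v = (\<Sum>j<m. w j)"
    "\<And>j. h (w j) = scale (of_nat j) (w j)" "\<And>j. w j \<in> U"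
    using Suc.IH[of "h v - scale (of_nat m) v"] Suc.prems by auto
  define w1 where "w1 = (\<lambda>j. scale (1 / (of_nat j - of_nat m)) (w j))"
  define w' where "w' = (\<lambda>j. if j < m then w1 j else if j = m then v - (\<Sum>j<m. w1 j) else 0)"
  have w1: "h (w1 j) = scale (of_nat j) (w1 j)" "w1 j \<in> U" for j
    using assms(2) by (auto simp: w1_def h.scale w mult.commute intro: subspace_scale)
  have "h (w1 j) - scale (of_nat m) (w1 j) = w j" if "j < m" for j
  proof -
    have "of_nat j - of_nat m \<noteq> (0::complex)" using that by simp
    then have "of_nat j * (1 / (of_nat j - of_nat m)) - of_nat m * (1 / (of_nat j - of_nat m)) = (1::complex)"
      by (simp add: diff_divide_distrib[symmetric])
    then show ?thesis unfolding w1
      by (simp only: w1_def scale_scale scale_one flip: scale_left_diff_distrib)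
  qed
  then have "(\<Sum>j<m. h (w1 j)) - scale (of_nat m) (\<Sum>j<m. w1 j) = (\<Sum>j<m. w j)"
    by (simp add: scale_sum_right flip: sum_subtractf)
  then have "h (v - (\<Sum>j<m. w1 j)) = scale (of_nat m) (v - (\<Sum>j<m. w1 j))"
    using w(1) by (simp add: h.diff h.sum algebra_simps)
  moreover have "v - (\<Sum>j<m. w1 j) \<in> U"
    using Suc.prems assms(2) w1 by (auto intro!: subspace_diff subspace_sum)
  ultimately have "\<forall>j. h (w' j) = scale (of_nat j) (w' j) \<and> w' j \<in> U"
    using w1 assms(2) by (auto simp: w'_def h.zero subspace_0)
  moreover have "v = (\<Sum>j<Suc m. w' j)" by (simp add: w'_def)
  ultimately show ?case by blast
qed

text \<open>The hypothesis f (e v) = 0 covers the kernel of e, and also the vectors in \<open>strings_span\<close> that e maps to the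
  kernel of f.  Under it, e f^(m+1) v = 0 reads f^m (h - m) v = 0, which trades a power of f for a factor of the product.\<close>

lemma falling_h_fe_kernel:
  assumes "f (e v) = 0" "(f ^^ m) v = 0"
  shows "falling_h m v = 0"
  using assms
proof (induction m arbitrary: v)
  case (Suc m)
  have "(f ^^ Suc m) (e v) = (f ^^ m) (f (e v))" by (simp add: funpow_swap1)
  then have "(f ^^ Suc m) (e v) = 0" using Suc.prems(1) fk.zero by simp
  then have "(f ^^ m) (h v - scale (of_nat m) v) = 0"
    using e_f_power[of m v] Suc.prems(2) by (simp add: e.zero del: of_nat_Suc funpow.simps)
  moreover have "f (e (h v - scale (of_nat m) v)) = 0"
  proof -
    have "e (h v) = h (e v) - scale 2 (e v)" using he[of v] by (simp add: algebra_simps)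
    moreover have "f (h (e v)) = h (f (e v)) + scale 2 (f (e v))" using hf[of "e v"] by (simp add: algebra_simps)
    ultimately show ?thesis using Suc.prems(1)
      by (simp add: e.diff e.scale f.diff f.scale h.zero)
  qed
  ultimately show ?case using Suc.IH by simp
qed simp

lemma fe_kernel_decompose:
  assumes "f (e v) = 0"
  shows "\<exists>m w. v = (\<Sum>j<m. w j) \<and> (\<forall>j. h (w j) = scale (of_nat j) (w j) \<and> f (e (w j)) = 0)"
proof -
  obtain m where "(f ^^ m) v = 0" using f_nilpotent by blast
  let ?U = "{v. f (e v) = 0}"
  have "subspace ?U" by (auto simp: subspace_def e.add f.add e.scale f.scale e.zero f.zero)
  moreover have "h ` ?U \<subseteq> ?U"
  proof safe
    fix v assume v: "f (e v) = 0"
    have "e (h v) = h (e v) - scale 2 (e v)" using he[of v] by (simp add: algebra_simps)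
    moreover have "f (h (e v)) = h (f (e v)) + scale 2 (f (e v))" using hf[of "e v"] by (simp add: algebra_simps)
    ultimately show "f (e (h v)) = 0" using v by (simp add: f.diff f.scale h.zero)
  qed
  ultimately show ?thesis
    using falling_h_decompose[of m v ?U] falling_h_fe_kernel[OF assms \<open>(f ^^ m) v = 0\<close>] assms by auto
qed

lemma kernel_eigenbasis:
  "\<exists>B. independent B \<and> span B = {v. e v = 0} \<and> (\<forall>b\<in>B. \<exists>d::nat. h b = scale (of_nat d) b)"
proof -
  let ?E = "{v. e v = 0 \<and> (\<exists>d::nat. h v = scale (of_nat d) v)}"
  have "v \<in> span ?E" if ev: "e v = 0" for v
  proof -
    obtain m where m: "(f ^^ m) v = 0" using f_nilpotent by blast
    have "subspace {v. e v = 0}" by (rule e.subspace_kernel)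
    moreover have "h ` {v. e v = 0} \<subseteq> {v. e v = 0}"
    proof safe
      fix v assume "e v = 0"
      then show "e (h v) = 0" using he[of v] by (simp add: h.zero)
    qed
    moreover have "falling_h m v = 0" using falling_h_fe_kernel[of v m] m ev by (simp add: f.zero)
    ultimately obtain w where w: "v = (\<Sum>j<m. w j)" "\<And>j. h (w j) = scale (of_nat j) (w j)" "\<And>j. e (w j) = 0"
      using falling_h_decompose[of m v "{v. e v = 0}"] ev by auto
    have "w j \<in> ?E" for j using w by blast
    then show ?thesis unfolding w(1) by (intro span_sum span_base)
  qed
  moreover obtain B where B: "B \<subseteq> ?E" "independent B" "?E \<subseteq> span B"
    using maximal_independent_subset[of ?E] by blast
  moreover have "span B \<subseteq> {v. e v = 0}"
    using B(1) by (intro span_minimal e.subspace_kernel) auto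
  ultimately have "span B = {v. e v = 0}"
    using span_minimal[OF B(3) subspace_span] by blast
  then show ?thesis using B by blast
qed


lemma e_f_highest:
  assumes "e b = 0" "h b = scale (of_nat d) b"
  shows "e ((f ^^ Suc k) b) = scale (of_nat (Suc k) * (of_nat d - of_nat k)) ((f ^^ k) b)"
proof -
  have "(f ^^ Suc k) (e b) = 0" unfolding assms by (rule fk.zero)
  moreover have "h b - scale (of_nat k) b = scale (of_nat d - of_nat k) b"
    by (simp add: assms scale_left_diff_distrib)
  ultimately show ?thesis unfolding e_f_power by (simp only: fk.scale scale_scale add_0_left)
qed

lemma e_power_f_power:
  assumes "e b = 0" "h b = scale (of_nat d) b" "k \<le> d"
  shows "j \<le> k \<Longrightarrow> \<exists>\<gamma>. \<gamma> \<noteq> 0 \<and> (e ^^ j) ((f ^^ k) b) = scale \<gamma> ((f ^^ (k - j)) b)"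
proof (induction j)
  case 0
  show ?case by (intro exI[of _ 1]) simp
next
  case (Suc j)
  then obtain \<gamma> where \<gamma>: "\<gamma> \<noteq> 0" "(e ^^ j) ((f ^^ k) b) = scale \<gamma> ((f ^^ (k - j)) b)" by auto
  obtain i where i: "k - j = Suc i" using Suc.prems by (metis Suc_diff_le diff_Suc_Suc)
  then have "i < d" using assms(3) by linarith
  then have "of_nat (Suc i) * (of_nat d - of_nat i) \<noteq> (0::complex)" by (simp del: of_nat_Suc)
  moreover have "(e ^^ Suc j) ((f ^^ k) b)
      = scale (\<gamma> * (of_nat (Suc i) * (of_nat d - of_nat i))) ((f ^^ (k - Suc j)) b)"
  proof -
    have "k - Suc j = i" using i by linarith
    then show ?thesis using \<gamma>(2) e_f_highest[OF assms(1,2), of i]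
      by (simp add: i e.scale del: of_nat_Suc funpow.simps(2)) (simp add: i \<gamma>(2) e.scale)
  qed
  ultimately show ?case using \<gamma>(1) by (metis mult_eq_0_iff)
qed

lemma e_power_f_power_zero:
  assumes "e b = 0" "h b = scale (of_nat d) b" "k \<le> d" "k < j"
  shows "(e ^^ j) ((f ^^ k) b) = 0"
proof -
  obtain \<gamma> where "(e ^^ k) ((f ^^ k) b) = scale \<gamma> b"
    using e_power_f_power[OF assms(1-3) order_refl] by auto
  then have "(e ^^ Suc k) ((f ^^ k) b) = 0" using assms(1) by (simp add: e.scale)
  moreover obtain i where "j = i + Suc k" using assms(4) less_iff_Suc_add by (metis add.commute add_Suc_right)
  ultimately show ?thesis by (simp only: funpow_add o_apply ek.zero)
qed

text \<open>If m is the largest exponent with a nonzero coefficient, then e^m reduces the relation to a relation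
  between the elements of B.\<close>

lemma strings_independent:
  assumes B: "finite B" "independent B" "\<And>b. b \<in> B \<Longrightarrow> e b = 0 \<and> h b = scale (of_nat (d b)) b"
    and c: "(\<Sum>b\<in>B. \<Sum>k\<le>d b. scale (c b k) ((f ^^ k) b)) = 0"
  shows "\<forall>b\<in>B. \<forall>k\<le>d b. c b k = 0"
proof (rule ccontr)
  assume *: "\<not> ?thesis"
  define N where "N = {k. \<exists>b\<in>B. k \<le> d b \<and> c b k \<noteq> 0}"
  have "N \<subseteq> (\<Union>b\<in>B. {..d b})" by (auto simp: N_def)
  then have fin: "finite N" using B(1) finite_subset by blast
  have "N \<noteq> {}" using * by (auto simp: N_def)
  define m where "m = Max N"
  have m: "m \<in> N" "\<And>k. k \<in> N \<Longrightarrow> k \<le> m" using fin \<open>N \<noteq> {}\<close> by (auto simp: m_def)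
  have "\<exists>\<gamma>. (e ^^ m) (\<Sum>k\<le>d b. scale (c b k) ((f ^^ k) b)) = scale \<gamma> b \<and> (m \<le> d b \<longrightarrow> c b m \<noteq> 0 \<longrightarrow> \<gamma> \<noteq> 0)"
    if b: "b \<in> B" for b
  proof -
    \<comment> \<open>e^m kills the terms with k < m, and the coefficients with k > m are zero\<close>
    have tm: "scale (c b k) ((e ^^ m) ((f ^^ k) b)) = 0" if "k \<le> d b" "k \<noteq> m" for k
    proof (cases "k < m")
      case True
      then show ?thesis using e_power_f_power_zero[of b "d b" k m] B(3)[OF b] that by simp
    next
      case False
      then have "c b k = 0" using m(2)[of k] that b by (auto simp: N_def)
      then show ?thesis by simp
    qed
    have "(e ^^ m) (\<Sum>k\<le>d b. scale (c b k) ((f ^^ k) b)) = (\<Sum>k\<le>d b. scale (c b k) ((e ^^ m) ((f ^^ k) b)))"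
      by (simp add: ek.sum ek.scale)
    also have "\<dots> = (\<Sum>k\<in>{..d b} \<inter> {m}. scale (c b k) ((e ^^ m) ((f ^^ k) b)))"
      using tm by (intro sum.mono_neutral_right) auto
    finally have eq: "(e ^^ m) (\<Sum>k\<le>d b. scale (c b k) ((f ^^ k) b)) = \<dots>" .
    show ?thesis
    proof (cases "m \<le> d b")
      case True
      then obtain \<gamma> where "\<gamma> \<noteq> 0" "(e ^^ m) ((f ^^ m) b) = scale \<gamma> b"
        using e_power_f_power[of b "d b" m m] B(3)[OF b] by auto
      then show ?thesis using True unfolding eq by (intro exI[of _ "c b m * \<gamma>"]) auto
    next
      case False
      then have "{..d b} \<inter> {m} = {}" by auto
      then show ?thesis using False unfolding eq by (intro exI[of _ 0]) auto
    qed
  qed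
  then obtain \<gamma> where \<gamma>: "\<And>b. b \<in> B \<Longrightarrow> (e ^^ m) (\<Sum>k\<le>d b. scale (c b k) ((f ^^ k) b)) = scale (\<gamma> b) b"
    "\<And>b. b \<in> B \<Longrightarrow> m \<le> d b \<Longrightarrow> c b m \<noteq> 0 \<Longrightarrow> \<gamma> b \<noteq> 0"
    by metis
  have "(\<Sum>b\<in>B. scale (\<gamma> b) b) = (e ^^ m) (\<Sum>b\<in>B. \<Sum>k\<le>d b. scale (c b k) ((f ^^ k) b))"
    using \<gamma>(1) by (simp add: ek.sum)
  then have "(\<Sum>b\<in>B. scale (\<gamma> b) b) = 0" using c ek.zero by simp
  then have "\<forall>b\<in>B. \<gamma> b = 0" using B(1,2) independentD[of B B \<gamma>] by blast
  moreover obtain b where "b \<in> B" "m \<le> d b" "c b m \<noteq> 0" using m(1) by (auto simp: N_def)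
  ultimately show False using \<gamma>(2) by blast
qed

text \<open>All vectors of the strings but the lowest ones are images under e, so every u in the span S is e s + l with s in S
  and l in the kernel of f with h-eigenvalues at most 0 (the set L below).  If S were not everything, nilpotency of e
  would give v outside S with e v in S.  Writing e v = e s + l, the vector e (v - s) = l is killed by f, so
  v - s is a sum of h-eigenvectors with eigenvalues at least 0 and e (v - s) is one with eigenvalues at least 2.
  Comparison with the eigenvalues of l gives l = 0, so v - s is in the kernel of e, which lies in S.\<close>

lemma strings_span:
  assumes B: "span B = {v. e v = 0}" "\<And>b. b \<in> B \<Longrightarrow> h b = scale (of_nat (d b)) b" "0 \<notin> B"
  shows "span {(f ^^ k) b |b k. b \<in> B \<and> k \<le> d b} = UNIV"
proof (rule ccontr)
  let ?S = "span {(f ^^ k) b |b k. b \<in> B \<and> k \<le> d b}"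
  let ?L = "{l. f l = 0 \<and> (\<exists>m w. l = (\<Sum>j<m. w j) \<and> (\<forall>j. h (w j) = scale (- of_nat j) (w j)))}"
  assume "?S \<noteq> UNIV"
  have eb: "e b = 0" if "b \<in> B" for b using B(1) that span_base[of b B] by auto
  have "B \<subseteq> ?S"
  proof
    fix b assume "b \<in> B"
    then have "(f ^^ 0) b \<in> {(f ^^ k) b |b k. b \<in> B \<and> k \<le> d b}" by blast
    from span_base[OF this] show "b \<in> ?S" by simp
  qed
  then have ker: "v \<in> ?S" if "e v = 0" for v
    using that B(1) span_minimal[OF \<open>B \<subseteq> ?S\<close> subspace_span] by blast
  have L_add: "\<exists>m w. l + l' = (\<Sum>j<m. w j) \<and> (\<forall>j. h (w j) = scale (- of_nat j) (w j))"
    if "l = (\<Sum>j<m. w j)" "\<forall>j. h (w j) = scale (- of_nat j) (w j)"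
       "l' = (\<Sum>j<m'. w' j)" "\<forall>j. h (w' j) = scale (- of_nat j) (w' j)" for l l' m m' w w'
  proof -
    define u where "u = (\<lambda>j. (if j < m then w j else 0) + (if j < m' then w' j else 0))"
    have "l = (\<Sum>j<max m m'. if j < m then w j else 0)" "l' = (\<Sum>j<max m m'. if j < m' then w' j else 0)"
      unfolding that(1,3) by (intro sum.mono_neutral_cong_left; auto)+
    then have "l + l' = (\<Sum>j<max m m'. u j)" by (simp add: u_def sum.distrib)
    moreover have "\<forall>j. h (u j) = scale (- of_nat j) (u j)"
      using that(2,4) by (auto simp: u_def h.add h.zero scale_right_distrib)
    ultimately show ?thesis by blast
  qed
  have dec: "\<exists>s\<in>?S. \<exists>l\<in>?L. u = e s + l" if "u \<in> ?S" for u
    using that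
  proof (induction rule: span_induct_alt)
    case base
    have "\<exists>m w. 0 = (\<Sum>j<m. w j) \<and> (\<forall>j::nat. h (w j) = scale (- of_nat j) (w j))"
      by (intro exI[of _ "0::nat"] exI[of _ "\<lambda>_. 0"]) (simp add: h.zero)
    then have "0 \<in> ?L" using f.zero by blast
    moreover have "0 = e 0 + 0" by (simp add: e.zero)
    ultimately have "\<exists>l\<in>?L. 0 = e 0 + l" by (rule rev_bexI)
    with span_zero show ?case by (rule rev_bexI)
  next
    case (step c x y)
    then obtain b k where x: "x = (f ^^ k) b" "b \<in> B" "k \<le> d b" by blast
    obtain s l m w where sl: "s \<in> ?S" "f l = 0" "y = e s + l" "l = (\<Sum>j<m. w j)"
       "\<forall>j. h (w j) = scale (- of_nat j) (w j)" using step(2) by blast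
    note eb = eb[OF x(2)] and hb = B(2)[OF x(2)]
    show ?case
    proof (cases "k < d b")
      case True
      define g where "g = of_nat (Suc k) * (of_nat (d b) - of_nat k :: complex)"
      have "g \<noteq> 0" using True by (simp add: g_def del: of_nat_Suc)
      then have "e (scale (c / g) ((f ^^ Suc k) b)) = scale c x"
        using e_f_highest[OF eb hb, of k] by (simp add: e.scale x g_def del: funpow.simps of_nat_Suc)
      then have "scale c x + y = e (scale (c / g) ((f ^^ Suc k) b) + s) + l"
        by (simp add: e.add sl(3) add.assoc)
      moreover have "(f ^^ Suc k) b \<in> ?S" using True x(2) by (intro span_base) (use Suc_leI in blast)
      then have "scale (c / g) ((f ^^ Suc k) b) + s \<in> ?S" using sl(1) by (intro span_add span_scale)
      ultimately show ?thesis using sl by blast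
    next
      case False
      then have k: "k = d b" using x(3) by simp
      have "b \<noteq> 0" using B(3) x(2) by auto
      then have fx: "f x = 0" using highest_weight_nat[OF eb hb] by (auto simp: x k)
      have "h x = (f ^^ k) (h b) - scale (2 * of_nat k) x" unfolding x(1) by (rule h_f_power)
      also have "\<dots> = scale (- of_nat k) x"
        by (simp add: hb k x(1) fk.scale flip: scale_left_diff_distrib)
      finally have hx: "h (scale c x) = scale (- of_nat k) (scale c x)"
        by (simp add: h.scale mult.commute)
      define u where "u = (\<lambda>j. if j = k then scale c x else 0)"
      have "scale c x = (\<Sum>j<Suc k. u j)" by (simp add: u_def)
      moreover have "\<forall>j. h (u j) = scale (- of_nat j) (u j)" using hx by (auto simp: u_def h.zero)
      ultimately have "\<exists>m w. scale c x + l = (\<Sum>j<m. w j) \<and> (\<forall>j. h (w j) = scale (- of_nat j) (w j))"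
        by (rule L_add[OF _ _ sl(4,5)])
      moreover have "f (scale c x + l) = 0" by (simp add: f.add f.scale fx sl(2))
      moreover have "scale c x + y = e s + (scale c x + l)" by (simp add: sl(3))
      ultimately show ?thesis using sl(1) by blast
    qed
  qed
  obtain v0 where v0: "v0 \<notin> ?S" using \<open>?S \<noteq> UNIV\<close> by blast
  obtain M where M: "(e ^^ M) v0 = 0" using e_nilpotent by blast
  define k where "k = (LEAST k. (e ^^ k) v0 \<in> ?S)"
  have "(e ^^ M) v0 \<in> ?S" unfolding M by (rule span_zero)
  then have ex: "\<exists>k. (e ^^ k) v0 \<in> ?S" by (rule exI)
  have k: "(e ^^ k) v0 \<in> ?S" unfolding k_def using ex by (rule LeastI_ex)
  have kmin: "(e ^^ i) v0 \<notin> ?S" if "i < k" for i using that unfolding k_def by (rule not_less_Least)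
  obtain i where i: "k = Suc i" using k v0 by (cases k) auto
  define v where "v = (e ^^ i) v0"
  have v: "v \<notin> ?S" "e v \<in> ?S" using kmin[of i] k by (auto simp: i v_def)
  obtain s l m w where sl: "s \<in> ?S" "f l = 0" "e v = e s + l" "l = (\<Sum>j<m. w j)"
       "\<And>j. h (w j) = scale (- of_nat j) (w j)" using dec[OF v(2)] by blast
  have ev: "e (v - s) = l" by (simp add: e.diff sl(3))
  then obtain m' w' where w': "v - s = (\<Sum>j<m'. w' j)" "\<And>j. h (w' j) = scale (of_nat j) (w' j)"
    using fe_kernel_decompose[of "v - s"] sl(2) by auto
  \<comment> \<open>eigenvectors with the pairwise distinct eigenvalues 0, -1, ..., 1 - m and 2, 3, ..., m' + 1\<close>
  define u where "u = (\<lambda>j. if j < m then w j else - e (w' (j - m)))"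
  define \<mu> :: "nat \<Rightarrow> complex" where "\<mu> = (\<lambda>j. of_int (if j < m then - int j else int (j - m) + 2))"
  have hew: "h (e (w' j)) = scale (of_nat j + 2) (e (w' j))" for j
    using he[of "w' j"] by (simp add: w'(2) e.scale scale_left_distrib algebra_simps)
  have "h (u j) = scale (\<mu> j) (u j)" for j
    by (simp add: u_def \<mu>_def sl(5) hew h.neg scale_minus_right)
  moreover have "inj_on \<mu> {..<m + m'}"
    by (rule inj_onI) (auto simp: \<mu>_def of_int_eq_iff split: if_splits simp del: of_int_minus of_int_add)
  moreover have "(\<Sum>j<m + m'. u j) = 0"
  proof -
    have "(\<Sum>j<m + m'. u j) = (\<Sum>j<m. u j) + (\<Sum>j<m'. u (m + j))"
      by (induction m') (simp_all add: add.assoc)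
    also have "(\<Sum>j<m. u j) = l" by (simp add: u_def sl(4))
    also have "(\<Sum>j<m'. u (m + j)) = - e (v - s)" by (simp add: u_def w'(1) e.sum sum_negf)
    finally show ?thesis using ev by simp
  qed
  ultimately have "\<forall>j\<in>{..<m + m'}. u j = 0"
    using eigenvector_sum_zero[OF lin_h, of "{..<m + m'}" u \<mu>] by blast
  then have "u j = 0" if "j < m" for j using that by simp
  then have "w j = 0" if "j < m" for j using that by (metis u_def)
  then have "l = 0" unfolding sl(4) by (intro sum.neutral) auto
  then have "v - s \<in> ?S" using ev by (intro ker) simp
  then have "v - s + s \<in> ?S" using sl(1) by (rule span_add)
  then show False using v(1) by simp
qed


definition string :: "'v \<Rightarrow> nat \<Rightarrow> 'v set" where
  "string b d = range (\<lambda>c. \<Sum>k\<le>d. scale (c k) ((f ^^ k) b))"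

lemma subspace_string: "subspace (string b d)"
proof (rule subspaceI)
  show "0 \<in> string b d" unfolding string_def by (rule range_eqI[of _ _ "\<lambda>_. 0"]) simp
next
  fix x y assume "x \<in> string b d" "y \<in> string b d"
  then obtain c c' where "x = (\<Sum>k\<le>d. scale (c k) ((f ^^ k) b))" "y = (\<Sum>k\<le>d. scale (c' k) ((f ^^ k) b))"
    by (auto simp: string_def)
  then show "x + y \<in> string b d" unfolding string_def
    by (intro range_eqI[of _ _ "\<lambda>k. c k + c' k"]) (simp add: scale_left_distrib sum.distrib)
next
  fix a x assume "x \<in> string b d"
  then obtain c where "x = (\<Sum>k\<le>d. scale (c k) ((f ^^ k) b))" by (auto simp: string_def)
  then show "scale a x \<in> string b d" unfolding string_def
    by (intro range_eqI[of _ _ "\<lambda>k. a * c k"]) (simp add: scale_sum_right)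
qed

lemma power_in_string: "k \<le> d \<Longrightarrow> (f ^^ k) b \<in> string b d"
  unfolding string_def
  by (rule range_eqI[of _ _ "\<lambda>j. if j = k then 1 else 0"])
     (simp add: if_distrib[of "\<lambda>x. scale x _"] cong: if_cong)

lemma string_minimal:
  assumes "subspace U" "\<And>k. k \<le> d \<Longrightarrow> (f ^^ k) b \<in> U"
  shows "string b d \<subseteq> U"
  using assms by (auto simp: string_def intro!: subspace_sum subspace_scale)

context
  fixes b d
  assumes b: "e b = 0" "h b = scale (of_nat d) b" "b \<noteq> 0"
begin

lemma f_power_Suc_zero: "(f ^^ Suc d) b = 0"
  using highest_weight_nat[OF b] by auto

lemma string_stable:
  assumes v: "v \<in> string b d"
  shows "e v \<in> string b d" "f v \<in> string b d" "h v \<in> string b d"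
proof -
  have "string b d \<subseteq> {v. e v \<in> string b d}"
  proof (rule string_minimal)
    show "subspace {v. e v \<in> string b d}"
      using subspace_string[of b d] by (auto simp: subspace_def e.add e.scale e.zero)
    fix k assume "k \<le> d"
    then show "(f ^^ k) b \<in> {v. e v \<in> string b d}"
      using e_f_highest[OF b(1,2)] b(1) subspace_0[OF subspace_string[of b d]]
        subspace_scale[OF subspace_string[of b d]] power_in_string[of _ d b]
      by (cases k) (auto simp del: funpow.simps(2))
  qed
  then show 1: "e v \<in> string b d" using v by blast
  have "string b d \<subseteq> {v. f v \<in> string b d}"
  proof (rule string_minimal)
    show "subspace {v. f v \<in> string b d}"
      using subspace_string[of b d] by (auto simp: subspace_def f.add f.scale f.zero)
    fix k assume "k \<le> d"
    then show "(f ^^ k) b \<in> {v. f v \<in> string b d}"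
      using f_power_Suc_zero subspace_0[OF subspace_string[of b d]] power_in_string[of "Suc k" d b]
      by (cases "k = d") auto
  qed
  then show 2: "f v \<in> string b d" using v by blast
  have "string b d \<subseteq> {v. h v \<in> string b d}"
  proof (rule string_minimal)
    show "subspace {v. h v \<in> string b d}"
      using subspace_string[of b d] by (auto simp: subspace_def h.add h.scale h.zero)
    fix k assume "k \<le> d"
    then show "(f ^^ k) b \<in> {v. h v \<in> string b d}"
      using subspace_scale[OF subspace_string[of b d]] subspace_diff[OF subspace_string[of b d]]
        power_in_string[of k d b]
      by (auto simp: h_f_power b fk.scale)
  qed
  then show "h v \<in> string b d" using v by blast
qed

lemma single_independent:
  assumes "(\<Sum>k\<le>d. scale (c k) ((f ^^ k) b)) = 0"
  shows "\<forall>k\<le>d. c k = 0"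
  using strings_independent[of "{b}" "\<lambda>_. d" "\<lambda>_. c"] assms b by auto

lemma dim_string: "dim (string b d) = d + 1"
proof -
  let ?B = "(\<lambda>k. (f ^^ k) b) ` {..d}"
  have inj: "inj_on (\<lambda>k. (f ^^ k) b) {..d}"
    by (rule independent_family(1)) (use single_independent in auto)
  have ind: "independent ?B"
    by (rule independent_family(2)) (use single_independent in auto)
  have "card ?B = dim (string b d)"
  proof (rule basis_card_eq_dim)
    show "?B \<subseteq> string b d" using power_in_string by auto
    show "string b d \<subseteq> span ?B" by (rule string_minimal) (auto intro: span_base)
  qed (rule ind)
  then show ?thesis using inj by (simp add: card_image)
qed

text \<open>Applying e^m to a nonzero element of U, with m its largest exponent, gives a nonzero multiple of b.\<close>

lemma string_irreducible:
  assumes U: "subspace U" "U \<subseteq> string b d" "e ` U \<subseteq> U" "f ` U \<subseteq> U"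
  shows "U = {0} \<or> U = string b d"
proof (cases "U \<subseteq> {0}")
  case True
  then show ?thesis using subspace_0[OF U(1)] by blast
next
  case False
  then obtain u where u: "u \<in> U" "u \<noteq> 0" by blast
  then obtain c where c: "u = (\<Sum>k\<le>d. scale (c k) ((f ^^ k) b))" using U(2) by (auto simp: string_def)
  define N where "N = {k. k \<le> d \<and> c k \<noteq> 0}"
  have "N \<noteq> {}" using u(2) c by (auto simp: N_def intro: ccontr)
  moreover have fin: "finite N" by (auto simp: N_def)
  ultimately have m: "Max N \<in> N" "\<And>k. k \<in> N \<Longrightarrow> k \<le> Max N" by auto
  define m where "m = Max N"
  have md: "m \<le> d" "c m \<noteq> 0" using m(1) by (auto simp: N_def m_def)
  obtain \<gamma> where \<gamma>: "\<gamma> \<noteq> 0" "(e ^^ m) ((f ^^ m) b) = scale \<gamma> b"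
    using e_power_f_power[OF b(1,2) md(1) order_refl] by auto
  have "(e ^^ m) u = (\<Sum>k\<le>d. scale (c k) ((e ^^ m) ((f ^^ k) b)))"
    by (simp add: c ek.sum ek.scale)
  also have "\<dots> = (\<Sum>k\<in>{m}. scale (c k) ((e ^^ m) ((f ^^ k) b)))"
  proof (intro sum.mono_neutral_right ballI)
    fix k assume k: "k \<in> {..d} - {m}"
    show "scale (c k) ((e ^^ m) ((f ^^ k) b)) = 0"
    proof (cases "k < m")
      case True
      then show ?thesis using e_power_f_power_zero[OF b(1,2)] k by auto
    next
      case False
      then have "k \<notin> N" using m(2)[of k] k by (auto simp: m_def)
      then have "c k = 0" using k by (auto simp: N_def)
      then show ?thesis by simp
    qed
  qed (use md in auto)
  finally have "(e ^^ m) u = scale (c m * \<gamma>) b" by (simp add: \<gamma>)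
  moreover have "(e ^^ k) u \<in> U" for k using u(1) U(3) by (induction k) auto
  ultimately have "scale (c m * \<gamma>) b \<in> U" by metis
  then have "scale (1 / (c m * \<gamma>)) (scale (c m * \<gamma>) b) \<in> U" by (rule subspace_scale[OF U(1)])
  then have bU: "b \<in> U" using md(2) \<gamma>(1) by simp
  have "(f ^^ k) b \<in> U" for k using bU U(4) by (induction k) auto
  then show ?thesis using U string_minimal[OF U(1)] by blast
qed

end

text \<open>Complete reducibility.  The spanning property is recorded next to the direct sum because functionals
  are tested on the vectors f^k b.\<close>

lemma string_decomposition:
  "\<exists>B d. finite B \<and> (\<forall>b\<in>B. e b = 0 \<and> h b = scale (of_nat (d b)) b \<and> b \<noteq> 0)
     \<and> span {(f ^^ k) b |b k. b \<in> B \<and> k \<le> d b} = UNIV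
     \<and> direct_sum_decomposition ((\<lambda>b. string b (d b)) ` B)"
proof -
  obtain B where B: "independent B" "span B = {v. e v = 0}" "\<And>b. b \<in> B \<Longrightarrow> \<exists>d::nat. h b = scale (of_nat d) b"
    using kernel_eigenbasis by blast
  have fin: "finite B" using B(1) by (rule finiteI_independent)
  obtain d where d: "\<And>b. b \<in> B \<Longrightarrow> h b = scale (of_nat (d b :: nat)) b" using B(3) by metis
  have nz: "0 \<notin> B" using B(1) dependent_zero by blast
  have eb: "e b = 0" if "b \<in> B" for b using B(2) that span_base[of b B] by auto
  let ?S = "\<lambda>b. string b (d b)"
  have sp: "span {(f ^^ k) b |b k. b \<in> B \<and> k \<le> d b} = UNIV"
    by (rule strings_span[OF B(2) d nz])
  have ex: "\<exists>w. (\<forall>b. w b \<in> ?S b) \<and> v = (\<Sum>b\<in>B. w b)" for v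
  proof -
    have "v \<in> span {(f ^^ k) b |b k. b \<in> B \<and> k \<le> d b}" unfolding sp by simp
    then show ?thesis
    proof (induction rule: span_induct_alt)
      case base
      show ?case by (rule exI[of _ "\<lambda>_. 0"]) (simp add: subspace_0[OF subspace_string])
    next
      case (step c x y)
      then obtain b k where x: "x = (f ^^ k) b" "b \<in> B" "k \<le> d b" by blast
      obtain w where w: "\<forall>b. w b \<in> ?S b" "y = (\<Sum>b\<in>B. w b)" using step(2) by blast
      have "scale c x \<in> ?S b" unfolding x(1) using x(3)
        by (intro subspace_scale[OF subspace_string] power_in_string)
      then have "\<forall>b'. w b' + (if b' = b then scale c x else 0) \<in> ?S b'"
        using w(1) by (auto intro: subspace_add[OF subspace_string])
      moreover have "scale c x + y = (\<Sum>b'\<in>B. w b' + (if b' = b then scale c x else 0))"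
        using x(2) fin by (simp add: sum.distrib w(2) add.commute)
      ultimately show ?case by (intro exI conjI)
    qed
  qed
  have uniq: "\<forall>b\<in>B. w b = 0" if w: "\<And>b. b \<in> B \<Longrightarrow> w b \<in> ?S b" "(\<Sum>b\<in>B. w b) = 0" for w
  proof -
    have "\<forall>b. \<exists>c. b \<in> B \<longrightarrow> w b = (\<Sum>k\<le>d b. scale (c k) ((f ^^ k) b))"
      using w(1) by (auto simp: string_def)
    then obtain c where c: "\<And>b. b \<in> B \<Longrightarrow> w b = (\<Sum>k\<le>d b. scale (c b k) ((f ^^ k) b))" by metis
    then have "(\<Sum>b\<in>B. \<Sum>k\<le>d b. scale (c b k) ((f ^^ k) b)) = 0" using w(2) by simp
    then have "\<forall>b\<in>B. \<forall>k\<le>d b. c b k = 0"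
      using strings_independent[OF fin B(1), of d c] eb d by blast
    then show ?thesis using c by simp
  qed
  have self: "b \<in> ?S b" for b using power_in_string[of 0 "d b" b] by simp
  have inj: "inj_on ?S B"
  proof (rule inj_onI, rule ccontr)
    fix b b' assume bb: "b \<in> B" "b' \<in> B" "?S b = ?S b'" "b \<noteq> b'"
    define w where "w = (\<lambda>x. if x = b then b else if x = b' then - b else 0)"
    have "w x \<in> ?S x" for x
      using self[of b] bb(3) subspace_neg[OF subspace_string, of b b' "d b'"]
      by (auto simp: w_def subspace_0[OF subspace_string])
    moreover have "(\<Sum>x\<in>B. w x) = (\<Sum>x\<in>{b,b'}. w x)"
      using bb fin by (intro sum.mono_neutral_right) (auto simp: w_def)
    then have "(\<Sum>x\<in>B. w x) = 0" using bb(4) by (simp add: w_def)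
    ultimately have "w b = 0" using uniq bb(1) by blast
    then show False using nz bb(1) by (simp add: w_def)
  qed
  have "direct_sum_decomposition (?S ` B)"
    unfolding direct_sum_decomposition_def
  proof (intro conjI allI)
    show "finite (?S ` B)" using fin by simp
    fix v
    obtain w where w: "\<forall>b. w b \<in> ?S b" "v = (\<Sum>b\<in>B. w b)" using ex by blast
    define g where "g = restrict (\<lambda>W. w (the_inv_into B ?S W)) (?S ` B)"
    have g: "g (?S b) = w b" if "b \<in> B" for b
      using that the_inv_into_f_f[OF inj that] by (simp add: g_def)
    show "\<exists>!f. f \<in> (\<Pi>\<^sub>E W\<in>?S ` B. W) \<and> (\<Sum>W\<in>?S ` B. f W) = v"
    proof (rule ex1I[of _ g])
      have "g \<in> (\<Pi>\<^sub>E W\<in>?S ` B. W)"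
        using w(1) g by (auto simp: PiE_iff g_def)
      moreover have "(\<Sum>W\<in>?S ` B. g W) = v"
        using g by (simp add: sum.reindex[OF inj] w(2))
      ultimately show "g \<in> (\<Pi>\<^sub>E W\<in>?S ` B. W) \<and> (\<Sum>W\<in>?S ` B. g W) = v" ..
    next
      fix g' assume g': "g' \<in> (\<Pi>\<^sub>E W\<in>?S ` B. W) \<and> (\<Sum>W\<in>?S ` B. g' W) = v"
      have "\<forall>b\<in>B. g' (?S b) - w b = 0"
      proof (rule uniq)
        fix b assume "b \<in> B"
        then show "g' (?S b) - w b \<in> ?S b"
          using g' w(1) by (intro subspace_diff[OF subspace_string]) (auto simp: PiE_iff)
      next
        show "(\<Sum>b\<in>B. g' (?S b) - w b) = 0"
          using g' w(2) by (simp add: sum_subtractf sum.reindex[OF inj])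
      qed
      then show "g' = g"
        using g' g by (intro ext) (auto simp: PiE_iff g_def extensional_def)
    qed
  qed
  then show ?thesis using fin eb d nz sp by (intro exI[of _ B] exI[of _ d]) auto
qed

text \<open>The functional vanishes on the image of e, which contains all vectors of the strings but the
  lowest ones.  The lowest vector of the string of b has h-eigenvalue - d b, so if the functional is
  nonzero on it then d b = c.\<close>

lemma functional_weight:
  assumes B: "\<forall>b\<in>B. e b = 0 \<and> h b = scale (of_nat (d b)) b \<and> b \<noteq> 0"
      "span {(f ^^ k) b |b k. b \<in> B \<and> k \<le> d b} = UNIV"
    and \<xi>: "\<And>x y. \<xi> (x + y) = \<xi> x + \<xi> y" "\<And>c x. \<xi> (scale c x) = c * (\<xi> x :: complex)"
      "\<And>v. \<xi> (e v) = 0" "\<And>v. \<xi> (h v) = - (of_int c * \<xi> v)" "\<xi> v0 \<noteq> 0"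
  shows "\<exists>b\<in>B. int (d b) = c"
proof (rule ccontr)
  assume no: "\<not> ?thesis"
  have \<xi>0: "\<xi> 0 = 0" using \<xi>(2)[of 0 0] by simp
  have gen: "\<xi> ((f ^^ k) b) = 0" if bk: "b \<in> B" "k \<le> d b" for b k
  proof (cases "k < d b")
    case True
    define g where "g = of_nat (Suc k) * (of_nat (d b) - of_nat k :: complex)"
    have "g \<noteq> 0" using True by (simp add: g_def del: of_nat_Suc)
    have "g * \<xi> ((f ^^ k) b) = \<xi> (e ((f ^^ Suc k) b))"
      using e_f_highest[of b "d b" k] B(1) bk(1) by (simp add: \<xi>(2) g_def del: funpow.simps of_nat_Suc)
    then show ?thesis using \<xi>(3) \<open>g \<noteq> 0\<close> by simp
  next
    case False
    then have k: "k = d b" using bk by simp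
    have "h ((f ^^ k) b) = scale (- of_nat k) ((f ^^ k) b)"
      using B(1) bk(1) by (simp add: h_f_power k fk.scale flip: scale_left_diff_distrib)
    then have "- (of_int c * \<xi> ((f ^^ k) b)) = - of_nat k * \<xi> ((f ^^ k) b)" using \<xi>(2,4) by metis
    then have "(of_int c - of_int (int k)) * \<xi> ((f ^^ k) b) = 0" by (simp add: algebra_simps)
    moreover have "c \<noteq> int k" using no bk(1) k by auto
    ultimately show ?thesis unfolding of_int_diff[symmetric] mult_eq_0_iff of_int_eq_0_iff by auto
  qed
  have "v0 \<in> span {(f ^^ k) b |b k. b \<in> B \<and> k \<le> d b}" unfolding B(2) by simp
  then have "\<xi> v0 = 0"
    by (induction rule: span_induct_alt) (use gen in \<open>auto simp: \<xi> \<xi>0\<close>)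
  then show False using \<xi>(5) by simp
qed

text \<open>One bound D serves all v because there are finitely many strings.\<close>

lemma h_grading:
  "\<exists>D. \<forall>v. \<exists>w. v = (\<Sum>k\<in>{-D..D}. w k) \<and> (\<forall>k. h (w k) = scale (of_int k) (w k))"
proof -
  obtain B d where B: "finite B" "\<forall>b\<in>B. e b = 0 \<and> h b = scale (of_nat (d b)) b \<and> b \<noteq> 0"
     "span {(f ^^ k) b |b k. b \<in> B \<and> k \<le> d b} = UNIV"
    using string_decomposition by blast
  define D where "D = int (Max (insert 0 (d ` B)))"
  have dD: "int (d b) \<le> D" if "b \<in> B" for b unfolding D_def using B(1) that by simp
  have "\<exists>w. v = (\<Sum>k\<in>{-D..D}. w k) \<and> (\<forall>k. h (w k) = scale (of_int k) (w k))" for v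
  proof -
    have "v \<in> span {(f ^^ k) b |b k. b \<in> B \<and> k \<le> d b}" unfolding B(3) by simp
    then show ?thesis
    proof (induction rule: span_induct_alt)
      case base
      show ?case by (rule exI[of _ "\<lambda>_. 0"]) (simp add: h.zero)
    next
      case (step c x y)
      then obtain b k where x: "x = (f ^^ k) b" "b \<in> B" "k \<le> d b" by blast
      obtain w where w: "y = (\<Sum>k\<in>{-D..D}. w k)" "\<And>k. h (w k) = scale (of_int k) (w k)" using step(2) by blast
      define m where "m = int (d b) - 2 * int k"
      have m: "m \<in> {-D..D}" using dD[OF x(2)] x(3) by (simp add: m_def)
      have "h x = scale (of_nat (d b) - 2 * of_nat k) x"
        using B(2) x(2) by (simp add: x(1) h_f_power fk.scale flip: scale_left_diff_distrib)
      then have hx: "h x = scale (of_int m) x" by (simp add: m_def)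
      define w' where "w' = (\<lambda>k. w k + (if k = m then scale c x else 0))"
      have "scale c x + y = (\<Sum>k\<in>{-D..D}. w' k)"
        using m by (simp add: w'_def sum.distrib w(1) add.commute)
      moreover have "h (w' k) = scale (of_int k) (w' k)" for k
        by (simp add: w'_def h.add w(2) h.scale hx scale_right_distrib h.zero mult.commute)
      ultimately show ?case by blast
    qed
  qed
  then show ?thesis by blast
qed

end

section \<open>Tensors over a space with a numbered basis\<close>

text \<open>A tensor of degree N is a function on words of length N over {0, ..., n - 1}, its coordinates in the standard
  basis.  One type carries all degrees, and n is a parameter of the locale rather than a type, so that
  inductions over degrees stay inside one type.  Values at other letters are junk: the operations below only
  read letters less than n, and statements are made for words over these letters where it matters.\<close>

type_synonym mat = "nat \<Rightarrow> nat \<Rightarrow> complex"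
type_synonym tensor = "nat list \<Rightarrow> complex"

locale tensor_rank = fixes n :: nat
begin

definition mv :: "mat \<Rightarrow> (nat \<Rightarrow> complex) \<Rightarrow> nat \<Rightarrow> complex" where
  "mv X v p = (\<Sum>q<n. X p q * v q)"

definition mm :: "mat \<Rightarrow> mat \<Rightarrow> mat" where
  "mm X Y p q = (\<Sum>r<n. X p r * Y r q)"

text \<open>The Lie algebra action on tensors: X acts on each position in turn (see \<open>act_explicit\<close>).\<close>

fun act :: "mat \<Rightarrow> tensor \<Rightarrow> tensor" where
  "act X \<tau> [] = 0"
| "act X \<tau> (p # l) = (\<Sum>q<n. X p q * \<tau> (q # l)) + act X (\<lambda>m. \<tau> (p # m)) l"

lemma act_add: "act X (\<lambda>l. \<tau> l + \<sigma> l) l = act X \<tau> l + act X \<sigma> l"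
  by (induction l arbitrary: \<tau> \<sigma>) (auto simp: sum.distrib algebra_simps)

lemma act_scale: "act X (\<lambda>l. c * \<tau> l) l = c * act X \<tau> l"
  by (induction l arbitrary: \<tau>) (auto simp: sum_distrib_left algebra_simps)

lemma act_zero: "act X (\<lambda>l. 0) l = 0"
  by (induction l) auto

lemma act_sum: "act X (\<lambda>l. \<Sum>j\<in>J. \<tau> j l) l = (\<Sum>j\<in>J. act X (\<tau> j) l)"
  by (induction J rule: infinite_finite_induct) (simp_all add: act_zero act_add)

lemma act_mat_add: "act (\<lambda>p q. X p q + Y p q) \<tau> l = act X \<tau> l + act Y \<tau> l"
  by (induction l arbitrary: \<tau>) (auto simp: sum.distrib algebra_simps)

lemma act_mat_scale: "act (\<lambda>p q. c * X p q) \<tau> l = c * act X \<tau> l"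
  by (induction l arbitrary: \<tau>) (auto simp: sum_distrib_left algebra_simps)

lemma act_mat_zero: "act (\<lambda>p q. 0) \<tau> l = 0"
  by (induction l arbitrary: \<tau>) auto

lemma act_mat_sum: "act (\<lambda>p q. \<Sum>j\<in>J. X j p q) \<tau> l = (\<Sum>j\<in>J. act (X j) \<tau> l)"
  by (induction J rule: infinite_finite_induct) (simp_all add: act_mat_zero act_mat_add)

lemma act_commute:
  "act X (act Y \<tau>) l = act Y (act X \<tau>) l + act (\<lambda>p q. mm X Y p q - mm Y X p q) \<tau> l"
proof (induction l arbitrary: \<tau>)
  case (Cons p l)
  have 1: "act X (\<lambda>m. act Y \<tau> (p # m)) l
      = (\<Sum>q<n. Y p q * act X (\<lambda>m. \<tau> (q # m)) l) + act X (act Y (\<lambda>m. \<tau> (p # m))) l" for X Y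
    by (simp add: act_add act_sum act_scale)
  have 2: "(\<Sum>q<n. X p q * act Y \<tau> (q # l))
      = (\<Sum>q<n. mm X Y p q * \<tau> (q # l)) + (\<Sum>q<n. X p q * act Y (\<lambda>m. \<tau> (q # m)) l)" for X Y
  proof -
    have "(\<Sum>q<n. X p q * (\<Sum>r<n. Y q r * \<tau> (r # l))) = (\<Sum>q<n. mm X Y p q * \<tau> (q # l))"
      unfolding mm_def sum_distrib_left sum_distrib_right
      by (subst sum.swap) (simp add: mult.assoc)
    then show ?thesis by (simp add: distrib_left sum.distrib)
  qed
  have "act X (act Y \<tau>) (p # l) = (\<Sum>q<n. X p q * act Y \<tau> (q # l)) + act X (\<lambda>m. act Y \<tau> (p # m)) l" for X Y
    by simp
  then have 3: "act X (act Y \<tau>) (p # l) = (\<Sum>q<n. mm X Y p q * \<tau> (q # l)) + (\<Sum>q<n. X p q * act Y (\<lambda>m. \<tau> (q # m)) l)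
     + (\<Sum>q<n. Y p q * act X (\<lambda>m. \<tau> (q # m)) l) + act X (act Y (\<lambda>m. \<tau> (p # m))) l" for X Y
    unfolding 1 2 by simp
  show ?case unfolding 3 Cons.IH[of "\<lambda>m. \<tau> (p # m)"]
    by (simp add: left_diff_distrib sum_subtractf)
qed simp

definition words :: "nat \<Rightarrow> nat list set" where
  "words N = {l. length l = N \<and> set l \<subseteq> {..<n}}"

lemma words_0 [simp]: "words 0 = {[]}" by (auto simp: words_def)

lemma finite_words [simp]: "finite (words N)"
  using finite_lists_length_eq[of "{..<n}" N] by (simp add: words_def conj_commute)

lemma sum_words_Suc: "(\<Sum>l\<in>words (Suc N). g l) = (\<Sum>p<n. \<Sum>l\<in>words N. g (p # l))"
proof -
  have eq: "words (Suc N) = (\<lambda>(p, l). p # l) ` ({..<n} \<times> words N)"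
    by (auto simp: words_def image_def length_Suc_conv)
  have "inj_on (\<lambda>(p, l). p # l) ({..<n} \<times> words N)" by (auto simp: inj_on_def)
  then show ?thesis unfolding eq by (simp add: sum.reindex sum.cartesian_product split_def o_def)
qed

text \<open>The bilinear pairing of coefficient tensors with tensors.  The transpose of X acts on coefficients
  (\<open>pairing_act\<close>).\<close>

definition pairing :: "nat \<Rightarrow> tensor \<Rightarrow> tensor \<Rightarrow> complex" where
  "pairing N c \<tau> = (\<Sum>l\<in>words N. c l * \<tau> l)"

lemma pairing_Suc: "pairing (Suc N) c \<tau> = (\<Sum>p<n. pairing N (\<lambda>l. c (p # l)) (\<lambda>l. \<tau> (p # l)))"
  by (simp add: pairing_def sum_words_Suc)

lemma pairing_add_right: "pairing N c (\<lambda>l. \<tau> l + \<sigma> l) = pairing N c \<tau> + pairing N c \<sigma>"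
  by (simp add: pairing_def sum.distrib distrib_left)

lemma pairing_scale_right: "pairing N c (\<lambda>l. a * \<tau> l) = a * pairing N c \<tau>"
  by (simp add: pairing_def sum_distrib_left algebra_simps)

lemma pairing_sum_right: "pairing N c (\<lambda>l. \<Sum>j\<in>J. \<tau> j l) = (\<Sum>j\<in>J. pairing N c (\<tau> j))"
  unfolding pairing_def sum_distrib_left by (rule sum.swap)

lemma pairing_add_left: "pairing N (\<lambda>l. c l + d l) \<tau> = pairing N c \<tau> + pairing N d \<tau>"
  by (simp add: pairing_def sum.distrib distrib_right)

lemma pairing_scale_left: "pairing N (\<lambda>l. a * c l) \<tau> = a * pairing N c \<tau>"
  by (simp add: pairing_def sum_distrib_left algebra_simps)

lemma pairing_sum_left: "pairing N (\<lambda>l. \<Sum>j\<in>J. c j l) \<tau> = (\<Sum>j\<in>J. pairing N (c j) \<tau>)"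
  unfolding pairing_def sum_distrib_right by (rule sum.swap)

lemma pairing_act: "pairing N c (act X \<tau>) = pairing N (act (\<lambda>p q. X q p) c) \<tau>"
proof (induction N arbitrary: c \<tau>)
  case 0
  show ?case by (simp add: pairing_def)
next
  case (Suc N)
  have "pairing (Suc N) c (act X \<tau>)
     = (\<Sum>p<n. \<Sum>q<n. X p q * pairing N (\<lambda>l. c (p # l)) (\<lambda>l. \<tau> (q # l)))
       + (\<Sum>p<n. pairing N (\<lambda>l. c (p # l)) (act X (\<lambda>l. \<tau> (p # l))))"
    by (simp add: pairing_Suc pairing_add_right pairing_sum_right pairing_scale_right sum.distrib)
  also have "(\<Sum>p<n. \<Sum>q<n. X p q * pairing N (\<lambda>l. c (p # l)) (\<lambda>l. \<tau> (q # l)))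
     = (\<Sum>p<n. \<Sum>q<n. X q p * pairing N (\<lambda>l. c (q # l)) (\<lambda>l. \<tau> (p # l)))"
    by (rule sum.swap)
  also have "\<dots> + (\<Sum>p<n. pairing N (\<lambda>l. c (p # l)) (act X (\<lambda>l. \<tau> (p # l))))
     = pairing (Suc N) (act (\<lambda>p q. X q p) c) \<tau>"
    by (simp add: Suc pairing_Suc pairing_add_left pairing_sum_left pairing_scale_left sum.distrib)
  finally show ?case .
qed

definition tens :: "nat \<Rightarrow> tensor \<Rightarrow> tensor \<Rightarrow> tensor" where
  "tens i c d l = c (take i l) * d (drop i l)"

lemma act_tens:
  "i \<le> length l \<Longrightarrow> act X (tens i c d) l = tens i (act X c) d l + tens i c (act X d) l"
proof (induction i arbitrary: c l)
  case 0
  show ?case by (simp add: tens_def act_scale[unfolded tens_def])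
next
  case (Suc i)
  then obtain p m where l: "l = p # m" "i \<le> length m" by (cases l) auto
  have "(\<lambda>m. tens (Suc i) c d (p # m)) = tens i (\<lambda>m. c (p # m)) d" by (simp add: tens_def fun_eq_iff)
  then show ?case using Suc.IH[OF l(2), of "\<lambda>m. c (p # m)"]
    by (simp add: l tens_def sum_distrib_left algebra_simps)
qed

lemma pairing_tens: "pairing (i + N) (tens i c d) (tens i \<sigma> \<tau>) = pairing i c \<sigma> * pairing N d \<tau>"
proof (induction i arbitrary: c \<sigma>)
  case 0
  show ?case by (simp add: pairing_def tens_def sum_distrib_left algebra_simps)
next
  case (Suc i)
  have "(\<lambda>l. tens (Suc i) c d (p # l)) = tens i (\<lambda>m. c (p # m)) d" for c d p
    by (simp add: tens_def fun_eq_iff)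
  then show ?case by (simp add: pairing_Suc Suc sum_distrib_right)
qed

section \<open>Polarisation\<close>

text \<open>The tensor power of the matrix A, acting on all positions at once.\<close>

fun tpow :: "mat \<Rightarrow> tensor \<Rightarrow> tensor" where
  "tpow A \<tau> [] = \<tau> []"
| "tpow A \<tau> (p # l) = (\<Sum>q<n. A p q * tpow A (\<lambda>m. \<tau> (q # m)) l)"

lemma tpow_scale: "tpow X (\<lambda>l. c * \<tau> l) l = c * tpow X \<tau> l"
  by (induction l arbitrary: \<tau>) (auto simp: sum_distrib_left algebra_simps)

lemma tpow_add: "tpow X (\<lambda>l. \<sigma> l + \<tau> l) l = tpow X \<sigma> l + tpow X \<tau> l"
  by (induction l arbitrary: \<sigma> \<tau>) (auto simp: sum.distrib algebra_simps)

lemma tpow_zero: "tpow X (\<lambda>l. 0) l = 0"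
  by (induction l) auto

lemma tpow_sum: "tpow X (\<lambda>l. \<Sum>j\<in>J. \<tau> j l) l = (\<Sum>j\<in>J. tpow X (\<tau> j) l)"
  by (induction J rule: infinite_finite_induct) (simp_all add: tpow_zero tpow_add)

lemma tpow_tens:
  "i \<le> length l \<Longrightarrow> tpow X (tens i c d) l = tens i (tpow X c) (tpow X d) l"
proof (induction i arbitrary: c l)
  case 0
  show ?case by (simp add: tens_def tpow_scale[unfolded tens_def])
next
  case (Suc i)
  then obtain p m where l: "l = p # m" "i \<le> length m" by (cases l) auto
  have "(\<lambda>m. tens (Suc i) c d (q # m)) = tens i (\<lambda>m. c (q # m)) d" for q by (simp add: tens_def fun_eq_iff)
  then show ?case using Suc.IH[OF l(2)]
    by (simp add: l) (simp add: tens_def sum_distrib_left mult_ac)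
qed

text \<open>The sum over all injections of K into the positions of the operators that apply X j at the position
  chosen for j.\<close>

fun slots :: "nat set \<Rightarrow> (nat \<Rightarrow> mat) \<Rightarrow> tensor \<Rightarrow> tensor" where
  "slots K X \<tau> [] = (if K = {} then \<tau> [] else 0)"
| "slots K X \<tau> (p # l) = slots K X (\<lambda>m. \<tau> (p # m)) l
     + (\<Sum>j\<in>K. \<Sum>q<n. X j p q * slots (K - {j}) X (\<lambda>m. \<tau> (q # m)) l)"

lemma slots_empty: "slots {} X \<tau> l = \<tau> l"
  by (induction l arbitrary: \<tau>) auto

lemma slots_cong: "(\<And>j. j \<in> K \<Longrightarrow> X j = Y j) \<Longrightarrow> slots K X \<tau> l = slots K Y \<tau> l"
proof (induction l arbitrary: K \<tau>)
  case (Cons p l)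
  show ?case
    using Cons.IH[of K] Cons.IH[of "K - {j}" for j] Cons.prems by (auto intro!: sum.cong)
qed simp

text \<open>Applying Y at one more position either uses a free position, which is the operator for one more
  index, or hits the position of some j, where Y composes with X j.\<close>

lemma act_slots:
  assumes "finite K" "k \<notin> K"
  shows "act Y (slots K X \<tau>) l
    = slots (insert k K) (X(k := Y)) \<tau> l + (\<Sum>j\<in>K. slots K (X(j := mm Y (X j))) \<tau> l)"
  using assms
proof (induction l arbitrary: K \<tau>)
  case Nil
  then show ?case by (cases "K = {}") auto
next
  case (Cons p l)
  let ?t = "\<lambda>q m. \<tau> (q # m)"
  have c1: "slots K (X(k := Y)) \<sigma> l = slots K X \<sigma> l" for \<sigma>
    using Cons.prems by (intro slots_cong) auto
  have c2: "slots (K - {j}) (X(j := Z)) \<sigma> l = slots (K - {j}) X \<sigma> l" for j Z \<sigma>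
    by (intro slots_cong) auto
  have ins: "insert k K - {j} = insert k (K - {j})" if "j \<in> K" for j
    using that Cons.prems by auto
  have ins2: "insert k K - {k} = K" using Cons.prems by auto
  have IH: "act Y (slots (K - {j}) X \<sigma>) l
    = slots (insert k (K - {j})) (X(k := Y)) \<sigma> l + (\<Sum>i\<in>K - {j}. slots (K - {j}) (X(i := mm Y (X i))) \<sigma> l)" for j \<sigma>
    using Cons.prems by (intro Cons.IH) auto
  define A where "A = (\<Sum>q<n. Y p q * slots K X (?t q) l)"
  define B where "B = (\<Sum>j\<in>K. \<Sum>q<n. mm Y (X j) p q * slots (K - {j}) X (?t q) l)"
  define C where "C = (\<Sum>j\<in>K. \<Sum>q<n. X j p q * slots (insert k (K - {j})) (X(k := Y)) (?t q) l)"
  define D where "D = (\<Sum>j\<in>K. \<Sum>q<n. X j p q * (\<Sum>i\<in>K - {j}. slots (K - {j}) (X(i := mm Y (X i))) (?t q) l))"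
  have "(\<Sum>q<n. Y p q * slots K X \<tau> (q # l)) = A + B"
  proof -
    have "(\<Sum>q<n. Y p q * (\<Sum>j\<in>K. \<Sum>r<n. X j q r * slots (K - {j}) X (?t r) l)) = B"
    proof -
      have "(\<Sum>q<n. Y p q * (\<Sum>j\<in>K. \<Sum>r<n. X j q r * slots (K - {j}) X (?t r) l))
        = (\<Sum>j\<in>K. \<Sum>q<n. \<Sum>r<n. Y p q * (X j q r * slots (K - {j}) X (?t r) l))"
        unfolding sum_distrib_left by (rule sum.swap)
      also have "\<dots> = (\<Sum>j\<in>K. \<Sum>r<n. \<Sum>q<n. Y p q * (X j q r * slots (K - {j}) X (?t r) l))"
        by (rule sum.cong[OF refl], rule sum.swap)
      also have "\<dots> = B" unfolding B_def mm_def sum_distrib_right by (simp add: mult.assoc)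
      finally show ?thesis .
    qed
    then show ?thesis by (simp add: A_def distrib_left sum.distrib)
  qed
  moreover have "act Y (\<lambda>m. slots K X \<tau> (p # m)) l
    = act Y (slots K X (?t p)) l + (C + D)"
  proof -
    have "act Y (\<lambda>m. slots K X \<tau> (p # m)) l
       = act Y (slots K X (?t p)) l + (\<Sum>j\<in>K. \<Sum>q<n. X j p q * act Y (slots (K - {j}) X (?t q)) l)"
      by (simp add: act_add act_sum act_scale)
    also have "(\<Sum>j\<in>K. \<Sum>q<n. X j p q * act Y (slots (K - {j}) X (?t q)) l) = C + D"
      unfolding IH by (simp add: C_def D_def distrib_left sum.distrib)
    finally show ?thesis .
  qed
  ultimately have lhs: "act Y (slots K X \<tau>) (p # l) = A + B + act Y (slots K X (?t p)) l + C + D"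
    by simp
  have rhs1: "slots (insert k K) (X(k := Y)) \<tau> (p # l) = slots (insert k K) (X(k := Y)) (?t p) l + A + C"
  proof -
    have "(\<Sum>j\<in>K. \<Sum>q<n. (X(k := Y)) j p q * slots (insert k K - {j}) (X(k := Y)) (?t q) l) = C"
      unfolding C_def using ins Cons.prems by (intro sum.cong) auto
    then show ?thesis using Cons.prems by (simp add: ins2 c1 A_def)
  qed
  have rhs2: "(\<Sum>j\<in>K. slots K (X(j := mm Y (X j))) \<tau> (p # l))
     = (\<Sum>j\<in>K. slots K (X(j := mm Y (X j))) (?t p) l) + B + D"
  proof -
    have "(\<Sum>i\<in>K. \<Sum>q<n. (X(j := mm Y (X j))) i p q * slots (K - {i}) (X(j := mm Y (X j))) (?t q) l)
       = (\<Sum>q<n. mm Y (X j) p q * slots (K - {j}) X (?t q) l)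
        + (\<Sum>i\<in>K - {j}. \<Sum>q<n. X i p q * slots (K - {i}) (X(j := mm Y (X j))) (?t q) l)" if "j \<in> K" for j
      using that Cons.prems by (simp add: sum.remove[of K j] c2)
    then have "(\<Sum>j\<in>K. slots K (X(j := mm Y (X j))) \<tau> (p # l))
     = (\<Sum>j\<in>K. slots K (X(j := mm Y (X j))) (?t p) l) + B
        + (\<Sum>j\<in>K. \<Sum>i\<in>K - {j}. \<Sum>q<n. X i p q * slots (K - {i}) (X(j := mm Y (X j))) (?t q) l)"
      by (simp add: sum.distrib B_def)
    also have "(\<Sum>j\<in>K. \<Sum>i\<in>K - {j}. \<Sum>q<n. X i p q * slots (K - {i}) (X(j := mm Y (X j))) (?t q) l)
      = (\<Sum>i\<in>K. \<Sum>j\<in>K - {i}. \<Sum>q<n. X i p q * slots (K - {i}) (X(j := mm Y (X j))) (?t q) l)"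
    proof -
      have "(\<Sum>j\<in>K. \<Sum>i\<in>K - {j}. g i j) = (\<Sum>i\<in>K. \<Sum>j\<in>K - {i}. g i j)" for g :: "nat \<Rightarrow> nat \<Rightarrow> complex"
      proof -
        have 1: "{y \<in> K. x \<noteq> y} = K - {x}" for x by auto
        have 2: "{y \<in> K. y \<noteq> x} = K - {x}" for x by auto
        show ?thesis
          using sum.swap_restrict[OF Cons.prems(1) Cons.prems(1), of g "\<lambda>j i. i \<noteq> j"]
          unfolding 1 2 by simp
      qed
      then show ?thesis .
    qed
    also have "\<dots> = D"
      unfolding D_def sum_distrib_left by (rule sum.cong[OF refl], rule sum.swap)
    finally show ?thesis .
  qed
  show ?case unfolding lhs rhs1 rhs2 Cons.IH[OF Cons.prems] by simp
qed

lemma slots_const_zero: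
  "finite K \<Longrightarrow> length l < card K \<Longrightarrow> slots K (\<lambda>_. A) \<tau> l = 0"
proof (induction l arbitrary: K \<tau>)
  case (Cons p l)
  have "slots (K - {j}) (\<lambda>_. A) \<sigma> l = 0" if "j \<in> K" for j \<sigma>
    using Cons.prems that by (intro Cons.IH) auto
  then show ?case using Cons by auto
qed auto

text \<open>With as many indices as positions, all injections are bijections and contribute equally.\<close>

lemma slots_const:
  "finite K \<Longrightarrow> card K = length l \<Longrightarrow> slots K (\<lambda>_. A) \<tau> l = fact (card K) * tpow A \<tau> l"
proof (induction l arbitrary: K \<tau>)
  case (Cons p l)
  have IH: "slots (K - {j}) (\<lambda>_. A) \<sigma> l = fact (length l) * tpow A \<sigma> l" if "j \<in> K" for j \<sigma>
    using Cons.IH[of "K - {j}" \<sigma>] Cons.prems that by simp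
  have "slots K (\<lambda>_. A) (\<lambda>m. \<tau> (p # m)) l = 0"
    using Cons.prems by (intro slots_const_zero) auto
  moreover have "(\<Sum>j\<in>K. \<Sum>q<n. A p q * slots (K - {j}) (\<lambda>_. A) (\<lambda>m. \<tau> (q # m)) l)
     = (\<Sum>j\<in>K. fact (length l) * tpow A \<tau> (p # l))"
    by (intro sum.cong refl) (simp add: IH sum_distrib_left algebra_simps)
  ultimately show ?case using Cons.prems by (simp add: algebra_simps)
qed auto

text \<open>A subspace stable under the Lie algebra action of all matrices is stable under tensor powers
  of all matrices, singular ones included.  By \<open>act_slots\<close> the operators \<open>slots K X\<close> are
  polynomials in the Lie algebra action, and for N indices that all carry A the operator is N! times the tensor
  power.  The two sides agree on words of length N only, because a tensor also has values on other lengths.\<close>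

lemma polarisation:
  assumes Z: "\<And>\<sigma> \<tau>. \<sigma> \<in> Z \<Longrightarrow> \<tau> \<in> Z \<Longrightarrow> (\<lambda>l. \<sigma> l + \<tau> l) \<in> Z"
      "\<And>c \<tau>. \<tau> \<in> Z \<Longrightarrow> (\<lambda>l. c * \<tau> l) \<in> Z"
      "\<And>X \<tau>. \<tau> \<in> Z \<Longrightarrow> act X \<tau> \<in> Z"
    and z: "z \<in> Z"
  shows "\<exists>\<tau>\<in>Z. \<forall>l. length l = N \<longrightarrow> \<tau> l = tpow A z l"
proof -
  have Zsum: "(\<lambda>l. \<Sum>j\<in>J. \<tau> j l) \<in> Z" if "finite J" "\<And>j. j \<in> J \<Longrightarrow> \<tau> j \<in> Z" for J :: "nat set" and \<tau>
    using that
  proof (induction J rule: finite_induct)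
    case empty
    then show ?case using Z(2)[OF z, of 0] by simp
  qed (simp add: Z(1))
  have "slots K X z \<in> Z" if "finite K" for K X
    using that
  proof (induction K arbitrary: X rule: finite_induct)
    case empty
    have "slots {} X z = z" by (rule ext) (rule slots_empty)
    then show ?case using z by simp
  next
    case (insert k K)
    have eq: "slots (insert k K) X z
      = (\<lambda>l. act (X k) (slots K X z) l + (-1) * (\<Sum>j\<in>K. slots K (X(j := mm (X k) (X j))) z l))"
      using act_slots[OF insert.hyps, of "X k" X z] by (simp add: fun_eq_iff)
    show ?case
      unfolding eq by (intro Z(1) Z(2) Z(3) Zsum insert)
  qed
  then have "(\<lambda>l. (1 / fact N) * slots {..<N} (\<lambda>_. A) z l) \<in> Z" by (intro Z(2)) auto
  moreover have "(1 / fact N) * slots {..<N} (\<lambda>_. A) z l = tpow A z l" if "length l = N" for l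
    using slots_const[of "{..<N}" l A z] that by simp
  ultimately show ?thesis by (intro bexI[of _ "\<lambda>l. (1 / fact N) * slots {..<N} (\<lambda>_. A) z l"]) auto
qed

end

context tensor_rank begin

section \<open>Pure tensors, wedges and flags\<close>

fun pure :: "(nat \<Rightarrow> complex) list \<Rightarrow> tensor" where
  "pure [] [] = 1"
| "pure (v # vs) (p # l) = v p * pure vs l"
| "pure [] (p # l) = 0"
| "pure (v # vs) [] = 0"

lemma pure_length: "length l \<noteq> length vs \<Longrightarrow> pure vs l = 0"
  by (induction vs l rule: pure.induct) auto

lemma act_pure: "act X (pure vs) l = (\<Sum>a<length vs. pure (vs[a := mv X (vs ! a)]) l)"
proof (induction vs l rule: pure.induct)
  case (2 v vs p l)
  have "act X (\<lambda>m. v p * pure vs m) l = v p * act X (pure vs) l" by (rule act_scale)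
  then show ?case using 2
    by (simp add: sum.lessThan_Suc_shift mv_def sum_distrib_left sum_distrib_right mult.assoc del: sum.lessThan_Suc)
next
  case (4 v vs)
  show ?case by (simp add: pure_length del: list_update.simps sum.lessThan_Suc length_Cons) 
qed (auto simp: act_zero)

lemma tpow_pure: "tpow A (pure vs) l = pure (map (mv A) vs) l"
proof (induction vs l rule: pure.induct)
  case (2 v vs p l)
  then show ?case by (simp add: tpow_scale mv_def sum_distrib_right mult.assoc)
qed (auto simp: tpow_zero)

text \<open>The exterior product of the columns A 0, ..., A (i - 1), without normalising factor.\<close>

definition wedge :: "nat \<Rightarrow> (nat \<Rightarrow> nat \<Rightarrow> complex) \<Rightarrow> tensor" where
  "wedge i A l = (\<Sum>\<sigma> | \<sigma> permutes {..<i}. of_int (sign \<sigma>) * pure (map (A \<circ> \<sigma>) [0..<i]) l)"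

lemma wedge_length: "length l \<noteq> i \<Longrightarrow> wedge i A l = 0"
  by (simp add: wedge_def pure_length)

lemma wedge_cong: "(\<And>a. a < i \<Longrightarrow> A a = B a) \<Longrightarrow> wedge i A = wedge i B"
proof (rule ext)
  fix l assume ab: "\<And>a. a < i \<Longrightarrow> A a = B a"
  have "map (A \<circ> \<sigma>) [0..<i] = map (B \<circ> \<sigma>) [0..<i]" if "\<sigma> permutes {..<i}" for \<sigma>
    unfolding map_eq_conv using permutes_in_image[OF that] ab by auto
  then have "pure (map (A \<circ> \<sigma>) [0..<i]) l = pure (map (B \<circ> \<sigma>) [0..<i]) l" if "\<sigma> permutes {..<i}" for \<sigma>
    using that by metis
  then show "wedge i A l = wedge i B l" unfolding wedge_def by (intro sum.cong refl) simp
qed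

lemma tpow_wedge: "tpow X (wedge i A) l = wedge i (\<lambda>a. mv X (A a)) l"
proof -
  have "tpow X (wedge i A) l = (\<Sum>\<sigma> | \<sigma> permutes {..<i}. of_int (sign \<sigma>) * tpow X (pure (map (A \<circ> \<sigma>) [0..<i])) l)"
    unfolding wedge_def by (simp add: tpow_sum tpow_scale)
  then show ?thesis by (simp add: wedge_def tpow_pure o_def)
qed

lemma act_wedge: "act X (wedge i A) l = (\<Sum>a<i. wedge i (A(a := mv X (A a))) l)"
proof -
  have "(\<Sum>b<i. pure ((map (A \<circ> \<sigma>) [0..<i])[b := mv X (map (A \<circ> \<sigma>) [0..<i] ! b)]) l)
      = (\<Sum>a<i. pure (map (A(a := mv X (A a)) \<circ> \<sigma>) [0..<i]) l)" if \<sigma>: "\<sigma> permutes {..<i}" for \<sigma>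
  proof -
    have "(\<Sum>a<i. pure (map (A(a := mv X (A a)) \<circ> \<sigma>) [0..<i]) l)
       = (\<Sum>b<i. pure (map (A(\<sigma> b := mv X (A (\<sigma> b))) \<circ> \<sigma>) [0..<i]) l)"
      using sum.permute[OF \<sigma>, of "\<lambda>a. pure (map (A(a := mv X (A a)) \<circ> \<sigma>) [0..<i]) l"] by (simp add: o_def)
    moreover have "map (A(\<sigma> b := mv X (A (\<sigma> b))) \<circ> \<sigma>) [0..<i]
        = (map (A \<circ> \<sigma>) [0..<i])[b := mv X (map (A \<circ> \<sigma>) [0..<i] ! b)]" if "b < i" for b
      using that permutes_inj[OF \<sigma>] by (intro nth_equalityI) (auto simp: nth_list_update inj_def)
    ultimately show ?thesis by simp
  qed
  then show ?thesis
    unfolding wedge_def act_sum act_scale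
    by (subst sum.swap) (simp add: act_pure sum_distrib_left)
qed

text \<open>The tensor product of exterior powers of degrees given by the list, all built from initial segments of the same
  sequence of columns.\<close>

fun flag :: "nat list \<Rightarrow> (nat \<Rightarrow> nat \<Rightarrow> complex) \<Rightarrow> tensor" where
  "flag [] A = (\<lambda>l. if l = [] then 1 else 0)"
| "flag (i # is) A = tens i (wedge i A) (flag is A)"

lemma tpow_flag: "length l = sum_list is \<Longrightarrow> tpow X (flag is A) l = flag is (\<lambda>a. mv X (A a)) l"
proof (induction "is" arbitrary: l)
  case (Cons i "is")
  then show ?case by (simp add: tpow_tens) (simp add: tens_def tpow_wedge)
qed auto

lemma flag_cong: "(\<And>a i. i \<in> set is \<Longrightarrow> a < i \<Longrightarrow> A a = B a) \<Longrightarrow> flag is A = flag is B"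
proof (induction "is")
  case (Cons i "is")
  have "wedge i A = wedge i B" using Cons.prems[of i] by (intro wedge_cong) auto
  moreover have "flag is A = flag is B" using Cons.prems by (intro Cons.IH) auto
  ultimately show ?case by simp
qed auto

definition unit :: "nat \<Rightarrow> nat \<Rightarrow> complex" where
  "unit a p = (if p = a then 1 else 0)"

lemma mv_unit: "a < n \<Longrightarrow> mv X (unit a) = (\<lambda>p. X p a)"
  by (auto simp: mv_def unit_def fun_eq_iff if_distrib[of "\<lambda>x. _ * x"] cong: if_cong)

text \<open>Any columns A arise from the basis columns by applying the matrix with columns A.\<close>

lemma flag_in_closure:
  assumes Z: "\<And>\<sigma> \<tau>. \<sigma> \<in> Z \<Longrightarrow> \<tau> \<in> Z \<Longrightarrow> (\<lambda>l. \<sigma> l + \<tau> l) \<in> Z"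
      "\<And>c \<tau>. \<tau> \<in> Z \<Longrightarrow> (\<lambda>l. c * \<tau> l) \<in> Z"
      "\<And>X \<tau>. \<tau> \<in> Z \<Longrightarrow> act X \<tau> \<in> Z"
    and z: "flag is unit \<in> Z" and "is": "\<And>i. i \<in> set is \<Longrightarrow> i \<le> n"
  shows "\<exists>\<tau>\<in>Z. \<forall>l. length l = sum_list is \<longrightarrow> \<tau> l = flag is A l"
proof -
  obtain \<tau> where \<tau>: "\<tau> \<in> Z" "\<forall>l. length l = sum_list is \<longrightarrow> \<tau> l = tpow (\<lambda>p a. A a p) (flag is unit) l"
    using polarisation[OF Z z] by blast
  have "flag is (\<lambda>a. mv (\<lambda>p a. A a p) (unit a)) = flag is A"
    using "is" by (intro flag_cong) (force simp: mv_unit)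
  then show ?thesis using \<tau> by (intro bexI[of _ \<tau>]) (auto simp: tpow_flag)
qed

section \<open>Functions of the columns\<close>

lemma pure_deriv:
  "((\<lambda>t. pure (map (\<lambda>a p. A a p + t * B a p) as) l) has_field_derivative
     (\<Sum>k<length as. pure ((map A as)[k := B (as ! k)]) l)) (at 0)"
proof (induction "as" arbitrary: l)
  case Nil
  show ?case by simp
next
  case (Cons a "as")
  show ?case
  proof (cases l)
    case Nil
    then show ?thesis by (simp add: sum.lessThan_Suc_shift del: sum.lessThan_Suc)
  next
    case (Cons p m)
    have "((\<lambda>t. (A a p + t * B a p) * pure (map (\<lambda>a p. A a p + t * B a p) as) m) has_field_derivative
       B a p * pure (map A as) m + A a p * (\<Sum>k<length as. pure ((map A as)[k := B (as ! k)]) m)) (at 0)"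
      by (rule derivative_eq_intros Cons.IH refl | simp)+
    then show ?thesis
      by (simp add: \<open>l = p # m\<close> sum.lessThan_Suc_shift sum_distrib_left del: sum.lessThan_Suc)
  qed
qed

lemma wedge_deriv:
  "((\<lambda>t. wedge i (\<lambda>a p. A a p + t * mv X (A a) p) l) has_field_derivative act X (wedge i A) l) (at 0)"
proof -
  have "((\<lambda>t. of_int (sign \<sigma>) * pure (map (\<lambda>a p. A a p + t * mv X (A a) p) (map \<sigma> [0..<i])) l) has_field_derivative
      of_int (sign \<sigma>) * act X (pure (map A (map \<sigma> [0..<i]))) l) (at 0)" for \<sigma> :: "nat \<Rightarrow> nat"
  proof -
    have "act X (pure (map A (map \<sigma> [0..<i]))) l
      = (\<Sum>k<length (map \<sigma> [0..<i]). pure ((map A (map \<sigma> [0..<i]))[k := mv X (A ((map \<sigma> [0..<i]) ! k))]) l)"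
      unfolding act_pure by simp
    then show ?thesis
      using pure_deriv[of A "\<lambda>a. mv X (A a)" "map \<sigma> [0..<i]" l] by (auto intro!: DERIV_cmult)
  qed
  then show ?thesis
    unfolding wedge_def act_sum act_scale
    by (intro DERIV_sum) (simp add: o_def)
qed

lemma flag_deriv:
  "length l = sum_list is \<Longrightarrow>
   ((\<lambda>t. flag is (\<lambda>a p. A a p + t * mv X (A a) p) l) has_field_derivative act X (flag is A) l) (at 0)"
proof (induction "is" arbitrary: l)
  case (Cons i "is")
  have "((\<lambda>t. wedge i (\<lambda>a p. A a p + t * mv X (A a) p) (take i l) * flag is (\<lambda>a p. A a p + t * mv X (A a) p) (drop i l))
     has_field_derivative act X (wedge i A) (take i l) * flag is A (drop i l)
       + wedge i A (take i l) * act X (flag is A) (drop i l)) (at 0)"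
    using Cons.prems
    by (auto intro!: derivative_eq_intros wedge_deriv Cons.IH simp: algebra_simps)
  then show ?case using Cons.prems by (simp add: act_tens) (simp add: tens_def)
qed simp

text \<open>Coefficient tensors enter only through the polynomial functions of the columns that they define on
  flag tensors.  Two coefficient tensors with the same function are interchangeable below, although they
  may differ as tensors.\<close>

definition val :: "nat list \<Rightarrow> tensor \<Rightarrow> (nat \<Rightarrow> nat \<Rightarrow> complex) \<Rightarrow> complex" where
  "val is c A = pairing (sum_list is) c (flag is A)"

lemma val_add: "val is (\<lambda>l. c l + d l) A = val is c A + val is d A"
  by (simp add: val_def pairing_add_left)

lemma val_scale: "val is (\<lambda>l. a * c l) A = a * val is c A"
  by (simp add: val_def pairing_scale_left)

lemma val_sum: "val is (\<lambda>l. \<Sum>j\<in>J. c j l) A = (\<Sum>j\<in>J. val is (c j) A)"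
  by (simp add: val_def pairing_sum_left)

text \<open>Because all factors share the columns A, concatenating lists of degrees multiplies the polynomials.\<close>

lemma val_tens: "val (i # is) (tens i c d) A = val [i] c A * val is d A"
proof -
  have "pairing i c (tens i (wedge i A) (\<lambda>l. if l = [] then 1 else 0)) = pairing i c (wedge i A)"
    unfolding pairing_def by (intro sum.cong) (auto simp: tens_def words_def)
  then show ?thesis by (simp add: val_def pairing_tens)
qed

lemma val_single: "val [i] c A = pairing i c (wedge i A)"
  unfolding val_def pairing_def by (intro sum.cong) (auto simp: tens_def words_def)

text \<open>The function of act X c at A is the derivative of the function of c along the direction of the transpose
  of X applied to A.  Hence the Lie algebra acts on the functions, not only on the coefficient tensors.\<close>

lemma val_act_zero:
  assumes "\<And>A. val is c A = 0"
  shows "val is (act X c) A = 0"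
proof -
  let ?X = "\<lambda>p q. X q p"
  have "((\<lambda>t. val is c (\<lambda>a p. A a p + t * mv ?X (A a) p)) has_field_derivative pairing (sum_list is) c (act ?X (flag is A))) (at 0)"
    unfolding val_def pairing_def
    by (intro DERIV_sum DERIV_cmult flag_deriv) (auto simp: words_def)
  then have "((\<lambda>t::complex. 0) has_field_derivative pairing (sum_list is) c (act ?X (flag is A))) (at 0)"
    using assms by simp
  then have "pairing (sum_list is) c (act ?X (flag is A)) = 0"
    using DERIV_unique DERIV_const by blast
  then show ?thesis by (simp add: val_def pairing_act)
qed

text \<open>Polynomials in the columns are studied along lines, where they become polynomials in one variable.\<close>

definition polyfun :: "(complex \<Rightarrow> complex) \<Rightarrow> bool" where
  "polyfun g \<longleftrightarrow> (\<exists>p. \<forall>t. g t = poly p t)"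

lemma polyfun_const: "polyfun (\<lambda>t. c)"
  unfolding polyfun_def by (rule exI[of _ "[:c:]"]) simp

lemma polyfun_linear: "polyfun (\<lambda>t. a + t * b)"
  unfolding polyfun_def by (rule exI[of _ "[:a, b:]"]) simp

lemma polyfun_add: "polyfun g \<Longrightarrow> polyfun k \<Longrightarrow> polyfun (\<lambda>t. g t + k t)"
  unfolding polyfun_def by (metis poly_add)

lemma polyfun_mult: "polyfun g \<Longrightarrow> polyfun k \<Longrightarrow> polyfun (\<lambda>t. g t * k t)"
  unfolding polyfun_def by (metis poly_mult)

lemma polyfun_sum: "(\<And>j. j \<in> J \<Longrightarrow> polyfun (g j)) \<Longrightarrow> polyfun (\<lambda>t. \<Sum>j\<in>J. g j t)"
  by (induction J rule: infinite_finite_induct) (auto intro: polyfun_const polyfun_add)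

lemma polyfun_pure: "polyfun (\<lambda>t. pure (map (\<lambda>a p. A a p + t * B a p) as) l)"
proof (induction "as" arbitrary: l)
  case Nil
  show ?case by (cases l) (auto intro: polyfun_const)
next
  case (Cons a "as")
  then show ?case by (cases l) (auto intro: polyfun_const polyfun_mult polyfun_linear)
qed

lemma polyfun_wedge: "polyfun (\<lambda>t. wedge i (\<lambda>a p. A a p + t * B a p) l)"
proof -
  have "polyfun (\<lambda>t. pure (map ((\<lambda>a p. A a p + t * B a p) \<circ> \<sigma>) [0..<i]) l)" for \<sigma>
    using polyfun_pure[of A B "map \<sigma> [0..<i]" l] by (simp add: o_def)
  then show ?thesis unfolding wedge_def by (intro polyfun_sum polyfun_mult polyfun_const)
qed

lemma polyfun_flag: "polyfun (\<lambda>t. flag is (\<lambda>a p. A a p + t * B a p) l)"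
  by (induction "is" arbitrary: l)
     (auto simp: tens_def intro: polyfun_const polyfun_mult polyfun_wedge)

lemma polyfun_val: "polyfun (\<lambda>t. val is c (\<lambda>a p. A a p + t * B a p))"
  unfolding val_def pairing_def by (intro polyfun_sum polyfun_mult polyfun_const polyfun_flag)

end

context tensor_rank begin

section \<open>Strings of coefficient tensors\<close>

lemma act_explicit: "act X \<tau> l = (\<Sum>a<length l. \<Sum>q<n. X (l ! a) q * \<tau> (l[a := q]))"
proof (induction l arbitrary: \<tau>)
  case (Cons p l)
  then show ?case by (simp add: sum.lessThan_Suc_shift del: sum.lessThan_Suc)
qed simp

lemma val_act_scale: "val is (act X (\<lambda>l. a * c l)) A = a * val is (act X c) A"
proof -
  have "act X (\<lambda>l. a * c l) = (\<lambda>l. a * act X c l)" by (rule ext) (rule act_scale)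
  then show ?thesis by (simp add: val_scale)
qed

lemma act_mat_cong:
  assumes "\<And>p q. p < n \<Longrightarrow> q < n \<Longrightarrow> X p q = Y p q" "set l \<subseteq> {..<n}"
  shows "act X \<tau> l = act Y \<tau> l"
  unfolding act_explicit using assms by (intro sum.cong refl) (auto simp: subset_iff)

text \<open>The matrices by which the principal triple acts on coefficients: up to sign the transposes of its matrices in
  a basis where e shifts the index down by one.\<close>

definition raise :: mat where "raise p q = (if p = Suc q then 1 else 0)"
definition lower :: mat where "lower p q = (if q = Suc p then of_nat (q * (n - q)) else 0)"
definition grade :: mat where "grade p q = (if p = q then 2 * of_nat p + 1 - of_nat n else 0)"

lemma commutators:
  assumes "p < n" "q < n"
  shows "mm raise lower p q - mm lower raise p q = grade p q"
    and "mm grade lower p q - mm lower grade p q = - 2 * lower p q"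
proof -
  have 1: "mm raise lower p q = (if p = q then of_nat (p * (n - p)) else 0)"
  proof (cases p)
    case (Suc r)
    have "mm raise lower p q = (\<Sum>s\<in>{r}. raise p s * lower s q)"
      unfolding mm_def using assms Suc by (intro sum.mono_neutral_right) (auto simp: raise_def)
    then show ?thesis by (simp add: Suc raise_def lower_def)
  qed (auto simp: mm_def raise_def)
  have 2: "mm lower raise p q = (if p = q then of_nat (Suc p * (n - Suc p)) else 0)"
  proof (cases "Suc p < n")
    case True
    have "mm lower raise p q = (\<Sum>s\<in>{Suc p}. lower p s * raise s q)"
      unfolding mm_def using True by (intro sum.mono_neutral_right) (auto simp: lower_def)
    then show ?thesis by (simp add: raise_def lower_def)
  next
    case False
    then have "n - Suc p = 0" by simp
    moreover have "mm lower raise p q = 0"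
      unfolding mm_def using False by (intro sum.neutral) (auto simp: lower_def)
    ultimately show ?thesis by simp
  qed
  have "of_nat (p * (n - p)) - of_nat (Suc p * (n - Suc p)) = (2 * of_nat p + 1 - of_nat n :: complex)"
  proof -
    have "of_nat (n - p) = (of_nat n - of_nat p :: complex)" "of_nat (n - Suc p) = (of_nat n - of_nat p - 1 :: complex)"
      using assms(1) by (simp_all add: of_nat_diff)
    then show ?thesis by (simp only: of_nat_mult) (simp add: algebra_simps)
  qed
  then show "mm raise lower p q - mm lower raise p q = grade p q"
    by (auto simp: 1 2 grade_def simp del: of_nat_mult)
  have "mm grade lower p q = (\<Sum>s\<in>{p}. grade p s * lower s q)"
    unfolding mm_def using assms by (intro sum.mono_neutral_right) (auto simp: grade_def)
  moreover have "mm lower grade p q = (\<Sum>s\<in>{q}. lower p s * grade s q)"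
    unfolding mm_def using assms by (intro sum.mono_neutral_right) (auto simp: grade_def)
  moreover have "grade p p * lower p q - lower p q * grade q q = - 2 * lower p q"
    by (cases "q = Suc p") (simp_all add: grade_def lower_def[of p q] algebra_simps del: of_nat_mult mult_Suc)
  ultimately show "mm grade lower p q - mm lower grade p q = - 2 * lower p q" by simp
qed

lemma val_cong:
  "(\<And>l. length l = sum_list is \<Longrightarrow> set l \<subseteq> {..<n} \<Longrightarrow> c l = d l) \<Longrightarrow> val is c A = val is d A"
  unfolding val_def pairing_def by (intro sum.cong) (auto simp: words_def)

lemma val_raise_lower:
  "val is (act raise (act lower c)) A = val is (act lower (act raise c)) A + val is (act grade c) A"
proof -
  have "act raise (act lower c) l = act lower (act raise c) l + act grade c l" if "set l \<subseteq> {..<n}" for l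
    unfolding act_commute[of raise lower c l]
    using act_mat_cong[OF commutators(1) that] by simp
  then show ?thesis by (simp add: val_add[symmetric] cong: val_cong)
qed

lemma val_grade_lower:
  "val is (act grade (act lower c)) A = val is (act lower (act grade c)) A - 2 * val is (act lower c) A"
proof -
  have "act grade (act lower c) l = act lower (act grade c) l + (- 2) * act lower c l" if "set l \<subseteq> {..<n}" for l
  proof -
    have "act (\<lambda>p q. mm grade lower p q - mm lower grade p q) c l = act (\<lambda>p q. (- 2) * lower p q) c l"
      by (rule act_mat_cong[OF commutators(2) that])
    then show ?thesis unfolding act_commute[of grade lower c l] act_mat_scale by simp
  qed
  then have "val is (act grade (act lower c)) A = val is (\<lambda>l. act lower (act grade c) l + (- 2) * act lower c l) A"
    by (intro val_cong)
  then show ?thesis unfolding val_add val_scale by simp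
qed

lemma val_act_cong:
  assumes "\<And>A. val is c A = a * val is d A"
  shows "val is (act X c) A = a * val is (act X d) A"
proof -
  have "val is (act X (\<lambda>l. c l + (- a) * d l)) A = 0"
    by (rule val_act_zero) (unfold val_add val_scale assms, simp)
  moreover have "act X (\<lambda>l. c l + (- a) * d l) = (\<lambda>l. act X c l + (- a) * act X d l)"
    by (rule ext) (simp only: act_add act_scale)
  ultimately have "val is (\<lambda>l. act X c l + (- a) * act X d l) A = 0" by (simp only:)
  then show ?thesis unfolding val_add val_scale by simp
qed

text \<open>The conditions on a highest weight vector are imposed on functions of columns.  As equations between coefficient
  tensors they would be too strong, since exterior powers only see alternating parts.\<close>

definition highest :: "nat list \<Rightarrow> int \<Rightarrow> tensor \<Rightarrow> bool" where
  "highest is w c \<longleftrightarrow> (\<forall>A. val is (act raise c) A = 0)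
     \<and> (\<forall>A. val is (act grade c) A = of_int w * val is c A) \<and> (\<exists>A. val is c A \<noteq> 0)"

text \<open>As far as e and h are concerned, the functions of c 0, ..., c a form a standard basis of F_a, with the
  normalisation e c_k = k c_(k-1) under which transvectants have binomial coefficients.\<close>

definition strung :: "nat list \<Rightarrow> nat \<Rightarrow> (nat \<Rightarrow> tensor) \<Rightarrow> bool" where
  "strung is a c \<longleftrightarrow> (\<forall>k\<le>a. \<forall>A. val is (act raise (c k)) A = of_nat k * val is (c (k - 1)) A)
     \<and> (\<forall>k\<le>a. \<forall>A. val is (act grade (c k)) A = (of_nat a - 2 * of_nat k) * val is (c k) A)
     \<and> (\<exists>A. val is (c 0) A \<noteq> 0)"

text \<open>The lowering matrix reads the tensor at words with one letter increased by one, and letters are at most n - 1.\<close>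

lemma lower_power_zero:
  "set l \<subseteq> {..<n} \<Longrightarrow> sum_list (map (\<lambda>x. n - Suc x) l) < k \<Longrightarrow> (act lower ^^ k) c l = 0"
proof (induction k arbitrary: l)
  case (Suc k)
  have "lower (l ! a) q * (act lower ^^ k) c (l[a := q]) = 0" if a: "a < length l" "q < n" for a q
  proof (cases "q = Suc (l ! a)")
    case True
    have la: "n - Suc (l ! a) \<in> set (map (\<lambda>x. n - Suc x) l)" using a by auto
    have "sum_list (map (\<lambda>x. n - Suc x) (l[a := q])) = sum_list ((map (\<lambda>x. n - Suc x) l)[a := n - Suc q])"
      by (simp add: map_update)
    also have "\<dots> = sum_list (map (\<lambda>x. n - Suc x) l) + (n - Suc q) - (n - Suc (l ! a))"
      using a by (subst sum_list_update) auto
    also have "\<dots> < k"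
    proof -
      have "n - Suc (l ! a) \<le> sum_list (map (\<lambda>x. n - Suc x) l)" using la by (intro member_le_sum_list) auto
      then show ?thesis using Suc.prems(2) True a(2) by linarith
    qed
    finally have "(act lower ^^ k) c (l[a := q]) = 0"
      using Suc.prems(1) a(2) set_update_subset_insert[of l a q] by (intro Suc.IH) auto
    then show ?thesis by simp
  next
    case False
    then show ?thesis by (simp add: lower_def)
  qed
  moreover have "(act lower ^^ Suc k) c l = (\<Sum>a<length l. \<Sum>q<n. lower (l ! a) q * (act lower ^^ k) c (l[a := q]))"
    by (simp only: funpow.simps o_apply act_explicit[of lower "(act lower ^^ k) c" l])
  ultimately show ?case by (auto intro!: sum.neutral simp del: funpow.simps)
qed simp

lemma highest_powers:
  assumes "highest is w c"
  shows "val is (act grade ((act lower ^^ k) c)) A = (of_int w - 2 * of_nat k) * val is ((act lower ^^ k) c) A"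
    and "val is (act raise ((act lower ^^ Suc k) c)) A
      = of_nat (Suc k) * (of_int w - of_nat k) * val is ((act lower ^^ k) c) A"
proof -
  let ?P = "\<lambda>k. (act lower ^^ k) c"
  have G: "val is (act grade (?P k)) A = (of_int w - 2 * of_nat k) * val is (?P k) A" for k A
  proof (induction k arbitrary: A)
    case 0
    then show ?case using assms by (simp add: highest_def)
  next
    case (Suc k)
    have "val is (act lower (act grade (?P k))) A = (of_int w - 2 * of_nat k) * val is (?P (Suc k)) A"
      using val_act_cong[OF Suc] by simp
    then show ?case by (simp add: val_grade_lower algebra_simps)
  qed
  show "val is (act grade (?P k)) A = (of_int w - 2 * of_nat k) * val is (?P k) A" by (rule G)
  show "val is (act raise (?P (Suc k))) A = of_nat (Suc k) * (of_int w - of_nat k) * val is (?P k) A"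
  proof (induction k arbitrary: A)
    case 0
    have "val is (act raise c) A = 0" for A using assms by (simp add: highest_def)
    then have "val is (act lower (act raise c)) A = 0" by (rule val_act_zero)
    then show ?case using G[of 0 A] by (simp add: val_raise_lower)
  next
    case (Suc k)
    have "val is (act lower (act raise (?P (Suc k)))) A
        = of_nat (Suc k) * (of_int w - of_nat k) * val is (?P (Suc k)) A"
      using val_act_cong[OF Suc, of lower A] by simp
    moreover have "val is (act raise (?P (Suc (Suc k)))) A
        = val is (act lower (act raise (?P (Suc k)))) A + val is (act grade (?P (Suc k))) A"
      by (simp only: funpow.simps o_apply val_raise_lower)
    ultimately show ?case unfolding G by (simp only:) (simp add: algebra_simps)
  qed
qed

text \<open>The usual argument that a highest weight is a natural number, applied to functions on columns.\<close>

lemma highest_string: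
  assumes "highest is w c"
  shows "\<exists>a C. w = int a \<and> strung is a C"
proof -
  let ?P = "\<lambda>k. (act lower ^^ k) c"
  define N where "N = sum_list is * n"
  have "val is (?P (Suc N)) A = 0" for A
  proof -
    have "?P (Suc N) l = 0" if l: "length l = sum_list is" "set l \<subseteq> {..<n}" for l
    proof (rule lower_power_zero[OF l(2)])
      have "sum_list (map (\<lambda>x. n - Suc x) l) \<le> sum_list (map (\<lambda>x. n) l)" by (intro sum_list_mono) simp
      then show "sum_list (map (\<lambda>x. n - Suc x) l) < Suc N" by (simp add: sum_list_triv l N_def)
    qed
    then have "val is (?P (Suc N)) A = val is (\<lambda>l. 0 * c l) A" by (intro val_cong) (simp del: funpow.simps)
    then show ?thesis unfolding val_scale by simp
  qed
  then have ex: "\<exists>k. \<forall>A. val is (?P k) A = 0" by blast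
  define K where "K = (LEAST k. \<forall>A. val is (?P k) A = 0)"
  have K: "\<forall>A. val is (?P K) A = 0" unfolding K_def using ex by (rule LeastI_ex)
  have min: "\<exists>A. val is (?P k) A \<noteq> 0" if "k < K" for k
    using not_less_Least[OF that[unfolded K_def]] by blast
  have "K \<noteq> 0"
  proof
    assume "K = 0"
    then have "\<forall>A. val is c A = 0" using K by simp
    then show False using assms by (auto simp: highest_def)
  qed
  then obtain a where a: "K = Suc a" using not0_implies_Suc by blast
  obtain A where A: "val is (?P a) A \<noteq> 0" using min[of a] a by auto
  have "of_nat (Suc a) * (of_int w - of_nat a) * val is (?P a) A = 0"
    using highest_powers(2)[OF assms, of a A] val_act_zero[of "is" "?P K" raise A] K a by simp
  then have "of_int w = (of_nat a :: complex)" using A by (simp del: of_nat_Suc)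
  then have w: "w = int a" by (metis of_int_eq_iff of_int_of_nat_eq)
  \<comment> \<open>rescaling the images under powers of the lowering matrix to satisfy e c_k = k c_(k-1)\<close>
  define s where "s = (\<lambda>k. fact (a - k) / (fact a :: complex))"
  define C where "C = (\<lambda>k l. s k * ?P k l)"
  have "strung is a C"
    unfolding strung_def
  proof (intro conjI allI impI)
    fix k A assume k: "k \<le> a"
    show "val is (act raise (C k)) A = of_nat k * val is (C (k - 1)) A"
    proof (cases k)
      case 0
      have "val is (act raise (C 0)) A = s 0 * val is (act raise c) A"
        by (simp add: C_def val_act_scale)
      then show ?thesis using assms by (simp add: 0 highest_def)
    next
      case (Suc j)
      have "a - j = Suc (a - k)" using Suc k by simp
      then have "s j = of_nat (a - j) * s k" by (simp add: s_def del: of_nat_Suc)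
      moreover have "of_int w - of_nat j = (of_nat (a - j) :: complex)"
        using k Suc w by (simp add: of_nat_diff)
      moreover have "val is (act raise (C k)) A = s k * val is (act raise (?P k)) A"
        by (simp only: C_def val_act_scale)
      ultimately show ?thesis
        using highest_powers(2)[OF assms, of j A] Suc by (simp add: C_def val_scale del: funpow.simps)
    qed
    have "val is (act grade (C k)) A = s k * val is (act grade (?P k)) A"
      by (simp only: C_def val_act_scale)
    then show "val is (act grade (C k)) A = (of_nat a - 2 * of_nat k) * val is (C k) A"
      using highest_powers(1)[OF assms, of k A] w by (simp add: C_def val_scale)
  next
    show "\<exists>A. val is (C 0) A \<noteq> 0" using assms by (simp add: C_def val_scale highest_def s_def)
  qed
  then show ?thesis using w by blast
qed

section \<open>Transvectants\<close>

text \<open>Computes e applied to a transvectant.  The terms that would leave the family cancel in neighbouring pairs, by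
  (j + 1) (J choose j + 1) = (J - j) (J choose j).\<close>

lemma transvectant_identity:
  fixes x y :: "nat \<Rightarrow> complex"
  shows "(\<Sum>j\<le>J. (-1) ^ j * of_nat (J choose j) *
      (of_nat (q + J - j) * y (q + J - j - 1) * x (p + j) + y (q + J - j) * (of_nat (p + j) * x (p + j - 1))))
   = of_nat p * (\<Sum>j\<le>J. (-1) ^ j * of_nat (J choose j) * (y (q + J - j) * x (p - 1 + j)))
     + of_nat q * (\<Sum>j\<le>J. (-1) ^ j * of_nat (J choose j) * (y (q - 1 + J - j) * x (p + j)))"
proof -
  define s where "s = (\<lambda>j. (-1) ^ j * of_nat (J choose j) :: complex)"
  have x: "of_nat (p + j) * x (p + j - 1) = of_nat p * x (p - 1 + j) + of_nat j * x (p + j - 1)" for j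
    by (cases p) (auto simp: algebra_simps)
  have y: "of_nat (q + J - j) * y (q + J - j - 1)
      = of_nat q * y (q - 1 + J - j) + of_nat (J - j) * y (q + J - j - 1)" if "j \<le> J" for j
    using that by (cases q) (auto simp: algebra_simps of_nat_diff)
  have "(\<Sum>j\<le>J. s j * (of_nat (q + J - j) * y (q + J - j - 1) * x (p + j) + y (q + J - j) * (of_nat (p + j) * x (p + j - 1))))
    = (\<Sum>j\<le>J. of_nat p * (s j * (y (q + J - j) * x (p - 1 + j))) + of_nat q * (s j * (y (q - 1 + J - j) * x (p + j)))
       + (s j * of_nat (J - j) * y (q + J - j - 1) * x (p + j) + s j * of_nat j * y (q + J - j) * x (p + j - 1)))"
  proof (intro sum.cong refl)
    fix j assume "j \<in> {..J}"
    then have "j \<le> J" by simp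
    show "s j * (of_nat (q + J - j) * y (q + J - j - 1) * x (p + j) + y (q + J - j) * (of_nat (p + j) * x (p + j - 1)))
      = of_nat p * (s j * (y (q + J - j) * x (p - 1 + j))) + of_nat q * (s j * (y (q - 1 + J - j) * x (p + j)))
       + (s j * of_nat (J - j) * y (q + J - j - 1) * x (p + j) + s j * of_nat j * y (q + J - j) * x (p + j - 1))"
      unfolding x y[OF \<open>j \<le> J\<close>] by (simp add: algebra_simps)
  qed
  also have "\<dots> = of_nat p * (\<Sum>j\<le>J. s j * (y (q + J - j) * x (p - 1 + j)))
     + of_nat q * (\<Sum>j\<le>J. s j * (y (q - 1 + J - j) * x (p + j)))
     + ((\<Sum>j\<le>J. s j * of_nat (J - j) * y (q + J - j - 1) * x (p + j))
       + (\<Sum>j\<le>J. s j * of_nat j * y (q + J - j) * x (p + j - 1)))"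
    by (simp add: sum.distrib sum_distrib_left)
  also have "(\<Sum>j\<le>J. s j * of_nat j * y (q + J - j) * x (p + j - 1))
     = - (\<Sum>j\<le>J. s j * of_nat (J - j) * y (q + J - j - 1) * x (p + j))"
  proof (cases J)
    case (Suc I)
    have s: "s (Suc j) * of_nat (Suc j) = - (s j * of_nat (J - j))" for j
    proof -
      have "(J choose Suc j) * Suc j = (J choose j) * (J - j)"
        using binomial_absorb_comp[of J j] binomial_absorption[of j I] Suc
        by (metis binomial_absorption diff_Suc_1 mult.commute)
      then have "of_nat (J choose Suc j) * of_nat (Suc j) = (of_nat (J choose j) * of_nat (J - j) :: complex)"
        by (metis of_nat_mult)
      then show ?thesis by (simp add: s_def mult.assoc del: of_nat_Suc)
    qed
    have "(\<Sum>j\<le>J. s j * of_nat j * y (q + J - j) * x (p + j - 1))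
       = (\<Sum>j\<le>I. s (Suc j) * of_nat (Suc j) * y (q + J - Suc j) * x (p + Suc j - 1))"
      unfolding Suc by (subst sum.atMost_Suc_shift) simp
    also have "\<dots> = - (\<Sum>j\<le>I. s j * of_nat (J - j) * y (q + J - j - 1) * x (p + j))"
      unfolding s by (simp add: sum_negf)
    also have "(\<Sum>j\<le>I. s j * of_nat (J - j) * y (q + J - j - 1) * x (p + j))
      = (\<Sum>j\<le>J. s j * of_nat (J - j) * y (q + J - j - 1) * x (p + j))"
      unfolding Suc by simp
    finally show ?thesis .
  qed simp
  finally show ?thesis by (simp add: s_def)
qed

text \<open>Dividing the P k by the largest power of the variable that divides all of them and evaluating at 0 turns a
  solution in polynomials into a nonzero solution of the system evaluated at 0.\<close>

lemma leading_coefficients: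
  assumes P: "P (0::nat) \<noteq> (0 :: complex poly)" and z: "\<And>m. m \<in> M \<Longrightarrow> (\<Sum>k\<le>a. Q m k * P k) = 0"
  shows "\<exists>f. (\<exists>k\<le>a. f k \<noteq> 0) \<and> (\<forall>m\<in>M. (\<Sum>k\<le>a. poly (Q m k) 0 * f k) = 0)"
proof -
  define R where "R = {r. \<forall>k\<le>a. [:0, 1:] ^ r dvd P k}"
  have "r \<le> degree (P 0)" if "r \<in> R" for r
  proof -
    have "[:0, 1:] ^ r dvd P 0" using that by (simp add: R_def)
    then have "degree ([:0, 1::complex:] ^ r) \<le> degree (P 0)" using P by (rule dvd_imp_degree_le)
    then show ?thesis by (simp add: degree_power_eq)
  qed
  then have fin: "finite R" by (meson finite_nat_set_iff_bounded_le)
  have "0 \<in> R" by (simp add: R_def)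
  define r where "r = Max R"
  have "r \<in> R" unfolding r_def using fin \<open>0 \<in> R\<close> by (intro Max_in) auto
  moreover have "Suc r \<notin> R"
  proof
    assume "Suc r \<in> R"
    then have "Suc r \<le> Max R" by (rule Max_ge[OF fin])
    then show False by (simp add: r_def)
  qed
  ultimately have r: "r \<in> R" "Suc r \<notin> R" .
  have "\<forall>k. \<exists>S. k \<le> a \<longrightarrow> P k = [:0, 1:] ^ r * S" using r(1) by (auto simp: R_def dvd_def)
  then obtain S where S: "\<And>k. k \<le> a \<Longrightarrow> P k = [:0, 1:] ^ r * S k" by metis
  obtain k where k: "k \<le> a" "\<not> [:0, 1:] ^ Suc r dvd P k" using r(2) by (auto simp: R_def)
  have "poly (S k) 0 \<noteq> 0"
  proof
    assume "poly (S k) 0 = 0"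
    then have "[:0, 1:] dvd S k" using poly_eq_0_iff_dvd[of "S k" 0] by simp
    then have "[:0, 1:] ^ Suc r dvd [:0, 1:] ^ r * S k" by (metis power_Suc2 mult_dvd_mono dvd_refl)
    then show False using k S by simp
  qed
  moreover have "(\<Sum>k\<le>a. poly (Q m k) 0 * poly (S k) 0) = 0" if "m \<in> M" for m
  proof -
    have "[:0, 1:] ^ r * (\<Sum>k\<le>a. Q m k * S k) = (\<Sum>k\<le>a. Q m k * P k)"
      by (simp add: S sum_distrib_left mult_ac)
    then have "[:0, 1:] ^ r * (\<Sum>k\<le>a. Q m k * S k) = 0" using z[OF that] by simp
    then have "(\<Sum>k\<le>a. Q m k * S k) = 0" by simp
    then have "poly (\<Sum>k\<le>a. Q m k * S k) 0 = 0" by simp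
    then show ?thesis by (simp add: poly_sum)
  qed
  ultimately show ?thesis using k(1) by (intro exI[of _ "\<lambda>k. poly (S k) 0"]) auto
qed

text \<open>The factor d is put first because the new degree is put at the head of the list.\<close>

definition transvectant :: "nat \<Rightarrow> nat \<Rightarrow> (nat \<Rightarrow> tensor) \<Rightarrow> (nat \<Rightarrow> tensor) \<Rightarrow> nat \<Rightarrow> nat \<Rightarrow> tensor" where
  "transvectant i J d c p q l = (\<Sum>j\<le>J. ((-1) ^ j * of_nat (J choose j)) * tens i (d (q + J - j)) (c (p + j)) l)"

lemma val_transvectant:
  "val (i # is) (transvectant i J d c p q) A
     = (\<Sum>j\<le>J. (-1) ^ j * of_nat (J choose j) * (val [i] (d (q + J - j)) A * val is (c (p + j)) A))"
  unfolding transvectant_def val_sum val_scale val_tens ..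

lemma val_act_transvectant:
  "val (i # is) (act X (transvectant i J d c p q)) A
     = (\<Sum>j\<le>J. (-1) ^ j * of_nat (J choose j) *
         (val [i] (act X (d (q + J - j))) A * val is (c (p + j)) A
           + val [i] (d (q + J - j)) A * val is (act X (c (p + j))) A))"
proof -
  have "act X (transvectant i J d c p q) l
     = (\<Sum>j\<le>J. ((-1) ^ j * of_nat (J choose j)) *
         (tens i (act X (d (q + J - j))) (c (p + j)) l + tens i (d (q + J - j)) (act X (c (p + j))) l))"
    if "length l = sum_list (i # is)" for l
  proof -
    have "i \<le> length l" using that by simp
    then show ?thesis unfolding transvectant_def act_sum act_scale by (simp add: act_tens)
  qed
  then have "val (i # is) (act X (transvectant i J d c p q)) A
     = val (i # is) (\<lambda>l. \<Sum>j\<le>J. ((-1) ^ j * of_nat (J choose j)) *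
         (tens i (act X (d (q + J - j))) (c (p + j)) l + tens i (d (q + J - j)) (act X (c (p + j))) l)) A"
    by (intro val_cong)
  then show ?thesis unfolding val_sum val_scale val_add val_tens .
qed

text \<open>The raising matrix lowers p + q by one, so it kills a nonzero transvectant for which p + q is minimal.\<close>

lemma transvectant_highest:
  assumes c: "strung is a c" and d: "strung [i] b d" and J: "J \<le> a" "J \<le> b"
    and nz: "p0 \<le> a - J" "q0 \<le> b - J" "val (i # is) (transvectant i J d c p0 q0) A0 \<noteq> 0"
  shows "\<exists>w e. highest (i # is) w e \<and> w \<le> int a + int b - 2 * int J"
proof -
  define S where "S = {(p, q). p \<le> a - J \<and> q \<le> b - J \<and> (\<exists>A. val (i # is) (transvectant i J d c p q) A \<noteq> 0)}"
  have "(p0, q0) \<in> S" using nz by (auto simp: S_def)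
  then obtain pq where pq: "pq \<in> S" "\<And>z. z \<in> S \<Longrightarrow> fst pq + snd pq \<le> fst z + snd z"
    using arg_min_nat_lemma[of "\<lambda>z. z \<in> S" "(p0, q0)" "\<lambda>z. fst z + snd z"] by blast
  obtain p q where pq': "pq = (p, q)" by (cases pq)
  let ?E = "transvectant i J d c p q"
  have pqb: "p \<le> a - J" "q \<le> b - J" "\<exists>A. val (i # is) ?E A \<noteq> 0" using pq(1) by (auto simp: S_def pq')
  have small: "val (i # is) (transvectant i J d c p' q') A = 0" if "p' \<le> p" "q' \<le> q" "p' + q' < p + q" for p' q' A
  proof -
    have "(p', q') \<notin> S" using pq(2)[of "(p', q')"] that by (auto simp: pq')
    then show ?thesis using that pqb by (auto simp: S_def)
  qed
  have "val (i # is) (act raise ?E) A = 0" for A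
  proof -
    let ?x = "\<lambda>k. val is (c k) A" and ?y = "\<lambda>k. val [i] (d k) A"
    have "val (i # is) (act raise ?E) A = (\<Sum>j\<le>J. (-1) ^ j * of_nat (J choose j) *
      (of_nat (q + J - j) * ?y (q + J - j - 1) * ?x (p + j) + ?y (q + J - j) * (of_nat (p + j) * ?x (p + j - 1))))"
      unfolding val_act_transvectant using c d pqb J
      by (intro sum.cong refl) (auto simp: strung_def)
    also have "\<dots> = of_nat p * val (i # is) (transvectant i J d c (p - 1) q) A
       + of_nat q * val (i # is) (transvectant i J d c p (q - 1)) A"
      unfolding val_transvectant
      by (rule transvectant_identity[where x = "\<lambda>k. val is (c k) A" and y = "\<lambda>k. val [i] (d k) A"])
    also have "\<dots> = 0" using small[of "p - 1" q A] small[of p "q - 1" A] by (cases p; cases q; simp)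
    finally show ?thesis .
  qed
  moreover have "val (i # is) (act grade ?E) A
      = of_int (int a + int b - 2 * int J - 2 * int p - 2 * int q) * val (i # is) ?E A" for A
  proof -
    have "val (i # is) (act grade ?E) A = (\<Sum>j\<le>J. (-1) ^ j * of_nat (J choose j) *
       ((of_nat b - 2 * of_nat (q + J - j)) * val [i] (d (q + J - j)) A * val is (c (p + j)) A
        + val [i] (d (q + J - j)) A * ((of_nat a - 2 * of_nat (p + j)) * val is (c (p + j)) A)))"
      unfolding val_act_transvectant using c d pqb J
      by (intro sum.cong refl) (auto simp: strung_def)
    also have "\<dots> = (\<Sum>j\<le>J. of_int (int a + int b - 2 * int J - 2 * int p - 2 * int q) *
       ((-1) ^ j * of_nat (J choose j) * (val [i] (d (q + J - j)) A * val is (c (p + j)) A)))"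
      by (intro sum.cong refl) (auto simp: of_nat_diff algebra_simps)
    finally show ?thesis unfolding val_transvectant sum_distrib_left .
  qed
  ultimately have "highest (i # is) (int a + int b - 2 * int J - 2 * int p - 2 * int q) ?E"
    using pqb(3) by (simp add: highest_def)
  then show ?thesis by (intro exI conjI) auto
qed

text \<open>On the line from A1 to a point where c 0 does not vanish, the functions of the c k are polynomials, not all zero.
  The f k are the coefficients of the lowest power of the line parameter that occurs in them; the point A1 itself
  may be a zero of all c k.\<close>

lemma transvectant_limit:
  assumes c: "strung is a c" and J: "J \<le> a"
    and z: "\<And>p q A. p \<le> a - J \<Longrightarrow> q \<le> b - J \<Longrightarrow> val (i # is) (transvectant i J d c p q) A = 0"
  shows "\<exists>f. (\<exists>k\<le>a. f k \<noteq> 0) \<and> (\<forall>p\<le>a - J. \<forall>q\<le>b - J.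
     (\<Sum>j\<le>J. (-1) ^ j * of_nat (J choose j) * (val [i] (d (q + J - j)) A1 * f (p + j))) = 0)"
proof -
  obtain A0 where A0: "val is (c 0) A0 \<noteq> 0" using c by (auto simp: strung_def)
  define L where "L = (\<lambda>t a p. A1 a p + t * (A0 a p - A1 a p))"
  have L: "L 0 = A1" "L 1 = A0" by (auto simp: L_def fun_eq_iff)
  have "\<forall>k. \<exists>P. \<forall>t. val is (c k) (L t) = poly P t" "\<forall>k. \<exists>P. \<forall>t. val [i] (d k) (L t) = poly P t"
    using polyfun_val by (auto simp: polyfun_def L_def)
  then obtain P Q where P: "\<And>k t. val is (c k) (L t) = poly (P k) t" and Q: "\<And>k t. val [i] (d k) (L t) = poly (Q k) t"
    by metis
  have "P 0 \<noteq> 0" using A0 P[of 0 1] L(2) by auto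
  define M where "M = {..a - J} \<times> {..b - J}"
  define R where "R = (\<lambda>m k. if fst m \<le> k \<and> k - fst m \<le> J
     then smult ((-1) ^ (k - fst m) * of_nat (J choose (k - fst m))) (Q (snd m + J - (k - fst m))) else 0)"
  have reindex: "(\<Sum>k\<le>a. if p \<le> k \<and> k - p \<le> J then g (k - p) k else 0) = (\<Sum>j\<le>J. g j (p + j))"
    if "p \<le> a - J" for p and g :: "nat \<Rightarrow> nat \<Rightarrow> 'b::comm_monoid_add"
  proof -
    have "(\<Sum>j\<le>J. g j (p + j)) = (\<Sum>k\<in>(\<lambda>j. p + j) ` {..J}. g (k - p) k)"
      by (subst sum.reindex) (auto simp: inj_on_def)
    also have "\<dots> = (\<Sum>k\<in>{k. k \<le> a \<and> p \<le> k \<and> k - p \<le> J}. g (k - p) k)"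
    proof (rule sum.cong)
      show "(\<lambda>j. p + j) ` {..J} = {k. k \<le> a \<and> p \<le> k \<and> k - p \<le> J}"
      proof (intro set_eqI iffI)
        fix k assume "k \<in> {k. k \<le> a \<and> p \<le> k \<and> k - p \<le> J}"
        then have "k = p + (k - p)" "k - p \<in> {..J}" by auto
        then show "k \<in> (\<lambda>j. p + j) ` {..J}" by (rule image_eqI)
      qed (use that J in auto)
    qed simp
    also have "\<dots> = (\<Sum>k\<le>a. if p \<le> k \<and> k - p \<le> J then g (k - p) k else 0)"
      by (subst sum.inter_filter[symmetric]) (auto intro!: sum.cong)
    finally show ?thesis ..
  qed
  have "(\<Sum>k\<le>a. R m k * P k) = 0" if m: "m \<in> M" for m
  proof -
    have "poly (\<Sum>k\<le>a. R m k * P k) t = 0" for t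
    proof -
      have "poly (\<Sum>k\<le>a. R m k * P k) t = (\<Sum>k\<le>a. if fst m \<le> k \<and> k - fst m \<le> J
         then (-1) ^ (k - fst m) * of_nat (J choose (k - fst m)) * (poly (Q (snd m + J - (k - fst m))) t * poly (P k) t) else 0)"
        unfolding poly_sum by (intro sum.cong refl) (simp add: R_def)
      also have "\<dots> = (\<Sum>j\<le>J. (-1) ^ j * of_nat (J choose j) * (poly (Q (snd m + J - j)) t * poly (P (fst m + j)) t))"
        using m by (intro reindex) (auto simp: M_def)
      also have "\<dots> = val (i # is) (transvectant i J d c (fst m) (snd m)) (L t)"
        by (simp add: val_transvectant P Q)
      also have "\<dots> = 0" using m z by (auto simp: M_def)
      finally show ?thesis .
    qed
    then show ?thesis using poly_all_0_iff_0 by blast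
  qed
  then obtain f where f: "\<exists>k\<le>a. f k \<noteq> 0" "\<forall>m\<in>M. (\<Sum>k\<le>a. poly (R m k) 0 * f k) = 0"
    using leading_coefficients[where P = P and M = M and a = a and Q = R] \<open>P 0 \<noteq> 0\<close> by blast
  have "(\<Sum>j\<le>J. (-1) ^ j * of_nat (J choose j) * (val [i] (d (q + J - j)) A1 * f (p + j))) = 0"
    if "p \<le> a - J" "q \<le> b - J" for p q
  proof -
    have "(\<Sum>j\<le>J. (-1) ^ j * of_nat (J choose j) * (val [i] (d (q + J - j)) A1 * f (p + j)))
      = (\<Sum>k\<le>a. if p \<le> k \<and> k - p \<le> J then (-1) ^ (k - p) * of_nat (J choose (k - p)) * (val [i] (d (q + J - (k - p))) A1 * f k) else 0)"
      using reindex[OF that(1), of "\<lambda>j k. (-1) ^ j * of_nat (J choose j) * (val [i] (d (q + J - j)) A1 * f k)"] by simp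
    also have "\<dots> = (\<Sum>k\<le>a. poly (R (p, q) k) 0 * f k)"
      using Q[of _ 0] by (intro sum.cong refl) (auto simp: R_def L)
    also have "\<dots> = 0" using f(2) that by (auto simp: M_def)
    finally show ?thesis .
  qed
  then show ?thesis using f(1) by blast
qed

end

context tensor_rank begin

section \<open>Adding a factor\<close>

text \<open>With a single nonzero g \<beta>, the equation for (p, q) has the single term f (p + j) with q + J - j = \<beta>.
  Every k at most a is reached, as the choice of J allows all j from 0 to J.\<close>

lemma vanish_even:
  fixes f g :: "nat \<Rightarrow> complex"
  assumes g: "\<And>l. l \<le> 2 * \<beta> \<Longrightarrow> g l = (if l = \<beta> then \<kappa> else 0)" "\<kappa> \<noteq> 0" and J: "J = min a \<beta>"
    and z: "\<And>p q. p \<le> a - J \<Longrightarrow> q \<le> 2 * \<beta> - J \<Longrightarrow>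
      (\<Sum>j\<le>J. (-1) ^ j * of_nat (J choose j) * (g (q + J - j) * f (p + j))) = 0"
    and k: "k \<le> a"
  shows "f k = 0"
proof -
  define p where "p = min k (a - J)"
  define i where "i = k - p"
  have i: "i \<le> J" "p \<le> a - J" "p + i = k" using k J by (auto simp: i_def p_def)
  have "J \<le> \<beta>" using J by simp
  define q where "q = \<beta> - J + i"
  have q: "q \<le> 2 * \<beta> - J" using i(1) \<open>J \<le> \<beta>\<close> by (simp add: q_def)
  have "(\<Sum>j\<le>J. (-1) ^ j * of_nat (J choose j) * (g (q + J - j) * f (p + j)))
     = (\<Sum>j\<in>{i}. (-1) ^ j * of_nat (J choose j) * (g (q + J - j) * f (p + j)))"
  proof (intro sum.mono_neutral_right ballI)
    fix j assume j: "j \<in> {..J} - {i}"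
    then have "q + J - j \<noteq> \<beta>" "q + J - j \<le> 2 * \<beta>" using i(1) \<open>J \<le> \<beta>\<close> by (auto simp: q_def)
    then show "(-1) ^ j * of_nat (J choose j) * (g (q + J - j) * f (p + j)) = 0" by (simp add: g)
  qed (use i in auto)
  also have "\<dots> = (-1) ^ i * of_nat (J choose i) * (\<kappa> * f k)"
  proof -
    have "q + J - i = \<beta>" using i(1) \<open>J \<le> \<beta>\<close> by (simp add: q_def)
    then show ?thesis using g(1)[of \<beta>] i(3) by simp
  qed
  finally have "(-1) ^ i * of_nat (J choose i) * (\<kappa> * f k) = 0" using z[OF i(2) q] by simp
  then show ?thesis using g(2) i(1) by simp
qed

text \<open>With two neighbouring nonzero values of g, an equation relates f (p + m) to f (p + m - 1).  It is enough to show that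
  f vanishes up to a - J.  If J \<le> \<beta>, there is also an equation with a single term.  Otherwise J = \<beta> + 1, and the two
  relations between f 1 and f 2, for p = 0 and p = 1, have determinant proportional to
  (J choose 2) - J * J, which is not zero.\<close>

lemma vanish_odd:
  fixes f g :: "nat \<Rightarrow> complex"
  assumes g: "\<And>l. l \<le> 2 * \<beta> + 1 \<Longrightarrow> g l = (if l = \<beta> then \<kappa> else if l = Suc \<beta> then \<kappa>' else 0)"
      "\<kappa> \<noteq> 0" "\<kappa>' \<noteq> 0" "\<beta> \<ge> 1"
    and a: "a \<le> 2 * \<beta> + 1" and J: "J = (a + 1) div 2"
    and z: "\<And>p q. p \<le> a - J \<Longrightarrow> q \<le> 2 * \<beta> + 1 - J \<Longrightarrow>
      (\<Sum>j\<le>J. (-1) ^ j * of_nat (J choose j) * (g (q + J - j) * f (p + j))) = 0"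
    and k: "k \<le> a"
  shows "f k = 0"
proof -
  have Jb: "J \<le> \<beta> + 1" "J \<le> a" using a J by auto
  let ?t = "\<lambda>p q j. (-1) ^ j * of_nat (J choose j) * (g (q + J - j) * f (p + j))"
  have rel: "of_nat (J choose m) * \<kappa> * f (p + m) = of_nat (J choose (m - 1)) * \<kappa>' * f (p + m - 1)"
    if m: "1 \<le> m" "m \<le> J" and p: "p \<le> a - J" for m p
  proof -
    define q where "q = \<beta> + m - J"
    have q: "q \<le> 2 * \<beta> + 1 - J" "q + J = \<beta> + m" using m Jb by (auto simp: q_def)
    have "(\<Sum>j\<le>J. ?t p q j) = (\<Sum>j\<in>{m, m - 1}. ?t p q j)"
    proof (intro sum.mono_neutral_right ballI)
      fix j assume "j \<in> {..J} - {m, m - 1}"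
      then have "q + J - j \<noteq> \<beta>" "q + J - j \<noteq> Suc \<beta>" "q + J - j \<le> 2 * \<beta> + 1" using m q Jb(1) by auto
      then show "?t p q j = 0" by (simp add: g)
    qed (use m in auto)
    also have "\<dots> = ?t p q m + ?t p q (m - 1)" using m by simp
    also have "?t p q m = (-1) ^ m * (of_nat (J choose m) * \<kappa> * f (p + m))"
      using g(1)[of \<beta>] q by simp
    also have "?t p q (m - 1) = - ((-1) ^ m * (of_nat (J choose (m - 1)) * \<kappa>' * f (p + m - 1)))"
    proof -
      have "q + J - (m - 1) = Suc \<beta>" using q m by simp
      moreover have "(-1) ^ m = - ((-1::complex) ^ (m - 1))" using m by (cases m) auto
      ultimately show ?thesis using g(1)[of "Suc \<beta>"] m g(4) by simp
    qed
    finally show ?thesis using z[OF p q(1)] by simp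
  qed
  have step: "f (p + m) = 0" if "f p = 0" "p \<le> a - J" "m \<le> J" for p m
    using that(3)
  proof (induction m)
    case 0
    then show ?case using that by simp
  next
    case (Suc m)
    then show ?case using rel[of "Suc m" p] that g(2) by simp
  qed
  have zero: "f p = 0" if "p \<le> a - J" for p
  proof (cases "J \<le> \<beta>")
    case True
    define q where "q = \<beta> - J"
    have q: "q \<le> 2 * \<beta> + 1 - J" "q + J = \<beta>" using True by (auto simp: q_def)
    have "(\<Sum>j\<le>J. ?t p q j) = (\<Sum>j\<in>{0}. ?t p q j)"
    proof (intro sum.mono_neutral_right ballI)
      fix j assume "j \<in> {..J} - {0}"
      then have "q + J - j \<noteq> \<beta>" "q + J - j \<noteq> Suc \<beta>" "q + J - j \<le> 2 * \<beta> + 1" using q True by auto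
      then show "?t p q j = 0" by (simp add: g)
    qed auto
    also have "\<dots> = \<kappa> * f p" using q g(1)[of \<beta>] by simp
    finally show ?thesis using z[OF that q(1)] g(2) by simp
  next
    case False
    then have JB: "J = \<beta> + 1" "a - J = \<beta>" using Jb a J by auto
    have "of_nat (J choose 2) * \<kappa> * f 2 = of_nat J * \<kappa>' * f 1"
      using rel[of 2 0] JB g(4) by (simp add: numeral_2_eq_2)
    moreover have "of_nat J * \<kappa> * f 2 = \<kappa>' * f 1"
      using rel[of 1 1] JB g(4) by (simp add: numeral_2_eq_2)
    ultimately have 1: "of_nat (J choose 2) * \<kappa>' * f 1 = of_nat J * of_nat J * \<kappa>' * f 1"
      by (metis (no_types, lifting) mult.assoc mult.left_commute)
    have "(J choose 2) < J * J"
    proof -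
      have "(J choose 2) \<le> J * (J - 1)" by (simp add: choose_two)
      also have "\<dots> < J * J" using JB by simp
      finally show ?thesis .
    qed
    then have "of_nat (J choose 2) \<noteq> (of_nat J * of_nat J :: complex)"
      by (metis nat_neq_iff of_nat_eq_iff of_nat_mult)
    then have f1: "f 1 = 0" using 1 g(3) by simp
    then have "f 0 = 0" using rel[of 1 0] JB g(2,3) by simp
    then show ?thesis using step[of 0 p] that JB by simp
  qed
  show ?thesis
  proof (cases "k \<le> a - J")
    case True then show ?thesis by (rule zero)
  next
    case False
    then show ?thesis using step[OF zero[of "a - J"], of "k - (a - J)"] k Jb by simp
  qed
qed

text \<open>At some point A, the string d has exactly the middle value nonzero, or, for odd b = n - 1, exactly the two
  middle values.  These are the cases that \<open>vanish_even\<close> and \<open>vanish_odd\<close> can handle.\<close>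

definition good :: "nat \<Rightarrow> nat \<Rightarrow> (nat \<Rightarrow> tensor) \<Rightarrow> bool" where
  "good i b d \<longleftrightarrow> (\<exists>A \<kappa> \<kappa>' \<beta>. \<kappa> \<noteq> 0 \<and>
     (b = 2 * \<beta> \<and> (\<forall>l\<le>b. val [i] (d l) A = (if l = \<beta> then \<kappa> else 0))
      \<or> \<kappa>' \<noteq> 0 \<and> 1 \<le> \<beta> \<and> b = 2 * \<beta> + 1 \<and> n = b + 1 \<and>
        (\<forall>l\<le>b. val [i] (d l) A = (if l = \<beta> then \<kappa> else if l = Suc \<beta> then \<kappa>' else 0))))"

text \<open>In both cases of J the weight a + b - 2 J is less than n.  For even b it is b - a or a.  For odd b = n - 1 it is at most b, since J is at least a / 2.\<close>

lemma add_factor: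
  assumes c: "strung is a c" "a < n" and d: "strung [i] b d" "b < n" "good i b d"
  shows "\<exists>w e. highest (i # is) w e \<and> w < int n"
proof -
  obtain A1 \<kappa> \<kappa>' \<beta> where \<kappa>: "\<kappa> \<noteq> 0" and
    cases: "b = 2 * \<beta> \<and> (\<forall>l\<le>b. val [i] (d l) A1 = (if l = \<beta> then \<kappa> else 0))
      \<or> \<kappa>' \<noteq> 0 \<and> 1 \<le> \<beta> \<and> b = 2 * \<beta> + 1 \<and> n = b + 1 \<and>
        (\<forall>l\<le>b. val [i] (d l) A1 = (if l = \<beta> then \<kappa> else if l = Suc \<beta> then \<kappa>' else 0))"
    using d(3) unfolding good_def by blast
  define J where "J = (if b = 2 * \<beta> then min a \<beta> else (a + 1) div 2)"
  have J: "J \<le> a" "J \<le> b" "int a + int b - 2 * int J < int n"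
    using cases c(2) d(2) by (auto simp: J_def)
  show ?thesis
  proof (cases "\<exists>p\<le>a - J. \<exists>q\<le>b - J. \<exists>A. val (i # is) (transvectant i J d c p q) A \<noteq> 0")
    case True
    then show ?thesis using transvectant_highest[OF c(1) d(1) J(1,2)] J(3) by (meson order.strict_trans1)
  next
    case False
    then have "\<And>p q A. p \<le> a - J \<Longrightarrow> q \<le> b - J \<Longrightarrow> val (i # is) (transvectant i J d c p q) A = 0" by blast
    from transvectant_limit[OF c(1) J(1) this, where ?A1.0 = A1]
    obtain f where f: "\<exists>k\<le>a. f k \<noteq> 0"
      "\<And>p q. p \<le> a - J \<Longrightarrow> q \<le> b - J \<Longrightarrow>
      (\<Sum>j\<le>J. (-1) ^ j * of_nat (J choose j) * (val [i] (d (q + J - j)) A1 * f (p + j))) = 0" by blast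
    have "f k = 0" if "k \<le> a" for k
    proof (cases "b = 2 * \<beta>")
      case True
      then have "\<forall>l\<le>b. val [i] (d l) A1 = (if l = \<beta> then \<kappa> else 0)" using cases by auto
      then show ?thesis
        using vanish_even[of \<beta> "\<lambda>l. val [i] (d l) A1" \<kappa> J a f k] \<kappa> that f(2) True by (auto simp: J_def)
    next
      case False
      then show ?thesis
        using vanish_odd[of \<beta> "\<lambda>l. val [i] (d l) A1" \<kappa> \<kappa>' a J f k] \<kappa> that f(2) cases c(2) by (auto simp: J_def)
    qed
    then show ?thesis using f(1) by blast
  qed
qed

section \<open>Coordinate columns\<close>

lemma pure_prod: "length l = length vs \<Longrightarrow> pure vs l = (\<Prod>b<length vs. (vs ! b) (l ! b))"
proof (induction vs l rule: pure.induct)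
  case (2 v vs p l)
  then show ?case by (simp add: prod.lessThan_Suc_shift del: prod.lessThan_Suc)
qed auto

lemma wedge_column:
  assumes k: "k < i" and l: "set l \<subseteq> {..<n}"
  shows "wedge i (A(k := v)) l = (\<Sum>r<n. v r * wedge i (A(k := unit r)) l)"
proof (cases "length l = i")
  case False
  then show ?thesis by (simp add: wedge_length)
next
  case len: True
  have "pure (map (A(k := v) \<circ> \<sigma>) [0..<i]) l = (\<Sum>r<n. v r * pure (map (A(k := unit r) \<circ> \<sigma>) [0..<i]) l)"
    if \<sigma>: "\<sigma> permutes {..<i}" for \<sigma>
  proof -
    obtain b where b: "b < i" "\<sigma> b = k" using k permutes_image[OF \<sigma>] by (metis imageE lessThan_iff)
    define G where "G = (\<Prod>c\<in>{..<i} - {b}. A (\<sigma> c) (l ! c))"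
    have ne: "\<sigma> c \<noteq> k" if "c \<noteq> b" for c using that b(2) permutes_inj[OF \<sigma>] by (auto simp: inj_def)
    have P: "pure (map (A(k := w) \<circ> \<sigma>) [0..<i]) l = w (l ! b) * G" for w
    proof -
      have "pure (map (A(k := w) \<circ> \<sigma>) [0..<i]) l = (\<Prod>c<i. (A(k := w)) (\<sigma> c) (l ! c))"
        using len by (simp add: pure_prod)
      also have "\<dots> = (A(k := w)) (\<sigma> b) (l ! b) * (\<Prod>c\<in>{..<i} - {b}. (A(k := w)) (\<sigma> c) (l ! c))"
        using b(1) by (intro prod.remove) auto
      also have "(\<Prod>c\<in>{..<i} - {b}. (A(k := w)) (\<sigma> c) (l ! c)) = G"
        unfolding G_def by (intro prod.cong) (auto simp: ne)
      finally show ?thesis by (simp only: b(2) fun_upd_same)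
    qed
    have "l ! b \<in> set l" using len b(1) by simp
    then have "l ! b < n" using l by auto
    then have "v (l ! b) = (\<Sum>r<n. v r * unit r (l ! b))"
      by (simp add: unit_def if_distrib[of "\<lambda>x. _ * x"] cong: if_cong)
    then show ?thesis unfolding P by (simp add: sum_distrib_right mult.assoc)
  qed
  then have "wedge i (A(k := v)) l = (\<Sum>\<sigma> | \<sigma> permutes {..<i}. \<Sum>r<n. v r * (of_int (sign \<sigma>) * pure (map (A(k := unit r) \<circ> \<sigma>) [0..<i]) l))"
    unfolding wedge_def by (intro sum.cong refl) (simp add: sum_distrib_left mult.left_commute)
  then show ?thesis unfolding wedge_def sum_distrib_left by (subst (asm) sum.swap)
qed

lemma val_column:
  assumes "k < i"
  shows "val [i] c (A(k := v)) = (\<Sum>r<n. v r * val [i] c (A(k := unit r)))"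
proof -
  have "pairing i c (wedge i (A(k := v))) = pairing i c (\<lambda>l. \<Sum>r<n. v r * wedge i (A(k := unit r)) l)"
    unfolding pairing_def using wedge_column[OF assms] by (intro sum.cong refl) (auto simp: words_def)
  then show ?thesis by (simp add: val_single pairing_sum_right pairing_scale_right)
qed

lemma val_column_add:
  "k < i \<Longrightarrow> val [i] c (A(k := \<lambda>p. v p + w p)) = val [i] c (A(k := v)) + val [i] c (A(k := w))"
  unfolding val_column[of k i c A "\<lambda>p. v p + w p"] val_column[of k i c A v] val_column[of k i c A w]
  by (simp add: sum.distrib distrib_right)

lemma val_column_scale:
  "k < i \<Longrightarrow> val [i] c (A(k := \<lambda>p. s * v p)) = s * val [i] c (A(k := v))"
  unfolding val_column[of k i c A "\<lambda>p. s * v p"] val_column[of k i c A v]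
  by (simp add: sum_distrib_left mult.assoc)

lemma val_act_single: "val [i] (act X c) A = (\<Sum>a<i. val [i] c (A(a := mv (\<lambda>p q. X q p) (A a))))"
proof -
  have "val [i] (act X c) A = pairing i c (act (\<lambda>p q. X q p) (wedge i A))"
    by (simp add: val_single pairing_act)
  also have "\<dots> = pairing i c (\<lambda>l. \<Sum>a<i. wedge i (A(a := mv (\<lambda>p q. X q p) (A a))) l)"
    by (intro arg_cong[where f = "pairing i c"] ext act_wedge)
  finally show ?thesis by (simp add: pairing_sum_right val_single)
qed

lemma val_single_cong: "(\<And>a. a < i \<Longrightarrow> A a = B a) \<Longrightarrow> val [i] c A = val [i] c B"
  using wedge_cong[of i A B] by (simp add: val_single)

text \<open>The function is linear in each of the i columns, so columns can be replaced by basis vectors one by one, from the last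
  to the first.\<close>

lemma nonzero_at_units:
  assumes "val [i] c A \<noteq> 0"
  shows "\<exists>l. length l = i \<and> set l \<subseteq> {..<n} \<and> val [i] c (\<lambda>a. unit (l ! a)) \<noteq> 0"
proof -
  have "\<exists>l. length l = i - k \<and> set l \<subseteq> {..<n} \<and> val [i] c (\<lambda>a. if a < k then A a else unit (l ! (a - k))) \<noteq> 0"
    if "k \<le> i" for k
    using that
  proof (induction rule: inc_induct)
    case base
    have "val [i] c (\<lambda>a. if a < i then A a else unit ([] ! (a - i))) = val [i] c A" by (rule val_single_cong) simp
    then show ?case using assms by (intro exI[of _ "[]"]) simp
  next
    case (step k)
    then obtain l where l: "length l = i - Suc k" "set l \<subseteq> {..<n}"
      "val [i] c (\<lambda>a. if a < Suc k then A a else unit (l ! (a - Suc k))) \<noteq> 0" by auto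
    let ?B = "\<lambda>a. if a < Suc k then A a else unit (l ! (a - Suc k))"
    have "?B = ?B(k := A k)" by auto
    then have "(\<Sum>r<n. A k r * val [i] c (?B(k := unit r))) \<noteq> 0"
      using l(3) val_column[of k i c ?B "A k"] step by simp
    then obtain r where r: "r < n" "val [i] c (?B(k := unit r)) \<noteq> 0"
      by (metis (no_types, lifting) lessThan_iff mult_zero_right sum.neutral)
    have "?B(k := unit r) = (\<lambda>a. if a < k then A a else unit ((r # l) ! (a - k)))"
      by (auto simp: fun_eq_iff less_Suc_eq nth_Cons split: nat.splits) (metis Suc_diff_Suc diff_Suc_Suc le_neq_implies_less not_less_eq not_le nat.inject)+
    then show ?case using r l step by (intro exI[of _ "r # l"]) auto
  qed
  from this[of 0] show ?thesis by simp
qed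

text \<open>Basis columns are eigenvectors of the grading matrix, so a weight function that is nonzero at them has
  their total weight.\<close>

lemma unit_weight:
  assumes "length l = i" "set l \<subseteq> {..<n}"
    and "\<And>A. val [i] (act grade c) A = s * val [i] c A" "val [i] c (\<lambda>a. unit (l ! a)) \<noteq> 0"
  shows "s = (\<Sum>a<i. 2 * of_nat (l ! a) + 1 - of_nat n)"
proof -
  let ?U = "\<lambda>a. unit (l ! a)"
  have "val [i] (act grade c) ?U = (\<Sum>a<i. (2 * of_nat (l ! a) + 1 - of_nat n) * val [i] c ?U)"
    unfolding val_act_single
  proof (intro sum.cong refl)
    fix a assume a: "a \<in> {..<i}"
    then have "l ! a \<in> set l" using assms(1) by simp
    then have "l ! a < n" using assms(2) by auto
    then have "mv (\<lambda>p q. grade q p) (?U a) = (\<lambda>p. (2 * of_nat (l ! a) + 1 - of_nat n) * unit (l ! a) p)"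
      by (auto simp: mv_unit grade_def unit_def fun_eq_iff)
    then show "val [i] c (?U(a := mv (\<lambda>p q. grade q p) (?U a))) = (2 * of_nat (l ! a) + 1 - of_nat n) * val [i] c ?U"
      using val_column_scale[of a i c ?U _ "unit (l ! a)"] a fun_upd_triv[of ?U a] by simp
  qed
  then show ?thesis using assms(3,4) by (simp flip: sum_distrib_right)
qed

lemma strung_nonzero:
  assumes "strung is a c" "k \<le> a"
  shows "\<exists>A. val is (c k) A \<noteq> 0"
  using assms(2)
proof (induction k)
  case 0
  then show ?case using assms(1) by (simp add: strung_def)
next
  case (Suc k)
  show ?case
  proof (rule ccontr)
    assume "\<nexists>A. val is (c (Suc k)) A \<noteq> 0"
    then have "val is (act raise (c (Suc k))) A = 0" for A by (intro val_act_zero) auto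
    moreover have "val is (act raise (c (Suc k))) A = of_nat (Suc k) * val is (c k) A" for A
      using assms(1) Suc.prems by (simp add: strung_def del: of_nat_Suc)
    ultimately have "val is (c k) A = 0" for A by (simp del: of_nat_Suc)
    then show False using Suc by auto
  qed
qed

text \<open>By \<open>unit_weight\<close>, basis columns at which the middle function is nonzero are zeros of all the others.\<close>

lemma good_even:
  assumes d: "strung [i] (2 * \<beta>) d"
  shows "good i (2 * \<beta>) d"
proof -
  obtain A where "val [i] (d \<beta>) A \<noteq> 0" using strung_nonzero[OF d, of \<beta>] by auto
  then obtain l where l: "length l = i" "set l \<subseteq> {..<n}" "val [i] (d \<beta>) (\<lambda>a. unit (l ! a)) \<noteq> 0"
    using nonzero_at_units by blast
  let ?U = "\<lambda>a. unit (l ! a)"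
  have "val [i] (d k) ?U = 0" if "k \<le> 2 * \<beta>" "k \<noteq> \<beta>" for k
  proof (rule ccontr)
    assume "val [i] (d k) ?U \<noteq> 0"
    then have "of_nat (2 * \<beta>) - 2 * of_nat k = (of_nat (2 * \<beta>) - 2 * of_nat \<beta> :: complex)"
      using unit_weight[OF l(1,2), of "d k" "of_nat (2 * \<beta>) - 2 * of_nat k"]
        unit_weight[OF l(1,2), of "d \<beta>" "of_nat (2 * \<beta>) - 2 * of_nat \<beta>"] d that(1) l(3)
      by (simp add: strung_def)
    then show False using that(2) by simp
  qed
  then have "\<forall>k\<le>2 * \<beta>. val [i] (d k) ?U = (if k = \<beta> then val [i] (d \<beta>) ?U else 0)" by simp
  then show ?thesis unfolding good_def using l(3) by blast
qed

text \<open>Start from basis columns U l where d \<beta> is nonzero.  As d \<beta> is a multiple of e d_(\<beta>+1), lowering the index of one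
  column by one gives basis columns U l' where d (\<beta> + 1) is nonzero.  At the columns with the sum of the two vectors in
  this place, the value of each d k is the sum of its values at U l and U l', and so it is nonzero for exactly the two
  middle indices.\<close>

lemma good_odd:
  assumes d: "strung [i] (2 * \<beta> + 1) d" and n: "n = 2 * \<beta> + 2" "1 \<le> \<beta>"
  shows "good i (2 * \<beta> + 1) d"
proof -
  let ?b = "2 * \<beta> + 1"
  obtain A where "val [i] (d \<beta>) A \<noteq> 0" using strung_nonzero[OF d, of \<beta>] by auto
  then obtain l where l: "length l = i" "set l \<subseteq> {..<n}" "val [i] (d \<beta>) (\<lambda>a. unit (l ! a)) \<noteq> 0"
    using nonzero_at_units by blast
  let ?U = "\<lambda>l a. unit (l ! a)"
  have uniq: "k = k'" if "length l = i" "set l \<subseteq> {..<n}" "k \<le> ?b" "k' \<le> ?b"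
      "val [i] (d k) (?U l) \<noteq> 0" "val [i] (d k') (?U l) \<noteq> 0" for k k' l
  proof -
    have "of_nat ?b - 2 * of_nat k = (of_nat ?b - 2 * of_nat k' :: complex)"
      using unit_weight[OF that(1,2), of "d k" "of_nat ?b - 2 * of_nat k"]
        unit_weight[OF that(1,2), of "d k'" "of_nat ?b - 2 * of_nat k'"] d that
      by (simp add: strung_def)
    then show ?thesis by simp
  qed
  have "val [i] (act raise (d (Suc \<beta>))) (?U l) \<noteq> 0"
    using d l(3) by (simp add: strung_def del: of_nat_Suc)
  then obtain a where a: "a < i" "val [i] (d (Suc \<beta>)) ((?U l)(a := mv (\<lambda>p q. raise q p) (unit (l ! a)))) \<noteq> 0"
    unfolding val_act_single by (metis (no_types, lifting) lessThan_iff sum.neutral)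
  define r where "r = l ! a"
  have "r \<in> set l" using l(1) a(1) by (simp add: r_def)
  then have r: "r < n" using l(2) by auto
  have mvr: "mv (\<lambda>p q. raise q p) (unit r) = (\<lambda>p. if r = Suc p then 1 else 0)"
    using r by (auto simp: mv_unit raise_def)
  have "r \<noteq> 0"
  proof
    assume "r = 0"
    then have "mv (\<lambda>p q. raise q p) (unit (l ! a)) = (\<lambda>p. 0 * unit r p)" using mvr r_def by simp
    then show False using a val_column_scale[of a i "d (Suc \<beta>)" "?U l" 0 "unit r"] by simp
  qed
  then obtain s where s: "r = Suc s" using not0_implies_Suc by blast
  have "mv (\<lambda>p q. raise q p) (unit (l ! a)) = unit s" using mvr s by (auto simp: r_def unit_def)
  define l' where "l' = l[a := s]"
  have l': "length l' = i" "set l' \<subseteq> {..<n}"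
    using l r s set_update_subset_insert[of l a s] by (auto simp: l'_def)
  have U': "val [i] c ((?U l)(a := unit s)) = val [i] c (?U l')" for c
    using a(1) l by (intro val_single_cong) (auto simp: l'_def nth_list_update)
  have nz': "val [i] (d (Suc \<beta>)) (?U l') \<noteq> 0"
    using a(2) \<open>mv _ _ = unit s\<close> U' by simp
  define B where "B = (?U l)(a := \<lambda>p. unit r p + unit s p)"
  have B: "val [i] c B = val [i] c (?U l) + val [i] c (?U l')" for c
  proof -
    have "(?U l)(a := unit r) = ?U l" by (auto simp: r_def)
    then show ?thesis unfolding B_def using val_column_add[OF a(1)] U' by simp
  qed
  have "val [i] (d k) B = (if k = \<beta> then val [i] (d \<beta>) (?U l) else if k = Suc \<beta> then val [i] (d (Suc \<beta>)) (?U l') else 0)"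
    if k: "k \<le> ?b" for k
  proof -
    have 1: "val [i] (d k) (?U l) = 0" if "k \<noteq> \<beta>" using uniq[OF l(1,2) k _ _ l(3)] that by auto
    have 2: "val [i] (d k) (?U l') = 0" if "k \<noteq> Suc \<beta>" using uniq[OF l' k _ _ nz'] that n(2) by auto
    show ?thesis
    proof (cases "k = \<beta>")
      case True then show ?thesis using 2 by (simp add: B)
    next
      case False then show ?thesis using 1 2 by (simp add: B)
    qed
  qed
  moreover have "n = ?b + 1" using n by simp
  ultimately show ?thesis unfolding good_def using l(3) nz' n(2) by blast
qed

end

section \<open>Fundamental factors\<close>

text \<open>A permutation that maps the blocks {2 r, 2 r + 1} to blocks is a permutation of the blocks, which is
  even as it moves them two elements at a time, followed by swaps inside some of the blocks.\<close>

lemma sign_pair_permutation: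
  fixes \<sigma> :: "nat \<Rightarrow> nat"
  assumes "\<sigma> permutes {..<2 * j}" "\<And>r. r < j \<Longrightarrow> \<sigma> (2 * r) div 2 = \<sigma> (2 * r + 1) div 2"
  shows "sign \<sigma> = (\<Prod>r<j. if even (\<sigma> (2 * r)) then 1 else - 1)"
  using assms
proof (induction j arbitrary: \<sigma>)
  case 0
  then show ?case by simp
next
  case (Suc j)
  \<comment> \<open>the case of a fixed last block, with or without a swap inside\<close>
  have fixed: "sign \<sigma> = (\<Prod>r<Suc j. if even (\<sigma> (2 * r)) then 1 else - 1)" if perm: "\<sigma> permutes {..<2 * Suc j}" and div: "\<And>r. r < Suc j \<Longrightarrow> \<sigma> (2 * r) div 2 = \<sigma> (2 * r + 1) div 2"
      and top: "\<sigma> (2 * j) div 2 = j" for \<sigma> :: "nat \<Rightarrow> nat"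
  proof -
    have inj: "inj \<sigma>" using permutes_inj[OF perm] .
    have top': "\<sigma> (2 * j + 1) div 2 = j" using div[of j] top by simp
    have ne: "\<sigma> (2 * j) \<noteq> \<sigma> (2 * j + 1)"
    proof
      assume "\<sigma> (2 * j) = \<sigma> (2 * j + 1)"
      from injD[OF inj this] show False by simp
    qed
    show ?thesis
    proof (cases "\<sigma> (2 * j) = 2 * j")
      case True
      then have t1: "\<sigma> (2 * j + 1) = 2 * j + 1" using top' ne by presburger
      have "\<sigma> permutes {..<2 * j}"
        using perm
      proof (rule permutes_superset)
        fix x assume "x \<in> {..<2 * Suc j} - {..<2 * j}"
        then have "x = 2 * j \<or> x = 2 * j + 1" by auto
        then show "\<sigma> x = x" using True t1 by auto
      qed
      then have "sign \<sigma> = (\<Prod>r<j. if even (\<sigma> (2 * r)) then 1 else - 1)"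
        using div by (intro Suc.IH) auto
      then show ?thesis using True by simp
    next
      case False
      then have s0: "\<sigma> (2 * j) = 2 * j + 1" using top by presburger
      then have s1: "\<sigma> (2 * j + 1) = 2 * j" using top' ne by presburger
      define \<sigma>' where "\<sigma>' = \<sigma> \<circ> Transposition.transpose (2 * j) (2 * j + 1)"
      have sw: "Transposition.transpose (2 * j) (2 * j + 1) permutes {..<2 * Suc j}" by (intro permutes_swap_id) auto
      have p': "\<sigma>' permutes {..<2 * Suc j}" unfolding \<sigma>'_def by (rule permutes_compose[OF sw perm])
      have low: "\<sigma>' x = \<sigma> x" if "x < 2 * j" for x using that by (simp add: \<sigma>'_def Transposition.transpose_def)
      have "\<sigma>' permutes {..<2 * j}"
        using p'
      proof (rule permutes_superset)
        fix x assume "x \<in> {..<2 * Suc j} - {..<2 * j}"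
        then have "x = 2 * j \<or> x = 2 * j + 1" by auto
        then show "\<sigma>' x = x" using s0 s1 by (auto simp: \<sigma>'_def)
      qed
      then have "sign \<sigma>' = (\<Prod>r<j. if even (\<sigma>' (2 * r)) then 1 else - 1)"
        using div low by (intro Suc.IH) auto
      also have "\<dots> = (\<Prod>r<j. if even (\<sigma> (2 * r)) then 1 else - 1)"
        by (intro prod.cong refl) (simp add: low)
      finally have "sign \<sigma>' = (\<Prod>r<j. if even (\<sigma> (2 * r)) then 1 else - 1)" .
      moreover have "sign \<sigma>' = - sign \<sigma>"
        unfolding \<sigma>'_def using perm sw
        by (subst sign_compose) (auto simp: sign_swap_id permutes_imp_permutation[OF finite_lessThan])
      ultimately show ?thesis using s0 by simp
    qed
  qed
  define t where "t = \<sigma> (2 * j) div 2"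
  have perm: "\<sigma> permutes {..<2 * Suc j}" by (rule Suc.prems(1))
  have "\<sigma> (2 * j) < 2 * Suc j" using permutes_in_image[OF perm, of "2 * j"] by auto
  then have tj: "t \<le> j" by (simp add: t_def)
  show ?case
  proof (cases "t = j")
    case True
    then show ?thesis using fixed[OF Suc.prems] by (simp add: t_def)
  next
    case False
    then have "t < j" using tj by simp
    \<comment> \<open>exchanges the blocks t and j\<close>
    define \<rho> where "\<rho> = Transposition.transpose (2 * t) (2 * j) \<circ> Transposition.transpose (2 * t + 1) (2 * j + 1)"
    have s1: "Transposition.transpose (2 * t) (2 * j) permutes {..<2 * Suc j}"
      and s2: "Transposition.transpose (2 * t + 1) (2 * j + 1) permutes {..<2 * Suc j}"
      using \<open>t < j\<close> by (auto intro!: permutes_swap_id)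
    have rp: "\<rho> permutes {..<2 * Suc j}" unfolding \<rho>_def by (rule permutes_compose[OF s2 s1])
    have odd_ne: "Suc (2 * a) \<noteq> 2 * b" for a b :: nat by presburger
    have \<rho>0: "\<rho> (2 * a) = 2 * (Transposition.transpose t j a)" and \<rho>1: "\<rho> (2 * a + 1) = 2 * (Transposition.transpose t j a) + 1" for a
      using odd_ne odd_ne[symmetric] by (auto simp: \<rho>_def Transposition.transpose_def)
    have \<rho>_div: "\<rho> x div 2 = Transposition.transpose t j (x div 2)" and \<rho>_even: "even (\<rho> x) = even x" for x
    proof -
      define a where "a = x div 2"
      have "x = 2 * a \<or> x = 2 * a + 1" unfolding a_def by presburger
      then have "\<rho> x = 2 * Transposition.transpose t j a \<and> x = 2 * a \<or> \<rho> x = 2 * Transposition.transpose t j a + 1 \<and> x = 2 * a + 1"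
        using \<rho>0 \<rho>1 by blast
      then show "\<rho> x div 2 = Transposition.transpose t j (x div 2)" "even (\<rho> x) = even x"
        by (auto simp flip: a_def)
    qed
    have sg: "sign \<rho> = 1"
      unfolding \<rho>_def using s1 s2 \<open>t < j\<close>
      by (subst sign_compose) (auto simp: sign_swap_id permutes_imp_permutation[OF finite_lessThan])
    define \<sigma>' where "\<sigma>' = \<rho> \<circ> \<sigma>"
    have "sign \<sigma>' = sign \<sigma>"
      unfolding \<sigma>'_def using perm rp sg
      by (subst sign_compose) (auto simp: permutes_imp_permutation[OF finite_lessThan])
    moreover have "sign \<sigma>' = (\<Prod>r<Suc j. if even (\<sigma>' (2 * r)) then 1 else - 1)"
    proof (rule fixed)
      show "\<sigma>' permutes {..<2 * Suc j}" unfolding \<sigma>'_def by (rule permutes_compose[OF perm rp])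
      show "\<sigma>' (2 * r) div 2 = \<sigma>' (2 * r + 1) div 2" if "r < Suc j" for r
        using Suc.prems(2)[OF that] by (simp add: \<sigma>'_def \<rho>_div)
      show "\<sigma>' (2 * j) div 2 = j" by (simp add: \<sigma>'_def \<rho>_div flip: t_def)
    qed
    ultimately show ?thesis by (simp add: \<sigma>'_def \<rho>_even)
  qed
qed

context tensor_rank begin

lemma wedge_not_distinct:
  assumes "\<not> distinct l"
  shows "wedge i A l = 0"
proof (cases "length l = i")
  case True
  then obtain x y where xy: "x < i" "y < i" "x \<noteq> y" "l ! x = l ! y"
    using assms by (auto simp: distinct_conv_nth)
  let ?\<tau> = "Transposition.transpose x y"
  have \<tau>: "?\<tau> permutes {..<i}" using xy by (intro permutes_swap_id) auto
  have "pure (map (A \<circ> (\<sigma> \<circ> ?\<tau>)) [0..<i]) l = pure (map (A \<circ> \<sigma>) [0..<i]) l" for \<sigma>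
  proof -
    have "pure (map (A \<circ> (\<sigma> \<circ> ?\<tau>)) [0..<i]) l = (\<Prod>b<i. A (\<sigma> (?\<tau> b)) (l ! (?\<tau> b)))"
      using True xy by (auto simp: pure_prod Transposition.transpose_def intro!: prod.cong)
    also have "\<dots> = (\<Prod>b<i. A (\<sigma> b) (l ! b))"
      using prod.permute[OF \<tau>, of "\<lambda>b. A (\<sigma> b) (l ! b)"] by (simp add: o_def)
    also have "\<dots> = pure (map (A \<circ> \<sigma>) [0..<i]) l" using True by (simp add: pure_prod)
    finally show ?thesis .
  qed
  moreover have "sign (\<sigma> \<circ> ?\<tau>) = - sign \<sigma>" if "\<sigma> permutes {..<i}" for \<sigma>
    using that \<tau> xy by (subst sign_compose) (auto simp: sign_swap_id permutes_imp_permutation[OF finite_lessThan])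
  ultimately have "wedge i A l = (\<Sum>\<sigma> | \<sigma> permutes {..<i}. - (of_int (sign \<sigma>) * pure (map (A \<circ> \<sigma>) [0..<i]) l))"
    unfolding wedge_def by (subst sum_permutations_compose_right[OF \<tau>]) (intro sum.cong refl, simp)
  then show ?thesis by (simp add: wedge_def sum_negf)
qed (simp add: wedge_length)

text \<open>For odd M this form is alternating.  Its alternating signs make the raising matrix kill it away from the boundary
  of the index range.\<close>

definition om :: "nat \<Rightarrow> nat \<Rightarrow> nat \<Rightarrow> complex" where
  "om M k m = (if k + m = M then (-1) ^ k else 0)"

fun omega :: "nat \<Rightarrow> tensor" where
  "omega M [k, m] = om M k m"
| "omega M _ = 0"

definition last_vector :: "bool \<Rightarrow> tensor" where
  "last_vector u l = (if l = (if u then [n - 1] else []) then 1 else 0)"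

text \<open>The product of j of these forms, followed by the last coordinate if u holds.  Only its alternating part
  matters, because it is evaluated on exterior powers.\<close>

fun fund :: "nat \<Rightarrow> bool \<Rightarrow> nat \<Rightarrow> tensor" where
  "fund M u 0 = last_vector u"
| "fund M u (Suc j) = tens 2 (omega M) (fund M u j)"

lemma fund_eq:
  assumes "length ws = 2 * j + of_bool u"
  shows "fund M u j ws = (\<Prod>r<j. om M (ws ! (2 * r)) (ws ! (2 * r + 1))) * (if u \<and> ws ! (2 * j) \<noteq> n - 1 then 0 else 1)"
  using assms
proof (induction j arbitrary: ws)
  case 0
  show ?case
  proof (cases u)
    case True
    then obtain x where "ws = [x]" using 0 by (cases ws) auto
    then show ?thesis using True by (simp add: last_vector_def)
  qed (use 0 in \<open>simp add: last_vector_def\<close>)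
next
  case (Suc j)
  then obtain k m vs where ws: "ws = k # m # vs" "length vs = 2 * j + of_bool u"
    by (cases ws; cases "tl ws") auto
  show ?case using Suc.IH[OF ws(2)]
    by (simp add: ws tens_def prod.lessThan_Suc_shift numeral_2_eq_2 del: prod.lessThan_Suc)
qed

lemma fund_sum:
  assumes "length ws = 2 * j + of_bool u" "fund M u j ws \<noteq> 0"
  shows "sum_list ws = j * M + (if u then n - 1 else 0) \<and> (u \<longrightarrow> n - 1 \<in> set ws)"
  using assms
proof (induction j arbitrary: ws)
  case 0
  then show ?case by (auto simp: last_vector_def split: if_splits)
next
  case (Suc j)
  then obtain k m vs where ws: "ws = k # m # vs" "length vs = 2 * j + of_bool u"
    by (cases ws; cases "tl ws") auto
  have "fund M u j vs \<noteq> 0" "om M k m \<noteq> 0" using Suc.prems(2) by (auto simp: ws tens_def numeral_2_eq_2)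
  then show ?case using Suc.IH[OF ws(2)] by (auto simp: ws om_def split: if_splits)
qed

text \<open>Inside the index range the two terms cancel.  What remains sits at k + m = M + 1 with k or m zero.  The other index is
  then M + 1, which is out of range unless M + 2 = n.\<close>

lemma act_raise_omega:
  assumes "k < n" "m < n" "act raise (omega M) [k, m] \<noteq> 0" "M + 2 \<ge> n"
  shows "M + 2 = n \<and> n - 1 \<in> {k, m}"
proof -
  have "act raise (omega M) [k, m] = (\<Sum>q<n. raise k q * om M q m) + (\<Sum>q<n. raise m q * om M k q)"
    by simp
  also have "(\<Sum>q<n. raise k q * om M q m) = (if k = 0 then 0 else om M (k - 1) m)"
  proof (cases k)
    case (Suc r)
    have "(\<Sum>q<n. raise k q * om M q m) = (\<Sum>q\<in>{r}. raise k q * om M q m)"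
      using assms Suc by (intro sum.mono_neutral_right) (auto simp: raise_def)
    then show ?thesis by (simp add: Suc raise_def)
  qed (auto simp: raise_def)
  also have "(\<Sum>q<n. raise m q * om M k q) = (if m = 0 then 0 else om M k (m - 1))"
  proof (cases m)
    case (Suc r)
    have "(\<Sum>q<n. raise m q * om M k q) = (\<Sum>q\<in>{r}. raise m q * om M k q)"
      using assms Suc by (intro sum.mono_neutral_right) (auto simp: raise_def)
    then show ?thesis by (simp add: Suc raise_def)
  qed (auto simp: raise_def)
  finally have "(if k = 0 then 0 else om M (k - 1) m) + (if m = 0 then 0 else om M k (m - 1)) \<noteq> 0"
    using assms(3) by simp
  then have "k + m = M + 1 \<and> (k = 0 \<or> m = 0)"
    by (cases k; cases m) (auto simp: om_def split: if_splits)
  then show ?thesis using assms by auto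
qed

text \<open>If M + 2 = n and u holds, then the remaining term has a letter n - 1 in addition to the one that u forces, and a word
  with a repeated letter is not seen by exterior powers.\<close>

lemma act_raise_fund:
  assumes "length ws = 2 * j + of_bool u" "set ws \<subseteq> {..<n}" "n \<ge> 1"
    and M: "M + 1 \<ge> n \<or> (u \<and> M + 2 = n)" and "act raise (fund M u j) ws \<noteq> 0"
  shows "\<not> distinct ws"
  using assms(1,2,5)
proof (induction j arbitrary: ws)
  case 0
  show ?case
  proof (cases u)
    case True
    then obtain x where x: "ws = [x]" using 0 by (cases ws) auto
    have "act raise (last_vector u) [x] = (\<Sum>q<n. raise x q * last_vector u [q])" by simp
    also have "\<dots> = 0" using True 0 x assms(3) by (intro sum.neutral) (auto simp: last_vector_def raise_def)
    finally show ?thesis using 0 x by simp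
  qed (use 0 in simp)
next
  case (Suc j)
  then obtain k m vs where ws: "ws = k # m # vs" "length vs = 2 * j + of_bool u"
    by (cases ws; cases "tl ws") auto
  have "act raise (fund M u (Suc j)) ws = tens 2 (act raise (omega M)) (fund M u j) ws
      + tens 2 (omega M) (act raise (fund M u j)) ws"
    using Suc.prems(1) by (simp add: act_tens)
  also have "\<dots> = act raise (omega M) [k, m] * fund M u j vs + om M k m * act raise (fund M u j) vs"
    by (simp add: ws tens_def numeral_2_eq_2 del: act.simps)
  finally consider "act raise (omega M) [k, m] \<noteq> 0" "fund M u j vs \<noteq> 0" | "act raise (fund M u j) vs \<noteq> 0"
    using Suc.prems(3) by (metis add_0 mult_zero_left mult_zero_right)
  then show ?case
  proof cases
    case 1
    then have "M + 2 = n \<and> n - 1 \<in> {k, m}"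
      using act_raise_omega[of k m M] Suc.prems(2) M by (auto simp: ws)
    then have "u" using M by auto
    then have "n - 1 \<in> set vs" using fund_sum[OF ws(2) 1(2)] by simp
    then show ?thesis using \<open>M + 2 = n \<and> _\<close> by (auto simp: ws)
  next
    case 2
    then show ?thesis using Suc.IH[of vs] ws Suc.prems(2) by auto
  qed
qed

lemma act_grade: "set l \<subseteq> {..<n} \<Longrightarrow> act grade \<tau> l = (2 * of_nat (sum_list l) + of_nat (length l) * (1 - of_nat n)) * \<tau> l"
proof (induction l arbitrary: \<tau>)
  case (Cons p l)
  have "(\<Sum>q<n. grade p q * \<tau> (q # l)) = (\<Sum>q\<in>{p}. grade p q * \<tau> (q # l))"
    using Cons.prems by (intro sum.mono_neutral_right) (auto simp: grade_def)
  also have "\<dots> = (2 * of_nat p + 1 - of_nat n) * \<tau> (p # l)" by (simp add: grade_def)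
  finally have "act grade \<tau> (p # l) = (2 * of_nat p + 1 - of_nat n) * \<tau> (p # l)
      + (2 * of_nat (sum_list l) + of_nat (length l) * (1 - of_nat n)) * \<tau> (p # l)"
    using Cons.IH[of "\<lambda>m. \<tau> (p # m)"] Cons.prems by simp
  then show ?case by (simp add: algebra_simps)
qed simp

lemma val_units:
  assumes "\<And>a. a < i \<Longrightarrow> x a < n"
  shows "val [i] c (\<lambda>a. unit (x a)) = (\<Sum>\<sigma> | \<sigma> permutes {..<i}. of_int (sign \<sigma>) * c (map (x \<circ> \<sigma>) [0..<i]))"
proof -
  have P: "pure (map unit ws) l = (if l = ws then 1 else 0)" for ws l
  proof (induction ws arbitrary: l)
    case Nil
    show ?case by (cases l) auto
  next
    case (Cons w ws)
    then show ?case by (cases l) (auto simp: unit_def)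
  qed
  have "pairing i c (pure (map ((\<lambda>a. unit (x a)) \<circ> \<sigma>) [0..<i])) = c (map (x \<circ> \<sigma>) [0..<i])"
    if \<sigma>: "\<sigma> permutes {..<i}" for \<sigma>
  proof -
    let ?w = "map (x \<circ> \<sigma>) [0..<i]"
    have "map ((\<lambda>a. unit (x a)) \<circ> \<sigma>) [0..<i] = map unit ?w" by simp
    then have "pairing i c (pure (map ((\<lambda>a. unit (x a)) \<circ> \<sigma>) [0..<i])) = (\<Sum>l\<in>words i. if l = ?w then c l else 0)"
      unfolding pairing_def by (intro sum.cong refl) (simp only: P, simp)
    moreover have "?w \<in> words i"
      using assms permutes_in_image[OF \<sigma>] by (auto simp: words_def)
    ultimately show ?thesis by simp
  qed
  then show ?thesis
    unfolding val_single wedge_def pairing_sum_right pairing_scale_right by simp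
qed

text \<open>The sequence 1, M - 1, 2, M - 2, ..., with n - 1 at the position 2 j.\<close>

definition col :: "nat \<Rightarrow> nat \<Rightarrow> nat \<Rightarrow> nat" where
  "col M j a = (if a = 2 * j then n - 1 else if even a then a div 2 + 1 else M - (a div 2 + 1))"

text \<open>At the basis columns given by \<open>col\<close>, a permutation contributes only if it maps the pairs of indices with sum M to
  such pairs.  Its sign then compensates the sign of the product of forms (\<open>sign_pair_permutation\<close>), so all nonzero
  contributions equal \<kappa> and cannot cancel.\<close>

lemma fund_nonzero:
  assumes M: "odd M" "2 * j < M" "M \<le> n" "u \<Longrightarrow> M \<le> n - 1" "n \<ge> 2" and i: "i = 2 * j + of_bool u"
  shows "\<exists>A. val [i] (fund M u j) A \<noteq> 0"
proof -
  let ?x = "col M j"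
  have xn: "?x a < n" if "a < i" for a
  proof -
    have "a = 2 * j \<or> a div 2 < j" using that i by (cases u) auto
    then show ?thesis using M by (auto simp: col_def)
  qed
  have even_x: "?x (2 * s) = s + 1" and odd_x: "?x (2 * s + 1) = M - (s + 1)" if "s < j" for s
    using that by (auto simp: col_def)
  have pair: "a div 2 = b div 2" if ab: "a < 2 * j" "b < 2 * j" "?x a + ?x b = M" for a b
  proof -
    have "a div 2 < j" "b div 2 < j" using ab by auto
    then show ?thesis using ab M(2) by (auto simp: col_def split: if_splits)
  qed
  define \<kappa> where "\<kappa> = (\<Prod>r<j. (-1::complex) ^ (r + 1))"
  have "\<kappa> \<noteq> 0" by (simp add: \<kappa>_def)
  have term_val: "of_int (sign \<sigma>) * fund M u j (map (?x \<circ> \<sigma>) [0..<i]) \<in> {0, \<kappa>}"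
    and term_id: "\<sigma> = id \<Longrightarrow> of_int (sign \<sigma>) * fund M u j (map (?x \<circ> \<sigma>) [0..<i]) = \<kappa>"
    if \<sigma>: "\<sigma> permutes {..<i}" for \<sigma>
  proof -
    have f: "fund M u j (map (?x \<circ> \<sigma>) [0..<i])
      = (\<Prod>r<j. om M (?x (\<sigma> (2 * r))) (?x (\<sigma> (2 * r + 1)))) * (if u \<and> ?x (\<sigma> (2 * j)) \<noteq> n - 1 then 0 else 1)"
    proof -
      define L where "L = map (?x \<circ> \<sigma>) [0..<i]"
      have nth: "L ! a = ?x (\<sigma> a)" if "a < i" for a using that by (simp add: L_def)
      have "fund M u j L = (\<Prod>r<j. om M (L ! (2 * r)) (L ! (2 * r + 1))) * (if u \<and> L ! (2 * j) \<noteq> n - 1 then 0 else 1)"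
        using i by (intro fund_eq) (simp add: L_def)
      also have "(\<Prod>r<j. om M (L ! (2 * r)) (L ! (2 * r + 1))) = (\<Prod>r<j. om M (?x (\<sigma> (2 * r))) (?x (\<sigma> (2 * r + 1))))"
        using i by (intro prod.cong refl) (simp add: nth)
      also have "(if u \<and> L ! (2 * j) \<noteq> n - 1 then 0 else 1 :: complex) = (if u \<and> ?x (\<sigma> (2 * j)) \<noteq> n - 1 then 0 else 1)"
        using i by (cases u) (simp_all add: nth)
      finally show ?thesis by (simp only: L_def)
    qed
    have main: "of_int (sign \<sigma>) * fund M u j (map (?x \<circ> \<sigma>) [0..<i]) = \<kappa>"
      if nz: "fund M u j (map (?x \<circ> \<sigma>) [0..<i]) \<noteq> 0"
    proof -
      have om_nz: "om M (?x (\<sigma> (2 * r))) (?x (\<sigma> (2 * r + 1))) \<noteq> 0" if "r < j" for r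
        using nz that unfolding f by auto
      have last: "\<sigma> (2 * j) = 2 * j"
      proof (cases u)
        case True
        then have "?x (\<sigma> (2 * j)) = n - 1" using nz unfolding f by (auto split: if_splits)
        moreover have "\<sigma> (2 * j) < i" using permutes_in_image[OF \<sigma>, of "2 * j"] i True by simp
        ultimately show ?thesis using M True i by (auto simp: col_def split: if_splits)
      next
        case False
        then show ?thesis using permutes_not_in[OF \<sigma>, of "2 * j"] i by simp
      qed
      have \<sigma>': "\<sigma> permutes {..<2 * j}"
        using \<sigma>
      proof (rule permutes_superset)
        fix y assume "y \<in> {..<i} - {..<2 * j}"
        then have "y = 2 * j" using i by (cases u) auto
        then show "\<sigma> y = y" using last by simp
      qed
      have lt: "\<sigma> a < 2 * j" if "a < 2 * j" for a using permutes_in_image[OF \<sigma>', of a] that by simp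
      have div: "\<sigma> (2 * r) div 2 = \<sigma> (2 * r + 1) div 2" if "r < j" for r
        using om_nz[OF that] pair[of "\<sigma> (2 * r)" "\<sigma> (2 * r + 1)"] lt that
        by (auto simp: om_def split: if_splits)
      define \<tau> where "\<tau> = (\<lambda>r. \<sigma> (2 * r) div 2)"
      have \<tau>_bij: "bij_betw \<tau> {..<j} {..<j}"
      proof -
        have "inj_on \<tau> {..<j}"
        proof (rule inj_onI, rule ccontr)
          fix r s assume rs: "r \<in> {..<j}" "s \<in> {..<j}" "\<tau> r = \<tau> s" "r \<noteq> s"
          have d: "\<sigma> (2 * r) div 2 = \<sigma> (2 * s) div 2" "\<sigma> (2 * r + 1) div 2 = \<sigma> (2 * s) div 2"
            using rs div[of r] by (auto simp: \<tau>_def)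
          have "2 * r \<noteq> 2 * r + 1" "2 * r \<noteq> 2 * s" "2 * r + 1 \<noteq> 2 * s" using rs(4) by presburger+
          then have "\<sigma> (2 * r) \<noteq> \<sigma> (2 * r + 1)" "\<sigma> (2 * r) \<noteq> \<sigma> (2 * s)" "\<sigma> (2 * r + 1) \<noteq> \<sigma> (2 * s)"
            by (simp_all only: inj_eq[OF permutes_inj[OF \<sigma>]] not_False_eq_True)
          moreover have "x = y \<or> x = z \<or> y = z" if "x div 2 = z div 2" "y div 2 = z div 2" for x y z :: nat
          proof -
            have "x mod 2 = y mod 2 \<or> x mod 2 = z mod 2 \<or> y mod 2 = z mod 2" by (auto simp: mod2_eq_if)
            then show ?thesis using that by (metis div_mult_mod_eq)
          qed
          ultimately show False using d by blast
        qed
        moreover have "\<tau> ` {..<j} \<subseteq> {..<j}" using lt by (auto simp: \<tau>_def) (metis less_mult_imp_div_less mult.commute nat_mult_less_cancel_disj zero_less_numeral)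
        ultimately show ?thesis by (simp add: bij_betw_def card_image card_subset_eq)
      qed
      have om: "om M (?x (\<sigma> (2 * r))) (?x (\<sigma> (2 * r + 1))) = (if even (\<sigma> (2 * r)) then 1 else - 1) * (-1) ^ (\<tau> r + 1)"
        if r: "r < j" for r
      proof -
        have s: "?x (\<sigma> (2 * r)) + ?x (\<sigma> (2 * r + 1)) = M"
          using om_nz[OF r] by (auto simp: om_def split: if_splits)
        have tr: "\<tau> r < j" using \<tau>_bij r by (auto simp: bij_betw_def)
        show ?thesis
        proof (cases "even (\<sigma> (2 * r))")
          case True
          then have "\<sigma> (2 * r) = 2 * \<tau> r" by (auto simp: \<tau>_def)
          then show ?thesis using s True even_x[OF tr] by (simp add: om_def)
        next
          case False
          then have "\<sigma> (2 * r) = 2 * \<tau> r + 1" by (simp add: \<tau>_def)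
          then have x: "?x (\<sigma> (2 * r)) = M - (\<tau> r + 1)" using odd_x[OF tr] by simp
          \<comment> \<open>here M has to be odd\<close>
          have "(-1) ^ (M - (\<tau> r + 1)) = - ((-1::complex) ^ (\<tau> r + 1))"
            using M(1,2) tr by (cases "even (\<tau> r)") (auto simp: uminus_power_if)
          then show ?thesis using s False x by (simp add: om_def)
        qed
      qed
      have "fund M u j (map (?x \<circ> \<sigma>) [0..<i]) = (\<Prod>r<j. om M (?x (\<sigma> (2 * r))) (?x (\<sigma> (2 * r + 1))))"
        using nz unfolding f by (auto split: if_splits)
      also have "\<dots> = (\<Prod>r<j. if even (\<sigma> (2 * r)) then 1 else - 1) * (\<Prod>r<j. (-1) ^ (\<tau> r + 1))"
        unfolding prod.distrib[symmetric] using om by (intro prod.cong refl) auto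
      also have "(\<Prod>r<j. (-1::complex) ^ (\<tau> r + 1)) = \<kappa>"
        unfolding \<kappa>_def by (rule prod.reindex_bij_betw[OF \<tau>_bij])
      also have "(\<Prod>r<j. if even (\<sigma> (2 * r)) then 1 else - 1) = (of_int (sign \<sigma>) :: complex)"
      proof -
        have "of_int (\<Prod>r<j. if even (\<sigma> (2 * r)) then 1 else - 1) = (\<Prod>r<j. if even (\<sigma> (2 * r)) then 1 else (- 1 :: complex))"
          unfolding of_int_prod by (intro prod.cong) auto
        moreover have "sign \<sigma> = (\<Prod>r<j. if even (\<sigma> (2 * r)) then 1 else - 1)"
          using \<sigma>' div by (rule sign_pair_permutation)
        ultimately show ?thesis by (simp only:)
      qed
      finally have fe: "fund M u j (map (?x \<circ> \<sigma>) [0..<i]) = of_int (sign \<sigma>) * \<kappa>" .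
      have "of_int (sign \<sigma>) * of_int (sign \<sigma>) = (1::complex)"
        by (metis of_int_1 of_int_mult sign_idempotent)
      then show ?thesis unfolding fe by (simp only: mult.assoc[symmetric] mult_1_left)
    qed
    then show "of_int (sign \<sigma>) * fund M u j (map (?x \<circ> \<sigma>) [0..<i]) \<in> {0, \<kappa>}" by auto
    show "of_int (sign \<sigma>) * fund M u j (map (?x \<circ> \<sigma>) [0..<i]) = \<kappa>" if "\<sigma> = id"
    proof (rule main)
      have "?x (2 * r) + ?x (2 * r + 1) = M" if "r < j" for r
        using even_x[OF that] odd_x[OF that] that M(2) by simp
      then have "om M (?x (\<sigma> (2 * r))) (?x (\<sigma> (2 * r + 1))) \<noteq> 0" if "r < j" for r
        using that by (simp add: \<open>\<sigma> = id\<close> om_def)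
      moreover have "?x (\<sigma> (2 * j)) = n - 1" by (simp add: \<open>\<sigma> = id\<close> col_def)
      ultimately show "fund M u j (map (?x \<circ> \<sigma>) [0..<i]) \<noteq> 0" unfolding f by auto
    qed
  qed
  let ?T = "\<lambda>\<sigma>. of_int (sign \<sigma>) * fund M u j (map (?x \<circ> \<sigma>) [0..<i])"
  let ?P = "{\<sigma>. \<sigma> permutes {..<i}}"
  have fin: "finite ?P" by (simp add: finite_permutations)
  have "(\<Sum>\<sigma>\<in>?P. ?T \<sigma>) = (\<Sum>\<sigma>\<in>{\<sigma>\<in>?P. ?T \<sigma> \<noteq> 0}. ?T \<sigma>)"
    using fin by (intro sum.mono_neutral_right) auto
  also have "\<dots> = (\<Sum>\<sigma>\<in>{\<sigma>\<in>?P. ?T \<sigma> \<noteq> 0}. \<kappa>)"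
    using term_val by (intro sum.cong refl) blast
  also have "\<dots> = of_nat (card {\<sigma>\<in>?P. ?T \<sigma> \<noteq> 0}) * \<kappa>" by simp
  also have "\<dots> \<noteq> 0"
  proof -
    have "id \<in> {\<sigma>\<in>?P. ?T \<sigma> \<noteq> 0}" using term_id[OF permutes_id] \<open>\<kappa> \<noteq> 0\<close> permutes_id by auto
    then have "{\<sigma>\<in>?P. ?T \<sigma> \<noteq> 0} \<noteq> {}" by blast
    moreover have "finite {\<sigma>\<in>?P. ?T \<sigma> \<noteq> 0}" using fin by simp
    ultimately have "card {\<sigma>\<in>?P. ?T \<sigma> \<noteq> 0} \<noteq> 0" by (simp only: card_eq_0_iff) simp
    then show ?thesis using \<open>\<kappa> \<noteq> 0\<close> by simp
  qed
  finally have "val [i] (fund M u j) (\<lambda>a. unit (?x a)) \<noteq> 0" using xn by (simp add: val_units)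
  then show ?thesis by blast
qed

lemma fund_highest:
  assumes M: "odd M" "2 * j < M" "M \<le> n" "u \<Longrightarrow> M \<le> n - 1" "n \<ge> 2" "M + 1 \<ge> n \<or> (u \<and> M + 2 = n)"
    and i: "i = 2 * j + of_bool u"
  shows "highest [i] (2 * int j * int M + (if u then 2 * (int n - 1) else 0) + int i * (1 - int n)) (fund M u j)"
  unfolding highest_def
proof (intro conjI allI)
  let ?w = "2 * int j * int M + (if u then 2 * (int n - 1) else 0) + int i * (1 - int n)"
  fix A
  show "val [i] (act raise (fund M u j)) A = 0"
    unfolding val_single pairing_def
  proof (intro sum.neutral ballI)
    fix l assume "l \<in> words i"
    then have l: "length l = 2 * j + of_bool u" "set l \<subseteq> {..<n}" using i by (auto simp: words_def)
    show "act raise (fund M u j) l * wedge i A l = 0"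
    proof (cases "act raise (fund M u j) l = 0")
      case False
      then have "\<not> distinct l" using act_raise_fund[OF l _ M(6)] M(5) by linarith
      then show ?thesis by (simp add: wedge_not_distinct)
    qed simp
  qed
  have "act grade (fund M u j) l = of_int ?w * fund M u j l" if l: "length l = i" "set l \<subseteq> {..<n}" for l
  proof (cases "fund M u j l = 0")
    case True
    then show ?thesis using l by (simp add: act_grade)
  next
    case False
    then have "sum_list l = j * M + (if u then n - 1 else 0)" using fund_sum[of l j u M] l(1) i by simp
    then have "2 * of_nat (sum_list l) + of_nat (length l) * (1 - of_nat n) = (of_int ?w :: complex)"
      using l(1) M(5) by (simp add: of_nat_diff algebra_simps)
    then show ?thesis using l(2) by (simp only: act_grade)
  qed
  then have "val [i] (act grade (fund M u j)) A = val [i] (\<lambda>l. of_int ?w * fund M u j l) A"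
    by (intro val_cong) simp
  then show "val [i] (act grade (fund M u j)) A = of_int ?w * val [i] (fund M u j) A"
    by (simp only: val_scale)
next
  show "\<exists>A. val [i] (fund M u j) A \<noteq> 0" using fund_nonzero[OF M(1-5) i] .
qed

text \<open>M is chosen as large as the parities permit.  The resulting weights are 0 or n - 1 if n is even, and i or n - i if n is
  odd.  The only odd weight is n - 1 with n even.\<close>

lemma good_factor:
  assumes n: "n \<ge> 3" and i: "1 \<le> i" "i < n"
  shows "\<exists>b d. strung [i] b d \<and> b < n \<and> good i b d"
proof -
  define j where "j = i div 2"
  define u where "u = odd i"
  define M where "M = (if even n then n - 1 else if even i then n else n - 2)"
  have iu: "i = 2 * j + of_bool u" by (auto simp: j_def u_def)
  have M: "odd M" "2 * j < M" "M \<le> n" "u \<Longrightarrow> M \<le> n - 1" "M + 1 \<ge> n \<or> (u \<and> M + 2 = n)"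
    using n i by (auto simp: M_def j_def u_def) presburger+
  define w where "w = 2 * int j * int M + (if u then 2 * (int n - 1) else 0) + int i * (1 - int n)"
  have "highest [i] w (fund M u j)" unfolding w_def using fund_highest[OF M(1-4) _ M(5) iu] n by simp
  then obtain b d where bd: "w = int b" "strung [i] b d" using highest_string by blast
  have w: "w = (if even n then (if even i then 0 else int n - 1) else (if even i then int i else int n - int i))"
  proof -
    have "int i = 2 * int j + of_bool u" using iu by simp
    moreover have "int M = (if even n then int n - 1 else if even i then int n else int n - 2)"
      using n by (auto simp: M_def of_nat_diff)
    ultimately show ?thesis unfolding w_def by (auto simp: u_def algebra_simps)
  qed
  have b: "even n \<and> even i \<and> b = 0 \<or> even n \<and> odd i \<and> b = n - 1 \<or> odd n \<and> even i \<and> b = i \<or> odd n \<and> odd i \<and> b = n - i"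
    using w bd(1) n i by (auto split: if_splits)
  have "b < n" using b n i by auto
  moreover have "good i b d"
  proof (cases "even b")
    case True
    then show ?thesis using good_even bd(2) by (metis evenE)
  next
    case False
    have "even n \<and> b = n - 1" using b False by auto
    moreover obtain \<beta> where "b = 2 * \<beta> + 1" using False oddE by blast
    moreover from calculation have "n = 2 * \<beta> + 2" "1 \<le> \<beta>" using n by linarith+
    ultimately show ?thesis using good_odd[of i \<beta> d] bd(2) by simp
  qed
  ultimately show ?thesis using bd(2) by blast
qed

text \<open>The hypothesis n \<ge> 3 excludes n = 2, where the odd weight 1 would have \<beta> = 0 in \<open>good_odd\<close>.\<close>

theorem small_highest:
  assumes n: "n \<ge> 3" and "is": "\<And>i. i \<in> set is \<Longrightarrow> 1 \<le> i \<and> i < n"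
  shows "\<exists>w c. highest is w c \<and> w < int n"
  using "is"
proof (induction "is")
  case Nil
  define c :: tensor where "c = (\<lambda>l. if l = [] then 1 else 0)"
  have "highest [] 0 c" by (auto simp: highest_def val_def pairing_def c_def)
  then show ?case using n by (intro exI conjI) auto
next
  case (Cons i "is")
  then obtain w c where c: "highest is w c" "w < int n" by auto
  then obtain a C where "w = int a" "strung is a C" using highest_string by blast
  moreover obtain b d where "strung [i] b d" "b < n" "good i b d" using good_factor[OF n, of i] Cons.prems[of i] by auto
  ultimately show ?case using add_factor c(2) by auto
qed

end

section \<open>Matrix units and the highest weight tensor\<close>

context tensor_rank
begin

definition EM :: "nat \<Rightarrow> nat \<Rightarrow> mat" where
  "EM p q a b = (if a = p \<and> b = q then 1 else 0)"

lemma mm_EM_left: "q < n \<Longrightarrow> mm (EM p q) Y a b = (if a = p then Y q b else 0)"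
  by (simp add: mm_def EM_def if_distrib[of "\<lambda>x. x * _"] cong: if_cong)

lemma mm_EM: "q < n \<Longrightarrow> mm (EM p q) (EM r s) a b = (if q = r then EM p s a b else 0)"
  by (auto simp: mm_EM_left EM_def)

lemma mm_grade_left: "a < n \<Longrightarrow> mm grade Y a b = grade a a * Y a b"
  by (simp add: mm_def grade_def if_distrib[of "\<lambda>x. x * _"] cong: if_cong)

lemma mm_grade_right: "b < n \<Longrightarrow> mm Y grade a b = Y a b * grade b b"
  by (simp add: mm_def grade_def if_distrib[of "\<lambda>x. _ * x"] cong: if_cong)

lemma mm_transpose: "mm (\<lambda>p q. X q p) (\<lambda>p q. Y q p) p q = mm Y X q p"
  by (simp add: mm_def mult.commute)

lemma mm_uminus: "mm (\<lambda>p q. - X p q) Y p q = - mm X Y p q" "mm X (\<lambda>p q. - Y p q) p q = - mm X Y p q"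
  by (simp_all add: mm_def sum_negf)

lemma grade_sym: "(\<lambda>p q. - grade q p) = (\<lambda>p q. - grade p q)"
  by (auto simp: fun_eq_iff grade_def)

lemma EM_transpose: "(\<lambda>a b. EM p q b a) = EM q p"
  by (auto simp: EM_def fun_eq_iff)

lemma pairing_raise: "pairing M c (act (EM p q) \<tau>) = pairing M (act (EM q p) c) \<tau>"
  unfolding pairing_act EM_transpose ..

lemma act_cong_words:
  assumes "\<And>l. l \<in> words N \<Longrightarrow> \<tau> l = \<sigma> l" "l \<in> words N"
  shows "act X \<tau> l = act X \<sigma> l"
proof -
  have "l[a := q] \<in> words N" if "q < n" for a q
    using assms(2) that set_update_subset_insert[of l a q] by (auto simp: words_def)
  then show ?thesis unfolding act_explicit using assms(1) by (intro sum.cong refl) auto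
qed

lemma pairing_cong: "(\<And>l. l \<in> words N \<Longrightarrow> c l * \<tau> l = d l * \<sigma> l) \<Longrightarrow> pairing N c \<tau> = pairing N d \<sigma>"
  unfolding pairing_def by (rule sum.cong) auto

lemma act_identity:
  assumes "l \<in> words N"
  shows "act (\<lambda>p q. if p = q then 1 else 0) \<tau> l = of_nat N * \<tau> l"
proof -
  have "(\<Sum>q<n. (if l ! a = q then 1 else 0) * \<tau> (l[a := q])) = \<tau> l" if "a < length l" for a
  proof -
    have "l ! a < n" using assms nth_mem[OF that] by (auto simp: words_def)
    moreover have "(\<Sum>q<n. (if l ! a = q then 1 else 0) * \<tau> (l[a := q])) = (\<Sum>q<n. if l ! a = q then \<tau> l else 0)"
      by (intro sum.cong refl) auto
    ultimately show ?thesis by simp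
  qed
  then show ?thesis unfolding act_explicit using assms by (simp add: words_def)
qed

lemma flag_unit_real: "cnj (flag is unit l) = flag is unit l"
proof (induction "is" arbitrary: l)
  case (Cons i "is")
  have p: "cnj (pure (map unit xs) l) = pure (map unit xs) l" for xs l
  proof (induction xs arbitrary: l)
    case Nil
    show ?case by (cases l) auto
  next
    case (Cons x xs)
    then show ?case by (cases l) (auto simp: unit_def)
  qed
  have "cnj (wedge i unit l) = wedge i unit l" for l
    unfolding wedge_def cnj_sum complex_cnj_mult complex_cnj_of_int p[of "map \<sigma> [0..<i]" for \<sigma>, unfolded map_map] ..
  then show ?case using Cons by (simp add: tens_def)
qed simp

lemma cnj_act: "cnj (act X \<tau> l) = act (\<lambda>p q. cnj (X p q)) (\<lambda>m. cnj (\<tau> m)) l"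
  by (simp add: act_explicit)

lemma grade_trace: "(\<Sum>p<n. grade p p) = 0"
proof -
  have "(\<Sum>p<m. 2 * of_nat p + 1 - of_nat n) = (of_nat m * (of_nat m - of_nat n) :: complex)" for m
    by (induction m) (auto simp: algebra_simps)
  then show ?thesis by (simp add: grade_def)
qed

lemma mm_trace: "(\<Sum>p<n. mm X Y p p - mm Y X p p) = 0"
proof -
  have "(\<Sum>p<n. mm X Y p p) = (\<Sum>p<n. mm Y X p p)"
    unfolding mm_def by (subst sum.swap) (simp add: mult.commute)
  then show ?thesis by (simp add: sum_subtractf)
qed

lemma wedge_equal_columns:
  assumes "x < i" "y < i" "x \<noteq> y" "A x = A y"
  shows "wedge i A l = 0"
proof -
  let ?\<tau> = "Transposition.transpose x y"
  have \<tau>: "?\<tau> permutes {..<i}" using assms by (intro permutes_swap_id) auto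
  have "A (?\<tau> a) = A a" for a using assms(4) by (auto simp: Transposition.transpose_def)
  then have A: "A \<circ> (?\<tau> \<circ> \<sigma>) = A \<circ> \<sigma>" for \<sigma> by (auto simp: fun_eq_iff)
  have s: "sign (?\<tau> \<circ> \<sigma>) = - sign \<sigma>" if "\<sigma> permutes {..<i}" for \<sigma>
    using that \<tau> assms by (subst sign_compose) (auto simp: sign_swap_id permutes_imp_permutation[OF finite_lessThan])
  have "wedge i A l = (\<Sum>\<sigma> | \<sigma> permutes {..<i}. - (of_int (sign \<sigma>) * pure (map (A \<circ> \<sigma>) [0..<i]) l))"
    unfolding wedge_def by (subst setum_permutations_compose_left[OF \<tau>]) (intro sum.cong refl, simp only: mem_Collect_eq A s of_int_minus mult_minus_left)
  then show ?thesis by (simp add: wedge_def sum_negf)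
qed

lemma act_EM_wedge:
  assumes "i \<le> n" "q < n"
  shows "act (EM p q) (wedge i unit) l = (if q < i then wedge i (unit(q := unit p)) l else 0)"
proof -
  have m: "mv (EM p q) (unit a) = (if a = q then unit p else (\<lambda>_. 0))" if "a < i" for a
    using that assms by (auto simp: mv_unit EM_def unit_def fun_eq_iff)
  have z: "wedge i (unit(a := (\<lambda>_. 0))) l = 0" if "a < i" for a
    unfolding wedge_def
  proof (intro sum.neutral ballI)
    fix \<sigma> assume "\<sigma> \<in> {\<sigma>. \<sigma> permutes {..<i}}"
    then have \<sigma>: "\<sigma> permutes {..<i}" by simp
    have "a \<in> \<sigma> ` {..<i}" unfolding permutes_image[OF \<sigma>] using \<open>a < i\<close> by simp
    then obtain b where b: "b < i" "\<sigma> b = a" by auto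
    have "pure (map (unit(a := (\<lambda>_. 0)) \<circ> \<sigma>) [0..<i]) l = 0"
    proof (cases "length l = i")
      case True
      then have "pure (map (unit(a := (\<lambda>_. 0)) \<circ> \<sigma>) [0..<i]) l = (\<Prod>c<i. (unit(a := (\<lambda>_. 0))) (\<sigma> c) (l ! c))"
        by (simp add: pure_prod)
      also have "\<dots> = 0" using b by (intro prod_zero) auto
      finally show ?thesis .
    qed (simp add: pure_length)
    then show "of_int (sign \<sigma>) * pure (map (unit(a := (\<lambda>_. 0)) \<circ> \<sigma>) [0..<i]) l = 0" by simp
  qed
  have "act (EM p q) (wedge i unit) l = (\<Sum>a<i. if a = q then wedge i (unit(q := unit p)) l else 0)"
    unfolding act_wedge by (intro sum.cong refl) (auto simp: m z)
  then show ?thesis by simp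
qed

text \<open>A matrix unit above the diagonal replaces a column by an earlier one, which each exterior power already contains.\<close>

lemma act_raising_flag:
  "(\<And>i. i \<in> set is \<Longrightarrow> i \<le> n) \<Longrightarrow> p < q \<Longrightarrow> q < n \<Longrightarrow> length l = sum_list is \<Longrightarrow> act (EM p q) (flag is unit) l = 0"
proof (induction "is" arbitrary: l)
  case (Cons i "is")
  have "act (EM p q) (wedge i unit) m = 0" for m
    using Cons.prems wedge_equal_columns[of p i q "unit(q := unit p)" m] by (auto simp: act_EM_wedge)
  then show ?case using Cons by (simp add: act_tens) (simp add: tens_def)
qed simp

lemma act_diagonal_flag:
  "(\<And>i. i \<in> set is \<Longrightarrow> i \<le> n) \<Longrightarrow> p < n \<Longrightarrow> length l = sum_list is \<Longrightarrow>
    act (EM p p) (flag is unit) l = of_nat (length (filter (\<lambda>i. p < i) is)) * flag is unit l"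
proof (induction "is" arbitrary: l)
  case (Cons i "is")
  have "act (EM p p) (wedge i unit) m = (if p < i then wedge i unit m else 0)" for m
    using Cons.prems by (simp add: act_EM_wedge)
  then show ?case using Cons by (simp add: act_tens) (auto simp: tens_def algebra_simps)
qed simp

text \<open>The degrees of the exterior powers whose product has highest weight with coordinates \<Lambda>: the degree k + 1 occurs
  \<Lambda> k times.\<close>

definition shape :: "(nat \<Rightarrow> nat) \<Rightarrow> nat list" where
  "shape \<Lambda> = concat (map (\<lambda>k. replicate (\<Lambda> k) (Suc k)) [0..<n - 1])"

lemma set_shape: "i \<in> set (shape \<Lambda>) \<Longrightarrow> 1 \<le> i \<and> i < n"
  by (auto simp: shape_def)

lemma shape_count: "p < n \<Longrightarrow> length (filter (\<lambda>i. p < i) (shape \<Lambda>)) = (\<Sum>k\<in>{p..<n - 1}. \<Lambda> k)"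
proof -
  assume p: "p < n"
  have "length (filter (\<lambda>i. p < i) (concat (map (\<lambda>k. replicate (\<Lambda> k) (Suc k)) [0..<m])))
     = (\<Sum>k<m. if p \<le> k then \<Lambda> k else 0)" for m
    by (induction m) (auto simp: less_Suc_eq_le)
  also have "(\<Sum>k<n - 1. if p \<le> k then \<Lambda> k else 0) = (\<Sum>k\<in>{k\<in>{..<n - 1}. p \<le> k}. \<Lambda> k)"
    by (rule sum.inter_filter[symmetric]) simp
  also have "{k\<in>{..<n - 1}. p \<le> k} = {p..<n - 1}" by auto
  finally show ?thesis by (simp add: shape_def)
qed

lemma act_expand: "set l \<subseteq> {..<n} \<Longrightarrow> act X \<tau> l = (\<Sum>p<n. \<Sum>q<n. X p q * act (EM p q) \<tau> l)"
proof -
  assume l: "set l \<subseteq> {..<n}"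
  have "X a b = (\<Sum>p<n. \<Sum>q<n. X p q * EM p q a b)" if "a < n" "b < n" for a b
  proof -
    have "(\<Sum>p<n. \<Sum>q<n. X p q * EM p q a b) = (\<Sum>p<n. \<Sum>q<n. if q = b then (if p = a then X a b else 0) else 0)"
      by (intro sum.cong refl) (auto simp: EM_def)
    then show ?thesis using that by simp
  qed
  then have "act X \<tau> l = act (\<lambda>a b. \<Sum>p<n. \<Sum>q<n. X p q * EM p q a b) \<tau> l"
    using l by (rule act_mat_cong)
  then show ?thesis by (simp only: act_mat_sum act_mat_scale)
qed

end

section \<open>Modules over gl and their highest weight vectors\<close>

text \<open>An irreducible module of traceless matrices, with the action extended to all matrices indexed by natural numbers
  below n.  The extension makes the matrix units available as operators.  Irreducibility refers to traceless matrices
  only, as the extension is arbitrary.\<close>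

locale gl_module = finite_dimensional_vector_space scale Bs + tensor_rank n
  for scale :: "complex \<Rightarrow> 'v::ab_group_add \<Rightarrow> 'v" and Bs and n :: nat +
  fixes opr :: "mat \<Rightarrow> 'v \<Rightarrow> 'v"
  assumes opr_linear: "Vector_Spaces.linear scale scale (opr X)"
    and opr_add: "opr (\<lambda>p q. X p q + Y p q) v = opr X v + opr Y v"
    and opr_scale: "opr (\<lambda>p q. c * X p q) v = scale c (opr X v)"
    and opr_commute: "opr X (opr Y v) = opr Y (opr X v) + opr (\<lambda>p q. mm X Y p q - mm Y X p q) v"
    and opr_cong: "(\<And>p q. p < n \<Longrightarrow> q < n \<Longrightarrow> X p q = Y p q) \<Longrightarrow> opr X v = opr Y v"
    and irreducible: "subspace U \<Longrightarrow> (\<And>X. (\<Sum>p<n. X p p) = 0 \<Longrightarrow> opr X ` U \<subseteq> U) \<Longrightarrow> U = {0} \<or> U = UNIV"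
    and nontrivial: "\<exists>v::'v. v \<noteq> 0"
    and n3: "n \<ge> 3"
begin

sublocale opr: Vector_Spaces.linear scale scale "opr X" for X by (rule opr_linear)

text \<open>The matrices of the previous sections act on coefficients, so transposes appear here.\<close>

abbreviation "pe \<equiv> opr (\<lambda>p q. raise q p)"
abbreviation "pf \<equiv> opr (\<lambda>p q. lower q p)"
abbreviation "ph \<equiv> opr (\<lambda>p q. - grade q p)"

lemma sl2_triple:
  assumes "\<And>p q. p < n \<Longrightarrow> q < n \<Longrightarrow> mm X Y p q - mm Y X p q = H p q"
    and "\<And>p q. p < n \<Longrightarrow> q < n \<Longrightarrow> mm H X p q - mm X H p q = 2 * X p q"
    and "\<And>p q. p < n \<Longrightarrow> q < n \<Longrightarrow> mm H Y p q - mm Y H p q = - 2 * Y p q"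
  shows "sl2_module scale Bs (opr X) (opr Y) (opr H)"
proof (intro sl2_module.intro sl2_module_axioms.intro finite_dimensional_vector_space_axioms opr_linear)
  fix v
  have "opr (\<lambda>p q. mm X Y p q - mm Y X p q) v = opr H v" using assms(1) by (rule opr_cong)
  then show "opr X (opr Y v) - opr Y (opr X v) = opr H v" using opr_commute[of X Y v] by simp
  have "opr (\<lambda>p q. mm H X p q - mm X H p q) v = opr (\<lambda>p q. 2 * X p q) v" using assms(2) by (rule opr_cong)
  then show "opr H (opr X v) - opr X (opr H v) = scale 2 (opr X v)" using opr_commute[of H X v] by (simp add: opr_scale)
  have "opr (\<lambda>p q. mm H Y p q - mm Y H p q) v = opr (\<lambda>p q. (- 2) * Y p q) v" using assms(3) by (intro opr_cong) auto
  then have "opr (\<lambda>p q. mm H Y p q - mm Y H p q) v = scale (- 2) (opr Y v)" by (simp only: opr_scale)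
  then show "opr H (opr Y v) - opr Y (opr H v) = - scale 2 (opr Y v)" using opr_commute[of H Y v] by simp
qed

lemma principal_triple: "sl2_module scale Bs pe pf ph"
proof (rule sl2_triple)
  fix p q assume pq: "p < n" "q < n"
  have t: "mm (\<lambda>p q. raise q p) (\<lambda>p q. lower q p) p q = mm lower raise q p"
    "mm (\<lambda>p q. lower q p) (\<lambda>p q. raise q p) p q = mm raise lower q p" by (rule mm_transpose)+
  have "mm lower raise q p - mm raise lower q p = - (mm raise lower q p - mm lower raise q p)" by (rule minus_diff_eq[symmetric])
  also have "\<dots> = - grade q p" using commutators(1)[OF pq(2,1)] by (rule arg_cong)
  finally show "mm (\<lambda>p q. raise q p) (\<lambda>p q. lower q p) p q - mm (\<lambda>p q. lower q p) (\<lambda>p q. raise q p) p q = - grade q p"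
    unfolding t .
  show "mm (\<lambda>p q. - grade q p) (\<lambda>p q. raise q p) p q - mm (\<lambda>p q. raise q p) (\<lambda>p q. - grade q p) p q = 2 * raise q p"
    unfolding grade_sym mm_uminus using pq by (simp add: mm_grade_left mm_grade_right) (auto simp: grade_def raise_def)
  show "mm (\<lambda>p q. - grade q p) (\<lambda>p q. lower q p) p q - mm (\<lambda>p q. lower q p) (\<lambda>p q. - grade q p) p q = - 2 * lower q p"
    unfolding grade_sym mm_uminus using pq by (simp add: mm_grade_left mm_grade_right)
      (cases "p = Suc q"; simp add: grade_def lower_def[of q p] algebra_simps del: of_nat_mult mult_Suc)
qed

sublocale pr: sl2_module scale Bs pe pf ph by (rule principal_triple)

lemma simple_triple:
  assumes "Suc k < n"
  shows "sl2_module scale Bs (opr (EM k (Suc k))) (opr (EM (Suc k) k)) (opr (\<lambda>p q. EM k k p q - EM (Suc k) (Suc k) p q))"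
proof (rule sl2_triple)
  have d: "mm (\<lambda>p q. X p q - Y p q) Z p q = mm X Z p q - mm Y Z p q"
     "mm Z (\<lambda>p q. X p q - Y p q) p q = mm Z X p q - mm Z Y p q" for X Y Z p q
    by (simp_all add: mm_def left_diff_distrib right_diff_distrib sum_subtractf)
  fix p q
  show "mm (EM k (Suc k)) (EM (Suc k) k) p q - mm (EM (Suc k) k) (EM k (Suc k)) p q = EM k k p q - EM (Suc k) (Suc k) p q"
    using assms by (simp add: mm_EM)
  show "mm (\<lambda>p q. EM k k p q - EM (Suc k) (Suc k) p q) (EM k (Suc k)) p q
     - mm (EM k (Suc k)) (\<lambda>p q. EM k k p q - EM (Suc k) (Suc k) p q) p q = 2 * EM k (Suc k) p q"
    using assms by (simp add: d mm_EM)
  show "mm (\<lambda>p q. EM k k p q - EM (Suc k) (Suc k) p q) (EM (Suc k) k) p q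
     - mm (EM (Suc k) k) (\<lambda>p q. EM k k p q - EM (Suc k) (Suc k) p q) p q = - 2 * EM (Suc k) k p q"
    using assms by (simp add: d mm_EM)
qed

lemma ph_EM:
  assumes "p < n" "q < n"
  shows "ph (opr (EM p q) v) = opr (EM p q) (ph v) + scale (of_int (2 * (int q - int p))) (opr (EM p q) v)"
proof -
  have "opr (\<lambda>a b. mm (\<lambda>p q. - grade q p) (EM p q) a b - mm (EM p q) (\<lambda>p q. - grade q p) a b) v
     = opr (\<lambda>a b. of_int (2 * (int q - int p)) * EM p q a b) v"
    unfolding grade_sym mm_uminus
  proof (rule opr_cong)
    fix a b assume "a < n" "b < n"
    then show "- mm grade (EM p q) a b - - mm (EM p q) grade a b = of_int (2 * (int q - int p)) * EM p q a b"
      by (simp add: mm_grade_left mm_grade_right) (auto simp: EM_def grade_def)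
  qed
  then show ?thesis by (simp only: opr_scale opr_commute[of "\<lambda>p q. - grade q p" "EM p q" v])
qed

lemma diagonal_commute:
  assumes "\<And>p q. p \<noteq> q \<Longrightarrow> X p q = 0" "\<And>p q. p \<noteq> q \<Longrightarrow> Y p q = 0"
  shows "opr X (opr Y v) = opr Y (opr X v)"
proof -
  have "mm X Y p q - mm Y X p q = 0 * X p q" if "p < n" "q < n" for p q
  proof -
    have "mm X Y p q = (\<Sum>r\<in>{p}. X p r * Y r q)" "mm Y X p q = (\<Sum>r\<in>{p}. Y p r * X r q)"
      unfolding mm_def using that assms by (intro sum.mono_neutral_right; auto)+
    then show ?thesis using assms by (cases "p = q") auto
  qed
  then have "opr (\<lambda>p q. mm X Y p q - mm Y X p q) v = opr (\<lambda>p q. 0 * X p q) v" by (rule opr_cong)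
  then show ?thesis using opr_commute[of X Y v] by (simp only: opr_scale scale_zero_left add_0_right)
qed

text \<open>The largest eigenvalue d of the principal h plays the role of the highest weight: positive matrix units
  raise it, so they kill its eigenspace.  On this eigenspace the simple coroots commute, and \<open>falling_h_decompose\<close>,
  applied to one simple triple after the other, yields a common eigenvector with eigenvalues in the natural numbers.\<close>

lemma highest_weight_vector:
  "\<exists>(v::'v) d \<Lambda>. v \<noteq> 0 \<and> ph v = scale (of_int d) v \<and> (\<forall>x k. ph x = scale (of_int k) x \<longrightarrow> x \<noteq> 0 \<longrightarrow> k \<le> d)
     \<and> (\<forall>p q. p < q \<longrightarrow> q < n \<longrightarrow> opr (EM p q) v = 0)
     \<and> (\<forall>k. Suc k < n \<longrightarrow> opr (\<lambda>p q. EM k k p q - EM (Suc k) (Suc k) p q) v = scale (of_nat (\<Lambda> k :: nat)) v)"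
proof -
  obtain D where D: "\<And>v. \<exists>w. v = (\<Sum>k\<in>{-D..D}. w k) \<and> (\<forall>k. ph (w k) = scale (of_int k) (w k))"
    using pr.h_grading by blast
  define W where "W = {k. \<exists>x. x \<noteq> 0 \<and> ph x = scale (of_int k) x}"
  \<comment> \<open>finiteness of the set of integer eigenvalues, so that there is a largest one\<close>
  have "W \<subseteq> {-D..D}"
  proof
    fix k assume "k \<in> W"
    then obtain x where x: "x \<noteq> 0" "ph x = scale (of_int k) x" by (auto simp: W_def)
    obtain w where w: "x = (\<Sum>k\<in>{-D..D}. w k)" "\<And>k. ph (w k) = scale (of_int k) (w k)" using D by blast
    show "k \<in> {-D..D}"
    proof (rule ccontr)
      assume k: "k \<notin> {-D..D}"
      define w' where "w' = (\<lambda>j. if j = k then - x else w j)"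
      have "(\<Sum>j\<in>{-D..D}. w' j) = x" unfolding w(1) using k by (intro sum.cong) (auto simp: w'_def)
      then have s: "(\<Sum>j\<in>insert k {-D..D}. w' j) = 0"
        using k by (simp add: w'_def)
      have "ph (w' j) = scale (of_int j) (w' j)" for j
        using w(2) x(2) by (simp add: w'_def opr.neg scale_minus_right)
      moreover have "inj_on (of_int :: int \<Rightarrow> complex) (insert k {-D..D})" by (rule inj_onI) simp
      ultimately have "\<forall>j\<in>insert k {-D..D}. w' j = 0"
        by (intro eigenvector_sum_zero[OF pr.lin_h _ _ _ s, where \<mu> = of_int]) simp_all
      then show False using x(1) by (simp add: w'_def)
    qed
  qed
  then have finW: "finite W" using finite_subset by blast
  have "W \<noteq> {}"
  proof -
    obtain v :: 'v where "v \<noteq> 0" using nontrivial by blast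
    moreover obtain w where "v = (\<Sum>k\<in>{-D..D}. w k)" "\<And>k. ph (w k) = scale (of_int k) (w k)" using D by blast
    ultimately obtain k where "w k \<noteq> 0" "ph (w k) = scale (of_int k) (w k)" by (metis sum.neutral)
    then show ?thesis by (auto simp: W_def)
  qed
  define d where "d = Max W"
  have d: "d \<in> W" "\<And>k. k \<in> W \<Longrightarrow> k \<le> d" using finW \<open>W \<noteq> {}\<close> by (auto simp: d_def)
  have up: "opr (EM p q) v = 0" if "p < q" "q < n" "ph v = scale (of_int d) v" for p q v
  proof (rule ccontr)
    assume nz: "opr (EM p q) v \<noteq> 0"
    have "ph (opr (EM p q) v) = scale (of_int (d + 2 * (int q - int p))) (opr (EM p q) v)"
      using ph_EM[of p q v] that by (simp add: opr.scale scale_left_distrib)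
    then have "d + 2 * (int q - int p) \<in> W" using nz by (auto simp: W_def)
    then show False using d(2) that(1) by fastforce
  qed
  let ?H = "\<lambda>k. opr (\<lambda>p q. EM k k p q - EM (Suc k) (Suc k) p q)"
  have Hc: "?H j (?H k v) = ?H k (?H j v)" "ph (?H k v) = ?H k (ph v)" for j k v
    by (rule diagonal_commute; simp add: EM_def grade_def)+
  have ex: "\<exists>\<Lambda> v. v \<noteq> 0 \<and> ph v = scale (of_int d) v \<and> (\<forall>k<K. ?H k v = scale (of_nat (\<Lambda> k :: nat)) v)" if "K < n" for K
    using that
  proof (induction K)
    case 0
    then show ?case using d(1) by (auto simp: W_def)
  next
    case (Suc K)
    then obtain \<Lambda> v where v: "v \<noteq> 0" "ph v = scale (of_int d) v" "\<forall>k<K. ?H k v = scale (of_nat (\<Lambda> k :: nat)) v" by auto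
    interpret s: sl2_module scale Bs "opr (EM K (Suc K))" "opr (EM (Suc K) K)" "?H K"
      by (rule simple_triple) (use Suc.prems in simp)
    let ?U = "{v. ph v = scale (of_int d) v \<and> (\<forall>k<K. ?H k v = scale (of_nat (\<Lambda> k)) v)}"
    have sub: "subspace ?U"
      by (auto simp: subspace_def opr.add opr.scale opr.zero scale_right_distrib mult.commute)
    have "?H K ` ?U \<subseteq> ?U"
    proof safe
      fix x assume x: "ph x = scale (of_int d) x" "\<forall>k<K. ?H k x = scale (of_nat (\<Lambda> k)) x"
      show "ph (?H K x) = scale (of_int d) (?H K x)" unfolding Hc(2) x(1) by (rule opr.scale)
      fix k assume "k < K"
      then show "?H k (?H K x) = scale (of_nat (\<Lambda> k)) (?H K x)" unfolding Hc(1)[of k K] using x(2) by (simp add: opr.scale)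
    qed
    moreover obtain M where "(opr (EM (Suc K) K) ^^ M) v = 0" using s.f_nilpotent by blast
    moreover have "opr (EM (Suc K) K) (opr (EM K (Suc K)) v) = 0"
      using up[of K "Suc K" v] v(2) Suc.prems by (simp add: opr.zero)
    ultimately obtain w where w: "v = (\<Sum>j<M. w j)" "\<And>j. ?H K (w j) = scale (of_nat j) (w j)" "\<And>j. w j \<in> ?U"
      using s.falling_h_decompose[of M v ?U] s.falling_h_fe_kernel[of v M] sub v by blast
    obtain j where j: "w j \<noteq> 0" using v(1) w(1) by (metis sum.neutral)
    have "\<forall>k<Suc K. ?H k (w j) = scale (of_nat ((\<Lambda>(K := j)) k)) (w j)"
      using w(2,3) by (auto simp: less_Suc_eq)
    then show ?case using j w(3)[of j] by blast
  qed
  obtain \<Lambda> v where "v \<noteq> 0" "ph v = scale (of_int d) v" "\<forall>k<n - 1. ?H k v = scale (of_nat (\<Lambda> k :: nat)) v"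
    using ex[of "n - 1"] n3 by auto
  moreover have "k \<le> d" if "ph x = scale (of_int k) x" "x \<noteq> 0" for x k using d(2) that by (auto simp: W_def)
  ultimately show ?thesis using up by (intro exI[of _ v] exI[of _ d] exI[of _ \<Lambda>]) auto
qed


lemma opr_expand: "opr X v = (\<Sum>p<n. \<Sum>q<n. scale (X p q) (opr (EM p q) v))"
proof -
  have sum_opr: "opr (\<lambda>p q. \<Sum>j\<in>J. Y j p q) v = (\<Sum>j\<in>J. opr (Y j) v)" if "finite J" for J :: "nat set" and Y
    using that
  proof (induction J rule: finite_induct)
    case empty
    show ?case using opr_scale[of 0 X v] by simp
  qed (simp add: opr_add)
  have "X a b = (\<Sum>p<n. \<Sum>q<n. X p q * EM p q a b)" if "a < n" "b < n" for a b
  proof -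
    have "(\<Sum>p<n. \<Sum>q<n. X p q * EM p q a b) = (\<Sum>p<n. \<Sum>q<n. if q = b then (if p = a then X a b else 0) else 0)"
      by (intro sum.cong refl) (auto simp: EM_def)
    then show ?thesis using that by simp
  qed
  then have "opr X v = opr (\<lambda>a b. \<Sum>p<n. \<Sum>q<n. X p q * EM p q a b) v" by (rule opr_cong)
  then show ?thesis by (simp add: sum_opr opr_scale)
qed

end

section \<open>Transfer of functionals\<close>

locale highest_weight_module = gl_module +
  fixes v0 d \<Lambda>
  assumes v0: "v0 \<noteq> 0" "ph v0 = scale (of_int d) v0"
    and raising: "p < q \<Longrightarrow> q < n \<Longrightarrow> opr (EM p q) v0 = 0"
    and coroot: "Suc k < n \<Longrightarrow> opr (\<lambda>p q. EM k k p q - EM (Suc k) (Suc k) p q) v0 = scale (of_nat (\<Lambda> k)) v0"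
begin

definition "N = sum_list (shape \<Lambda>)"
definition "z0 = flag (shape \<Lambda>) unit"
definition "wt p = (\<Sum>k\<in>{p..<n - 1}. \<Lambda> k)"

text \<open>The submodule of pairs generated by (v0, z0).  Closure under the strictly lower matrix units is enough for
  closure under all traceless matrices (\<open>rel_act\<close>) and makes inductions short.  The last rule discards
  the values of tensors outside words of length N.\<close>

inductive rel :: "'a \<Rightarrow> tensor \<Rightarrow> bool" where
  base: "rel v0 z0"
| add: "rel u \<sigma> \<Longrightarrow> rel v \<tau> \<Longrightarrow> rel (u + v) (\<lambda>l. \<sigma> l + \<tau> l)"
| scale: "rel v \<tau> \<Longrightarrow> rel (scale c v) (\<lambda>l. c * \<tau> l)"
| lower: "rel v \<tau> \<Longrightarrow> q < p \<Longrightarrow> p < n \<Longrightarrow> rel (opr (EM p q) v) (act (EM p q) \<tau>)"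
| agree: "rel v \<tau> \<Longrightarrow> (\<forall>l\<in>words N. \<sigma> l = \<tau> l) \<Longrightarrow> rel v \<sigma>"

lemma rel_zero: "rel 0 (\<lambda>l. 0)"
  using rel.scale[OF rel.base, of 0] by simp

lemma rel_sum: "finite J \<Longrightarrow> (\<And>j. j \<in> J \<Longrightarrow> rel (v j) (\<tau> j)) \<Longrightarrow> rel (\<Sum>j\<in>J. v j) (\<lambda>l. \<Sum>j\<in>J. \<tau> j l)"
proof (induction J rule: finite_induct)
  case empty
  show ?case by (simp add: rel_zero)
next
  case (insert j J)
  then show ?case using rel.add[of "v j" "\<tau> j" "\<Sum>j\<in>J. v j" "\<lambda>l. \<Sum>j\<in>J. \<tau> j l"] by simp
qed

lemma rel_diff: "rel u \<sigma> \<Longrightarrow> rel v \<tau> \<Longrightarrow> rel (u - v) (\<lambda>l. \<sigma> l - \<tau> l)"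
  using rel.add[of u \<sigma> "scale (-1) v" "\<lambda>l. (-1) * \<tau> l"] rel.scale[of v \<tau> "-1"] by simp

text \<open>Differences of diagonal matrix units act on v0 by sums of the \<Lambda> k.  The last diagonal unit itself is unknown, and it
  cancels for traceless matrices.\<close>

lemma diagonal_weight:
  "p < n \<Longrightarrow> opr (EM p p) v0 = opr (EM (n - 1) (n - 1)) v0 + scale (of_nat (wt p)) v0"
proof (induction "n - 1 - p" arbitrary: p)
  case 0
  then have "p = n - 1" by simp
  then show ?case by (simp add: wt_def)
next
  case (Suc m)
  then have p: "Suc p < n" by simp
  have "opr (\<lambda>a b. EM p p a b + (-1) * EM (Suc p) (Suc p) a b) v0 = scale (of_nat (\<Lambda> p)) v0"
    using coroot[OF p] by simp
  then have "opr (EM p p) v0 = opr (EM (Suc p) (Suc p)) v0 + scale (of_nat (\<Lambda> p)) v0"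
    unfolding opr_add opr_scale by (simp add: diff_eq_eq add.commute)
  moreover have "wt p = \<Lambda> p + wt (Suc p)" unfolding wt_def using p by (intro sum.atLeast_Suc_lessThan) simp
  moreover have "opr (EM (Suc p) (Suc p)) v0 = opr (EM (n - 1) (n - 1)) v0 + scale (of_nat (wt (Suc p))) v0"
    using Suc.hyps p by auto
  ultimately show ?case by (simp add: scale_left_distrib algebra_simps)
qed

text \<open>A traceless matrix acts on v0 and on z0 by the same scalar plus the strictly lower part.\<close>

lemma rel_base_traceless:
  assumes X: "(\<Sum>p<n. X p p) = 0"
  shows "rel (opr X v0) (act X z0)"
proof -
  define \<kappa> where "\<kappa> = (\<Sum>p<n. X p p * of_nat (wt p))"
  have dw: "scale (X p p) (opr (EM p p) v0)
      = scale (X p p) (opr (EM (n - 1) (n - 1)) v0) + scale (X p p * of_nat (wt p)) v0" if "p < n" for p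
    unfolding diagonal_weight[OF that] by (simp add: scale_right_distrib)
  have v: "opr X v0 = scale \<kappa> v0 + (\<Sum>p<n. \<Sum>q<p. scale (X p q) (opr (EM p q) v0))"
  proof -
    have "(\<Sum>q<n. scale (X p q) (opr (EM p q) v0))
       = scale (X p p) (opr (EM p p) v0) + (\<Sum>q<p. scale (X p q) (opr (EM p q) v0))" if "p < n" for p
    proof -
      have "(\<Sum>q<n. scale (X p q) (opr (EM p q) v0)) = (\<Sum>q\<in>insert p {..<p}. scale (X p q) (opr (EM p q) v0))"
        using that raising by (intro sum.mono_neutral_right) (auto simp: not_less)
      then show ?thesis by simp
    qed
    then have "opr X v0 = (\<Sum>p<n. scale (X p p) (opr (EM p p) v0)) + (\<Sum>p<n. \<Sum>q<p. scale (X p q) (opr (EM p q) v0))"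
      by (subst opr_expand) (simp add: sum.distrib)
    also have "(\<Sum>p<n. scale (X p p) (opr (EM p p) v0))
       = (\<Sum>p<n. scale (X p p) (opr (EM (n - 1) (n - 1)) v0) + scale (X p p * of_nat (wt p)) v0)"
      by (intro sum.cong refl dw) simp
    also have "\<dots> = scale (\<Sum>p<n. X p p) (opr (EM (n - 1) (n - 1)) v0) + scale \<kappa> v0"
      by (simp add: sum.distrib scale_sum_left \<kappa>_def)
    finally show ?thesis by (simp add: X)
  qed
  have z: "act X z0 l = \<kappa> * z0 l + (\<Sum>p<n. \<Sum>q<p. X p q * act (EM p q) z0 l)" if l: "l \<in> words N" for l
  proof -
    have le: "i \<le> n" if "i \<in> set (shape \<Lambda>)" for i using set_shape[OF that] by simp
    have ll: "length l = sum_list (shape \<Lambda>)" "set l \<subseteq> {..<n}" using l by (auto simp: words_def N_def)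
    have up: "act (EM p q) z0 l = 0" if "p < q" "q < n" for p q
      unfolding z0_def by (rule act_raising_flag[OF le that ll(1)])
    have dg: "act (EM p p) z0 l = of_nat (wt p) * z0 l" if "p < n" for p
      using act_diagonal_flag[OF le that ll(1)] by (simp only: z0_def wt_def shape_count[OF that])
    have "(\<Sum>q<n. X p q * act (EM p q) z0 l)
       = X p p * of_nat (wt p) * z0 l + (\<Sum>q<p. X p q * act (EM p q) z0 l)" if "p < n" for p
    proof -
      have "(\<Sum>q<n. X p q * act (EM p q) z0 l) = (\<Sum>q\<in>insert p {..<p}. X p q * act (EM p q) z0 l)"
        using that up by (intro sum.mono_neutral_right) (auto simp: not_less)
      then show ?thesis using dg[OF that] by simp
    qed
    then show ?thesis unfolding act_expand[OF ll(2), of X z0] by (simp add: sum.distrib \<kappa>_def sum_distrib_right)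
  qed
  have row: "rel (\<Sum>q<p. scale (X p q) (opr (EM p q) v0)) (\<lambda>l. \<Sum>q<p. X p q * act (EM p q) z0 l)" if "p < n" for p
  proof (rule rel_sum[where v = "\<lambda>q. scale (X p q) (opr (EM p q) v0)" and \<tau> = "\<lambda>q l. X p q * act (EM p q) z0 l"])
    fix q assume "q \<in> {..<p}"
    then have "rel (opr (EM p q) v0) (act (EM p q) z0)" using that rel.lower[OF rel.base] by simp
    then show "rel (scale (X p q) (opr (EM p q) v0)) (\<lambda>l. X p q * act (EM p q) z0 l)" by (rule rel.scale)
  qed simp
  have "rel (\<Sum>p<n. \<Sum>q<p. scale (X p q) (opr (EM p q) v0)) (\<lambda>l. \<Sum>p<n. \<Sum>q<p. X p q * act (EM p q) z0 l)"
    by (rule rel_sum[where v = "\<lambda>p. \<Sum>q<p. scale (X p q) (opr (EM p q) v0)" and \<tau> = "\<lambda>p l. \<Sum>q<p. X p q * act (EM p q) z0 l"])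
      (use row in auto)
  from rel.add[OF rel.scale[OF rel.base, of \<kappa>] this] have "rel (opr X v0) (\<lambda>l. \<kappa> * z0 l + (\<Sum>p<n. \<Sum>q<p. X p q * act (EM p q) z0 l))"
    unfolding v .
  then show ?thesis by (rule rel.agree[rule_format]) (rule z)
qed

text \<open>A strictly lower matrix unit E is moved past X at the cost of the commutator, which is again traceless and acts on
  a pair that was built before.\<close>

lemma rel_act:
  assumes "rel v \<tau>" "(\<Sum>p<n. X p p) = 0"
  shows "rel (opr X v) (act X \<tau>)"
  using assms
proof (induction arbitrary: X rule: rel.induct)
  case base
  then show ?case by (rule rel_base_traceless)
next
  case (add u \<sigma> v \<tau>)
  show ?case using rel.add[OF add.IH(1,2)[of X]] add.prems by (simp add: opr.add act_add[abs_def])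
next
  case (scale v \<tau> c)
  show ?case using rel.scale[OF scale.IH[of X], of c] scale.prems by (simp add: opr.scale act_scale[abs_def])
next
  case (lower v \<tau> q p)
  show ?case using rel.add[OF rel.lower[OF lower.IH[of X, OF lower.prems] lower.hyps(2,3)] lower.IH[of "\<lambda>a b. mm X (EM p q) a b - mm (EM p q) X a b", OF mm_trace]]
    by (simp only: opr_commute[of X "EM p q"] act_commute[of X "EM p q", abs_def])
next
  case (agree v \<tau> \<sigma>)
  show ?case by (rule rel.agree[OF agree.IH[of X, OF agree.prems]]) (use agree.hyps(2) in \<open>auto intro: act_cong_words\<close>)
qed

lemma rel_total: "\<exists>\<tau>. rel v \<tau>"
proof -
  let ?U = "{v. \<exists>\<tau>. rel v \<tau>}"
  have "subspace ?U" unfolding subspace_def using rel_zero rel.add rel.scale by blast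
  moreover have "opr X ` ?U \<subseteq> ?U" if "(\<Sum>p<n. X p p) = 0" for X
    using rel_act that by blast
  ultimately have "?U = {0} \<or> ?U = UNIV" by (rule irreducible)
  moreover have "v0 \<in> ?U" using rel.base by blast
  ultimately show ?thesis using v0(1) by blast
qed

text \<open>The part of V below the top eigenvalue d of the principal h.\<close>

definition below :: "'a set" where
  "below = span {x. \<exists>k<d. ph x = scale (of_int k) x}"

lemma v0_not_below: "v0 \<notin> below"
proof
  assume "v0 \<in> below"
  have "\<exists>K w. finite K \<and> K \<subseteq> {..<d} \<and> v = (\<Sum>k\<in>K. w k) \<and> (\<forall>k. ph (w k) = scale (of_int k) (w k)) \<and> (\<forall>k. k \<notin> K \<longrightarrow> w k = 0)"
    if "v \<in> below" for v
    using that unfolding below_def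
  proof (induction rule: span_induct_alt)
    case base
    show ?case by (rule exI[of _ "{}"], rule exI[of _ "\<lambda>_. 0"]) (simp add: opr.zero)
  next
    case (step c x y)
    then obtain j where j: "j < d" "ph x = scale (of_int j) x" by blast
    obtain K w where w: "finite K" "K \<subseteq> {..<d}" "y = (\<Sum>k\<in>K. w k)" "\<And>k. ph (w k) = scale (of_int k) (w k)"
       "\<And>k. k \<notin> K \<Longrightarrow> w k = 0" using step(2) by blast
    define w' where "w' = (\<lambda>k. w k + (if k = j then scale c x else 0))"
    have "y = (\<Sum>k\<in>insert j K. w k)" unfolding w(3) using w(1,5) by (intro sum.mono_neutral_left) auto
    then have "scale c x + y = (\<Sum>k\<in>insert j K. w' k)"
      using w(1) by (simp add: w'_def sum.distrib add.commute del: sum.insert)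
    moreover have "ph (w' k) = scale (of_int k) (w' k)" for k
      by (simp add: w'_def opr.add w(4) opr.scale j(2) scale_right_distrib opr.zero mult.commute)
    moreover have "w' k = 0" if "k \<notin> insert j K" for k using that w(5) by (simp add: w'_def)
    ultimately show ?case using w(1,2) j(1) by (intro exI[of _ "insert j K"] exI[of _ w']) auto
  qed
  from this[OF \<open>v0 \<in> below\<close>] obtain K w where w: "finite K" "K \<subseteq> {..<d}" "v0 = (\<Sum>k\<in>K. w k)"
     "\<And>k. ph (w k) = scale (of_int k) (w k)" by blast
  define w' where "w' = (\<lambda>k. if k = d then - v0 else w k)"
  have d: "d \<notin> K" using w(2) by auto
  have "(\<Sum>k\<in>K. w' k) = v0" unfolding w(3) using d by (intro sum.cong) (auto simp: w'_def)
  then have s: "(\<Sum>k\<in>insert d K. w' k) = 0" using d w(1) by (simp add: w'_def)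
  have "ph (w' j) = scale (of_int j) (w' j)" for j
    using w(4) v0(2) by (simp add: w'_def opr.neg scale_minus_right)
  moreover have "inj_on (of_int :: int \<Rightarrow> complex) (insert d K)" by (rule inj_onI) simp
  ultimately have "\<forall>j\<in>insert d K. w' j = 0"
    using w(1) by (intro eigenvector_sum_zero[OF pr.lin_h _ _ _ s, where \<mu> = of_int]) simp_all
  then show False using v0(1) by (simp add: w'_def)
qed

lemma below_lower:
  assumes "q < p" "p < n" "v \<in> below"
  shows "opr (EM p q) v \<in> below"
  using assms(3) unfolding below_def
proof (induction rule: span_induct_alt)
  case base
  show ?case by (simp add: opr.zero span_zero)
next
  case (step c x y)
  then obtain k where k: "k < d" "ph x = scale (of_int k) x" by blast
  have "ph (opr (EM p q) x) = scale (of_int (k + 2 * (int q - int p))) (opr (EM p q) x)"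
    using ph_EM[of p q x] assms k(2) by (simp add: opr.scale scale_left_distrib)
  moreover have "k + 2 * (int q - int p) < d" using assms(1) k(1) by simp
  ultimately have "opr (EM p q) x \<in> span {x. \<exists>k<d. ph x = scale (of_int k) x}" by (intro span_base) blast
  then show ?case using step(2) by (simp add: opr.add opr.scale span_add span_scale)
qed

text \<open>The pairing with z0 reads off the coefficient of v0, because the lower matrix units lower the eigenvalue of the principal h,
  and their adjoints kill z0.\<close>

lemma rel_top_component:
  assumes "rel v \<tau>"
  shows "\<exists>c v'. v = scale c v0 + v' \<and> v' \<in> below \<and> pairing N z0 \<tau> = c * pairing N z0 z0"
  using assms
proof (induction rule: rel.induct)
  case base
  show ?case by (rule exI[of _ 1], rule exI[of _ 0]) (simp add: below_def span_zero)
next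
  case (add u \<sigma> v \<tau>)
  then obtain a u' b v' where "u = scale a v0 + u'" "u' \<in> below" "pairing N z0 \<sigma> = a * pairing N z0 z0"
    "v = scale b v0 + v'" "v' \<in> below" "pairing N z0 \<tau> = b * pairing N z0 z0" by blast
  then show ?case
    by (intro exI[of _ "a + b"] exI[of _ "u' + v'"])
      (auto simp: scale_left_distrib pairing_add_right below_def span_add algebra_simps)
next
  case (scale v \<tau> c)
  then obtain b v' where "v = scale b v0 + v'" "v' \<in> below" "pairing N z0 \<tau> = b * pairing N z0 z0" by blast
  then show ?case
    by (intro exI[of _ "c * b"] exI[of _ "scale c v'"])
      (auto simp: scale_right_distrib pairing_scale_right below_def span_scale)
next
  case (lower v \<tau> q p)
  then obtain b v' where b: "v = scale b v0 + v'" "v' \<in> below" by blast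
  have "ph (opr (EM p q) v0) = scale (of_int (d + 2 * (int q - int p))) (opr (EM p q) v0)"
    using ph_EM[of p q v0] lower.hyps v0(2) by (simp add: opr.scale scale_left_distrib)
  moreover have "d + 2 * (int q - int p) < d" using lower.hyps by simp
  ultimately have "opr (EM p q) v0 \<in> below" unfolding below_def by (intro span_base) blast
  moreover have "opr (EM p q) v' \<in> below" using lower.hyps b(2) by (intro below_lower) auto
  ultimately have "opr (EM p q) v \<in> below" unfolding b(1) by (simp add: opr.add opr.scale below_def span_add span_scale)
  moreover have "pairing N z0 (act (EM p q) \<tau>) = 0"
    unfolding pairing_raise unfolding pairing_def
  proof (intro sum.neutral ballI)
    fix l assume "l \<in> words N"
    then have l: "length l = sum_list (shape \<Lambda>)" by (simp add: words_def N_def)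
    have le: "i \<le> n" if "i \<in> set (shape \<Lambda>)" for i using set_shape[OF that] by simp
    have "act (EM q p) z0 l = 0" unfolding z0_def by (rule act_raising_flag[OF le lower.hyps(2,3) l])
    then show "act (EM q p) z0 l * \<tau> l = 0" by simp
  qed
  ultimately have "opr (EM p q) v = scale 0 v0 + opr (EM p q) v \<and> opr (EM p q) v \<in> below
      \<and> pairing N z0 (act (EM p q) \<tau>) = 0 * pairing N z0 z0" by simp
  then show ?case by blast
next
  case (agree v \<tau> \<sigma>)
  then show ?case using pairing_cong[of N z0 \<sigma> z0 \<tau>] by simp
qed

lemma rel_zero_top:
  assumes "rel 0 \<tau>"
  shows "pairing N z0 \<tau> = 0"
proof -
  obtain c v' where c: "0 = scale c v0 + v'" "v' \<in> below" "pairing N z0 \<tau> = c * pairing N z0 z0"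
    using rel_top_component[OF assms] by blast
  have "c = 0"
  proof (rule ccontr)
    assume "c \<noteq> 0"
    have "scale c v0 = - v'" using c(1) by (simp add: eq_neg_iff_add_eq_0)
    then have "scale (inverse c) (scale c v0) = scale (- inverse c) v'" by simp
    then have "v0 = scale (- inverse c) v'" using \<open>c \<noteq> 0\<close> by simp
    moreover have "scale (- inverse c) v' \<in> below" using c(2) unfolding below_def by (rule span_scale)
    ultimately show False using v0_not_below by simp
  qed
  then show ?thesis using c(3) by simp
qed

text \<open>The adjoint of a lower matrix unit for the Hermitian form is an upper one, and this preserves the pairs with first
  component 0.  So it suffices to compare with z0, where \<open>rel_zero_top\<close> applies.\<close>

lemma rel_zero_orthogonal:
  assumes "rel u \<sigma>" "rel 0 \<tau>"
  shows "pairing N (\<lambda>l. cnj (\<sigma> l)) \<tau> = 0"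
  using assms
proof (induction arbitrary: \<tau> rule: rel.induct)
  case base
  then show ?case using rel_zero_top by (simp add: z0_def flag_unit_real)
next
  case (add u \<sigma> v \<sigma>')
  then show ?case by (simp add: pairing_add_left)
next
  case (scale v \<sigma> c)
  then show ?case by (simp add: pairing_scale_left)
next
  case (lower v \<sigma> q p)
  have "(\<Sum>a<n. EM q p a a) = 0" using lower.hyps by (intro sum.neutral) (auto simp: EM_def)
  then have "rel 0 (act (EM q p) \<tau>)" using rel_act[OF lower.prems, of "EM q p"] by (simp add: opr.zero)
  moreover have "(\<lambda>a b. cnj (EM p q a b)) = EM p q" by (auto simp: EM_def fun_eq_iff)
  ultimately show ?case using lower.IH by (simp add: cnj_act flip: pairing_raise)
next
  case (agree v \<sigma> \<sigma>')
  then show ?case using pairing_cong[of N "\<lambda>l. cnj (\<sigma>' l)" \<tau> "\<lambda>l. cnj (\<sigma> l)" \<tau>] by simp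
qed

lemma rel_zero_trivial:
  assumes "rel 0 \<tau>" "l \<in> words N"
  shows "\<tau> l = 0"
proof -
  have "(\<Sum>l\<in>words N. cnj (\<tau> l) * \<tau> l) = 0"
    using rel_zero_orthogonal[OF assms(1) assms(1)] by (simp add: pairing_def)
  moreover have "cnj (\<tau> l) * \<tau> l = complex_of_real ((cmod (\<tau> l))\<^sup>2)" for l
    by (simp only: complex_norm_square mult.commute)
  ultimately have "complex_of_real (\<Sum>l\<in>words N. (cmod (\<tau> l))\<^sup>2) = 0"
    by (simp only: of_real_sum)
  then have "(\<Sum>l\<in>words N. (cmod (\<tau> l))\<^sup>2) = 0" unfolding of_real_eq_0_iff .
  then have "\<forall>l\<in>words N. (cmod (\<tau> l))\<^sup>2 = 0" by (subst (asm) sum_nonneg_eq_0_iff) auto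
  then show ?thesis using assms(2) by simp
qed

text \<open>A coefficient tensor whose function is zero annihilates z0, and by \<open>val_act_zero\<close> so do its images under the
  action.\<close>

lemma null_on_rel:
  assumes "rel v \<tau>" "\<And>A. val (shape \<Lambda>) c A = 0"
  shows "pairing N c \<tau> = 0"
  using assms
proof (induction arbitrary: c rule: rel.induct)
  case base
  then show ?case by (simp add: val_def N_def z0_def)
next
  case (add u \<sigma> v \<tau>)
  then show ?case by (simp add: pairing_add_right)
next
  case (scale v \<tau> a)
  then show ?case by (simp add: pairing_scale_right)
next
  case (lower v \<tau> q p)
  show ?case unfolding pairing_raise using lower.prems by (intro lower.IH val_act_zero)
next
  case (agree v \<tau> \<sigma>)
  then show ?case using pairing_cong[of N c \<sigma> c \<tau>] by simp
qed

text \<open>\<open>flag_in_closure\<close> needs closure under all matrices.  A matrix is a traceless one plus a multiple of the identity, and the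
  identity acts on tensors of degree N by N, hence the pairs stay pairs up to a change of the first component.\<close>

lemma rel_flag: "\<exists>v. rel v (flag (shape \<Lambda>) A)"
proof -
  let ?Z = "{\<tau>. \<exists>v. rel v \<tau>}"
  have Z: "act X \<tau> \<in> ?Z" if "\<tau> \<in> ?Z" for X \<tau>
  proof -
    obtain v where v: "rel v \<tau>" using \<open>\<tau> \<in> ?Z\<close> by blast
    define t where "t = (\<Sum>p<n. X p p) / of_nat n"
    define I :: mat where "I = (\<lambda>p q. if p = q then 1 else 0)"
    have "(\<Sum>p<n. X p p + (- t) * I p p) = 0" using n3 by (simp add: sum_subtractf t_def I_def)
    from rel_act[of v \<tau> "\<lambda>p q. X p q + (- t) * I p q", OF v this] have "rel (opr (\<lambda>p q. X p q + (- t) * I p q) v) (act (\<lambda>p q. X p q + (- t) * I p q) \<tau>)" .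
    then have "rel (opr (\<lambda>p q. X p q + (- t) * I p q) v + scale (t * of_nat N) v)
        (\<lambda>l. act (\<lambda>p q. X p q + (- t) * I p q) \<tau> l + t * of_nat N * \<tau> l)"
      by (intro rel.add rel.scale v)
    then have "rel (opr (\<lambda>p q. X p q + (- t) * I p q) v + scale (t * of_nat N) v) (act X \<tau>)"
      by (rule rel.agree) (unfold act_mat_add act_mat_scale, simp add: I_def act_identity)
    then show ?thesis by blast
  qed
  have "\<exists>\<tau>\<in>?Z. \<forall>l. length l = sum_list (shape \<Lambda>) \<longrightarrow> \<tau> l = flag (shape \<Lambda>) A l"
  proof (rule flag_in_closure[OF _ _ Z])
    show "flag (shape \<Lambda>) unit \<in> ?Z" using rel.base by (auto simp: z0_def)
    show "i \<le> n" if "i \<in> set (shape \<Lambda>)" for i using set_shape[OF that] by simp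
  qed (use rel.add rel.scale in blast)+
  then obtain v \<tau> where "rel v \<tau>" "\<forall>l. length l = sum_list (shape \<Lambda>) \<longrightarrow> \<tau> l = flag (shape \<Lambda>) A l" by blast
  then have "rel v (flag (shape \<Lambda>) A)"
    using rel.agree[of v \<tau> "flag (shape \<Lambda>) A"] by (simp add: words_def N_def)
  then show ?thesis by blast
qed

text \<open>The pairing with c depends on v only, not on the tensor related to it, by \<open>rel_zero_trivial\<close>.\<close>

lemma functional_from_highest:
  assumes c: "highest (shape \<Lambda>) w c"
  shows "\<exists>\<xi>. (\<forall>x y. \<xi> (x + y) = \<xi> x + \<xi> y) \<and> (\<forall>a x. \<xi> (scale a x) = a * (\<xi> x :: complex))
    \<and> (\<forall>v. \<xi> (pe v) = 0) \<and> (\<forall>v. \<xi> (ph v) = - (of_int w * \<xi> v)) \<and> (\<exists>v. \<xi> v \<noteq> 0)"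
proof -
  define \<xi> where "\<xi> = (\<lambda>v. pairing N c (SOME \<tau>. rel v \<tau>))"
  have \<xi>: "\<xi> v = pairing N c \<tau>" if "rel v \<tau>" for v \<tau>
  proof -
    have "rel v (SOME \<tau>. rel v \<tau>)" using that by (rule someI[of "rel v"])
    from rel_diff[OF this that] have "rel 0 (\<lambda>l. (SOME \<tau>. rel v \<tau>) l - \<tau> l)" by simp
    then have "(SOME \<tau>. rel v \<tau>) l = \<tau> l" if "l \<in> words N" for l using rel_zero_trivial that by fastforce
    then show ?thesis unfolding \<xi>_def by (intro pairing_cong) simp
  qed
  have "\<xi> (x + y) = \<xi> x + \<xi> y" for x y
  proof -
    obtain \<sigma> \<tau> where r: "rel x \<sigma>" "rel y \<tau>" using rel_total by blast
    show ?thesis using \<xi>[OF rel.add[OF r]] \<xi>[OF r(1)] \<xi>[OF r(2)] by (simp add: pairing_add_right)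
  qed
  moreover have "\<xi> (scale a x) = a * \<xi> x" for a x
  proof -
    obtain \<tau> where r: "rel x \<tau>" using rel_total by blast
    show ?thesis using \<xi>[OF rel.scale[OF r]] \<xi>[OF r] by (simp add: pairing_scale_right)
  qed
  moreover have "\<xi> (pe v) = 0" for v
  proof -
    obtain \<tau> where \<tau>: "rel v \<tau>" using rel_total by blast
    have "rel (pe v) (act (\<lambda>p q. raise q p) \<tau>)" by (rule rel_act[OF \<tau>]) (simp add: raise_def)
    then have "\<xi> (pe v) = pairing N (act raise c) \<tau>" by (simp add: \<xi> pairing_act)
    also have "\<dots> = 0" using c by (intro null_on_rel[OF \<tau>]) (simp add: highest_def)
    finally show ?thesis .
  qed
  moreover have "\<xi> (ph v) = - (of_int w * \<xi> v)" for v
  proof -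
    obtain \<tau> where \<tau>: "rel v \<tau>" using rel_total by blast
    have "rel (ph v) (act (\<lambda>p q. - grade q p) \<tau>)" by (rule rel_act[OF \<tau>]) (simp add: sum_negf grade_trace)
    then have "\<xi> (ph v) = pairing N (act (\<lambda>p q. (- 1) * grade p q) c) \<tau>" by (simp add: \<xi> pairing_act)
    also have "\<dots> = - pairing N (act grade c) \<tau>"
      unfolding act_mat_scale[abs_def] pairing_scale_left by simp
    also have "pairing N (act grade c) \<tau> = of_int w * pairing N c \<tau>"
    proof -
      have "pairing N (\<lambda>l. act grade c l + (- of_int w) * c l) \<tau> = 0"
        using c by (intro null_on_rel[OF \<tau>]) (simp only: val_add val_scale highest_def, simp)
      then show ?thesis unfolding pairing_add_left pairing_scale_left by simp
    qed
    finally show ?thesis using \<xi>[OF \<tau>] by simp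
  qed
  moreover have "\<exists>v. \<xi> v \<noteq> 0"
  proof -
    obtain A where A: "val (shape \<Lambda>) c A \<noteq> 0" using c by (auto simp: highest_def)
    obtain v where "rel v (flag (shape \<Lambda>) A)" using rel_flag by blast
    then have "\<xi> v \<noteq> 0" using A \<xi> by (simp add: val_def N_def)
    then show ?thesis by blast
  qed
  ultimately show ?thesis by blast
qed

end

theorem (in gl_module) small_functional:
  "\<exists>\<xi> w. w < int n \<and> (\<forall>x y. \<xi> (x + y) = \<xi> x + \<xi> y) \<and> (\<forall>a x. \<xi> (scale a x) = a * (\<xi> x :: complex))
    \<and> (\<forall>v. \<xi> (pe v) = 0) \<and> (\<forall>v. \<xi> (ph v) = - (of_int w * \<xi> v)) \<and> (\<exists>v. \<xi> v \<noteq> 0)"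
proof -
  obtain v0 d \<Lambda> where h: "v0 \<noteq> 0" "ph v0 = scale (of_int d) v0"
     "\<forall>p q. p < q \<longrightarrow> q < n \<longrightarrow> opr (EM p q) v0 = 0"
     "\<forall>k. Suc k < n \<longrightarrow> opr (\<lambda>p q. EM k k p q - EM (Suc k) (Suc k) p q) v0 = scale (of_nat (\<Lambda> k :: nat)) v0"
    using highest_weight_vector by blast
  interpret h: highest_weight_module scale Bs n opr v0 d \<Lambda>
    by unfold_locales (use h in auto)
  obtain w c where "highest (shape \<Lambda>) w c" "w < int n" using small_highest[OF n3, of "shape \<Lambda>"] set_shape by blast
  then show ?thesis using h.functional_from_highest by blast
qed

section \<open>Representations of two by two matrices\<close>

definition E2 :: "complex^2^2" where "E2 = (\<chi> i j. if i = 1 \<and> j = 2 then 1 else 0)"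
definition F2 :: "complex^2^2" where "F2 = (\<chi> i j. if i = 2 \<and> j = 1 then 1 else 0)"
definition H2 :: "complex^2^2" where "H2 = (\<chi> i j. if i = j then if i = 1 then 1 else - 1 else 0)"

lemma sl2_basis:
  shows "E2 \<in> sl" "F2 \<in> sl" "H2 \<in> sl"
    and "lie_bracket E2 F2 = H2" "lie_bracket H2 E2 = smult_matrix 2 E2" "lie_bracket H2 F2 = smult_matrix (- 2) F2"
  by (simp_all add: sl_def trace_def sum_2 E2_def F2_def H2_def lie_bracket_def smult_matrix_def
      vec_eq_iff forall_2 matrix_matrix_mult_def)

lemma sl2_coordinates:
  assumes "X \<in> (sl :: (complex^2^2) set)"
  shows "X = smult_matrix (X$1$2) E2 + smult_matrix (X$2$1) F2 + smult_matrix (X$1$1) H2"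
  using assms by (simp add: sl_def trace_def sum_2 E2_def F2_def H2_def smult_matrix_def vec_eq_iff forall_2
      eq_neg_iff_add_eq_0 add.commute)

lemma smult_in_sl: "X \<in> sl \<Longrightarrow> smult_matrix c X \<in> sl"
  by (simp add: sl_def trace_def smult_matrix_def flip: sum_distrib_left)

lemma add_in_sl: "X \<in> sl \<Longrightarrow> Y \<in> sl \<Longrightarrow> X + Y \<in> sl"
  by (simp add: sl_def trace_def sum.distrib)

lemma bracket_in_sl: "lie_bracket X Y \<in> sl"
  by (simp add: lie_bracket_def sl_def trace_sub trace_mul_sym[of X Y])

lemma sl2_rep_coordinates:
  assumes "lie_rep sl smul \<sigma>" "X \<in> (sl :: (complex^2^2) set)"
  shows "\<sigma> X v = smul (X$1$2) (\<sigma> E2 v) + smul (X$2$1) (\<sigma> F2 v) + smul (X$1$1) (\<sigma> H2 v)"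
proof -
  have add: "\<sigma> (Y + Z) v = \<sigma> Y v + \<sigma> Z v" if "Y \<in> sl" "Z \<in> sl" for Y Z using assms(1) that by (simp add: lie_rep_def)
  have sc: "\<sigma> (smult_matrix c Y) v = smul c (\<sigma> Y v)" if "Y \<in> sl" for c Y using assms(1) that by (simp add: lie_rep_def)
  show ?thesis
    by (subst sl2_coordinates[OF assms(2)]) (simp add: add sc smult_in_sl add_in_sl sl2_basis)
qed

lemma sl2_rep_module:
  assumes rep: "lie_rep sl smul \<sigma>" and fd: "finite_dimensional_vector_space smul Bs"
  shows "sl2_module smul Bs (\<sigma> E2) (\<sigma> F2) (\<sigma> H2)"
proof -
  interpret finite_dimensional_vector_space smul Bs by (rule fd)
  have br: "\<sigma> (lie_bracket X Y) v = \<sigma> X (\<sigma> Y v) - \<sigma> Y (\<sigma> X v)" if "X \<in> sl" "Y \<in> sl" for X Y v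
    using rep that by (simp add: lie_rep_def)
  have sc: "\<sigma> (smult_matrix c Y) v = smul c (\<sigma> Y v)" if "Y \<in> sl" for c Y v using rep that by (simp add: lie_rep_def)
  have lin: "Vector_Spaces.linear smul smul (\<sigma> X)" if "X \<in> sl" for X using rep that by (simp add: lie_rep_def)
  show ?thesis
  proof (intro sl2_module.intro sl2_module_axioms.intro fd lin sl2_basis)
    fix v
    show "\<sigma> E2 (\<sigma> F2 v) - \<sigma> F2 (\<sigma> E2 v) = \<sigma> H2 v" using br[of E2 F2 v] by (simp add: sl2_basis)
    show "\<sigma> H2 (\<sigma> E2 v) - \<sigma> E2 (\<sigma> H2 v) = smul 2 (\<sigma> E2 v)" using br[of H2 E2 v] by (simp add: sl2_basis sc)
    show "\<sigma> H2 (\<sigma> F2 v) - \<sigma> F2 (\<sigma> H2 v) = - smul 2 (\<sigma> F2 v)" using br[of H2 F2 v] by (simp add: sl2_basis sc)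
  qed
qed

lemma string_subrep:
  assumes rep: "lie_rep sl smul \<sigma>" and fd: "finite_dimensional_vector_space smul Bs"
    and b: "\<sigma> E2 b = 0" "\<sigma> H2 b = smul (of_nat d) b" "b \<noteq> 0"
  shows "subrep sl smul \<sigma> (sl2_module.string smul (\<sigma> F2) b d)"
    and "is_F d sl smul \<sigma> (sl2_module.string smul (\<sigma> F2) b d)"
proof -
  interpret s: sl2_module smul Bs "\<sigma> E2" "\<sigma> F2" "\<sigma> H2" by (rule sl2_rep_module[OF rep fd])
  have 1: "\<sigma> X v \<in> s.string b d" if "X \<in> sl" "v \<in> s.string b d" for X v
    unfolding sl2_rep_coordinates[OF rep that(1)]
    using s.string_stable[OF b that(2)] s.subspace_string by (intro s.subspace_add s.subspace_scale)
  show sr: "subrep sl smul \<sigma> (s.string b d)"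
    unfolding subrep_def using s.subspace_string 1 by blast
  have "b \<in> s.string b d" using s.power_in_string[of 0 d b] by simp
  then have "s.string b d \<noteq> {0}" using b(3) by auto
  moreover have "U = {0} \<or> U = s.string b d" if U: "subrep sl smul \<sigma> U" "U \<subseteq> s.string b d" for U
  proof (rule s.string_irreducible[OF b _ U(2)])
    show "s.subspace U" "\<sigma> E2 ` U \<subseteq> U" "\<sigma> F2 ` U \<subseteq> U" using U(1) sl2_basis by (auto simp: subrep_def)
  qed
  ultimately show "is_F d sl smul \<sigma> (s.string b d)"
    using sr s.dim_string[OF b] unfolding is_F_def irreducible_subrep_def by blast
qed

text \<open>By \<open>functional_weight\<close> the functional singles out a string by its lowest vector.\<close>

lemma functional_detects_F:
  assumes rep: "lie_rep sl smul \<sigma>"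
    and \<xi>: "\<And>x y. \<xi> (x + y) = \<xi> x + \<xi> y" "\<And>c x. \<xi> (smul c x) = c * (\<xi> x :: complex)"
      "\<And>v. \<xi> (\<sigma> E2 v) = 0" "\<And>v. \<xi> (\<sigma> H2 v) = - (of_int w * \<xi> v)" "\<xi> v0 \<noteq> 0"
  shows "\<exists>d. int d = w \<and> contains_F_in_decomposition d sl smul \<sigma>"
proof -
  obtain Bs where fd: "finite_dimensional_vector_space smul Bs" using rep by (auto simp: lie_rep_def)
  interpret s: sl2_module smul Bs "\<sigma> E2" "\<sigma> F2" "\<sigma> H2" by (rule sl2_rep_module[OF rep fd])
  obtain B d where B: "finite B" "\<forall>b\<in>B. \<sigma> E2 b = 0 \<and> \<sigma> H2 b = smul (of_nat (d b)) b \<and> b \<noteq> 0"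
     "s.span {(\<sigma> F2 ^^ k) b |b k. b \<in> B \<and> k \<le> d b} = UNIV"
     "direct_sum_decomposition ((\<lambda>b. s.string b (d b)) ` B)"
    using s.string_decomposition by blast
  obtain b where b: "b \<in> B" "int (d b) = w" using s.functional_weight[OF B(2,3) \<xi>] by blast
  have F: "is_F (d b) sl smul \<sigma> (s.string b (d b))" if "b \<in> B" for b
    using string_subrep(2)[OF rep fd] B(2) that by blast
  have "contains_F_in_decomposition (d b) sl smul \<sigma>"
    unfolding contains_F_in_decomposition_def
  proof (intro exI conjI)
    show "direct_sum_decomposition ((\<lambda>b. s.string b (d b)) ` B)" by (rule B(4))
    show "\<forall>W\<in>(\<lambda>b. s.string b (d b)) ` B. irreducible_subrep sl smul \<sigma> W" using F by (auto simp: is_F_def)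
    show "\<exists>W\<in>(\<lambda>b. s.string b (d b)) ` B. is_F (d b) sl smul \<sigma> W" using F b(1) by blast
  qed
  then show ?thesis using b(2) by blast
qed

section \<open>Principal subalgebras\<close>

text \<open>As the module is irreducible, it is a single string.  Its vectors f^k b are rescaled so that e shifts the index
  without a factor.\<close>

lemma principal_basis:
  fixes \<phi> :: "complex^2^2 \<Rightarrow> complex^'n^'n"
  assumes rep: "lie_rep sl (*s) (\<lambda>X v. \<phi> X *v v)"
    and F: "is_F (CARD('n) - 1) sl (*s) (\<lambda>X v. \<phi> X *v v) UNIV"
  shows "\<exists>B :: nat \<Rightarrow> complex^'n. (\<forall>c. (\<Sum>k<CARD('n). c k *s B k) = 0 \<longrightarrow> (\<forall>k<CARD('n). c k = 0))
    \<and> \<phi> E2 *v B 0 = 0 \<and> (\<forall>k. Suc k < CARD('n) \<longrightarrow> \<phi> E2 *v B (Suc k) = B k)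
    \<and> (\<forall>k<CARD('n). \<phi> F2 *v B k = of_nat (Suc k * (CARD('n) - Suc k)) *s B (Suc k))
    \<and> (\<forall>k<CARD('n). \<phi> H2 *v B k = (of_nat CARD('n) - 1 - 2 * of_nat k) *s B k)"
proof -
  let ?\<sigma> = "\<lambda>X v. \<phi> X *v v"
  define n where "n = CARD('n)"
  have n0: "n > 0" by (simp add: n_def)
  have fd: "finite_dimensional_vector_space ((*s) :: complex \<Rightarrow> complex^'n \<Rightarrow> _) cart_basis" ..
  interpret s: sl2_module "(*s) :: complex \<Rightarrow> complex^'n \<Rightarrow> _" cart_basis "?\<sigma> E2" "?\<sigma> F2" "?\<sigma> H2"
    by (rule sl2_rep_module[OF rep fd])
  obtain Y d where Y: "\<forall>b\<in>Y. \<phi> E2 *v b = 0 \<and> \<phi> H2 *v b = of_nat (d b) *s b \<and> b \<noteq> 0"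
     "vec.span {(?\<sigma> F2 ^^ k) b |b k. b \<in> Y \<and> k \<le> d b} = UNIV"
    using s.string_decomposition by blast
  have "Y \<noteq> {}"
  proof
    assume "Y = {}"
    then have "(UNIV :: (complex^'n) set) = {0}" using Y(2) by simp
    then show False using F by (simp add: is_F_def irreducible_subrep_def)
  qed
  then obtain b where "b \<in> Y" by blast
  then have b: "\<phi> E2 *v b = 0" "\<phi> H2 *v b = of_nat (d b) *s b" "b \<noteq> 0" using Y(1) by auto
  have "s.string b (d b) = UNIV"
  proof -
    have "subrep sl (*s) ?\<sigma> (s.string b (d b))" using string_subrep(1)[OF rep fd b] .
    moreover have "b \<in> s.string b (d b)" using s.power_in_string[of 0 "d b" b] by simp
    ultimately show ?thesis using F b(3) unfolding is_F_def irreducible_subrep_def by blast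
  qed
  then have "d b + 1 = n" using s.dim_string[OF b] by (simp only: vec_dim_card n_def)
  then have d: "d b = n - 1" by simp
  define \<gamma> where "\<gamma> = (\<lambda>k. \<Prod>j<k. inverse (of_nat (Suc j) * (of_nat (n - 1) - of_nat j)) :: complex)"
  define B where "B = (\<lambda>k. \<gamma> k *s (?\<sigma> F2 ^^ k) b)"
  have g0: "of_nat (Suc j) * (of_nat (n - 1) - of_nat j) \<noteq> (0::complex)" if "Suc j < n" for j
    using that by (simp del: of_nat_Suc of_nat_diff)
  have gnz: "\<gamma> k \<noteq> 0" if "k < n" for k
    unfolding \<gamma>_def using g0 that by (subst prod_zero_iff) (auto simp del: of_nat_Suc)
  have gS: "\<gamma> (Suc k) * (of_nat (Suc k) * (of_nat (n - 1) - of_nat k)) = \<gamma> k" if "Suc k < n" for k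
    unfolding \<gamma>_def prod.lessThan_Suc by (simp only: mult.assoc left_inverse[OF g0[OF that]] mult_1_right)
  have ind: "c k = 0" if c: "(\<Sum>k<n. c k *s B k) = 0" and k: "k < n" for c k
  proof -
    have "{..<n} = {..d b}" using d n0 by auto
    then have "(\<Sum>k\<le>d b. (c k * \<gamma> k) *s (?\<sigma> F2 ^^ k) b) = 0" using c by (simp add: B_def)
    then have "c k * \<gamma> k = 0" using s.single_independent[OF b, of "\<lambda>k. c k * \<gamma> k"] k d by auto
    then show ?thesis using gnz[OF k] by simp
  qed
  have E0: "\<phi> E2 *v B 0 = 0" by (simp add: B_def \<gamma>_def b(1))
  have ES: "\<phi> E2 *v B (Suc k) = B k" if "Suc k < n" for k
    using s.e_f_highest[OF b(1,2), of k] gS[OF that]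
    by (simp add: B_def vector_scalar_commute d del: funpow.simps of_nat_Suc of_nat_diff)
  have FB: "\<phi> F2 *v B k = of_nat (Suc k * (n - Suc k)) *s B (Suc k)" if "k < n" for k
  proof (cases "Suc k < n")
    case True
    have "of_nat (Suc k * (n - Suc k)) = of_nat (Suc k) * (of_nat (n - 1) - of_nat k :: complex)"
      using True less_imp_Suc_add[OF True] by (auto simp: algebra_simps)
    then have "of_nat (Suc k * (n - Suc k)) * \<gamma> (Suc k) = \<gamma> k" using gS[OF True] by (simp add: mult.commute)
    then show ?thesis by (simp add: B_def vector_scalar_commute del: of_nat_mult of_nat_Suc mult_Suc)
  next
    case False
    then have k: "Suc k = Suc (d b)" using that d by simp
    have "(?\<sigma> F2 ^^ Suc k) b = 0" unfolding k by (rule s.f_power_Suc_zero[OF b])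
    then have "\<phi> F2 *v B k = 0" by (simp add: B_def vector_scalar_commute)
    then show ?thesis using False by simp
  qed
  have HB: "\<phi> H2 *v B k = (of_nat n - 1 - 2 * of_nat k) *s B k" if "k < n" for k
  proof -
    have nd: "of_nat n - 1 = (of_nat (d b) :: complex)" using n0 by (simp add: d of_nat_diff)
    have "\<phi> H2 *v (?\<sigma> F2 ^^ k) b = (of_nat n - 1 - 2 * of_nat k) *s (?\<sigma> F2 ^^ k) b"
      unfolding nd vec.scale_left_diff_distrib s.h_f_power b(2) s.fk.scale ..
    then show ?thesis unfolding B_def vector_scalar_commute by (simp only: vec.scale_scale mult.commute)
  qed
  show ?thesis using ind E0 ES FB HB unfolding n_def by (intro exI[of _ B]) blast
qed

section \<open>Coordinates\<close>

text \<open>A numbering of the coordinates and a change of basis P, with inverse Q.  They identify complex n by n matrices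
  with matrices indexed by natural numbers below n.\<close>

locale matrix_frame = tensor_rank n for n :: nat +
  fixes idx :: "'n::finite \<Rightarrow> nat" and P Q :: "complex^'n^'n"
  assumes idx: "bij_betw idx UNIV {..<n}"
    and QP: "Q ** P = mat 1"
begin

lemma PQ: "P ** Q = mat 1"
  using QP matrix_left_right_inverse by blast

lemma card_n: "CARD('n) = n"
  using bij_betw_same_card[OF idx] by simp

lemma idx_less: "idx i < n"
  using idx by (auto simp: bij_betw_def)

lemma idx_eq: "idx i = idx j \<longleftrightarrow> i = j"
  using idx by (auto simp: bij_betw_def inj_on_def)

lemma sum_idx: "(\<Sum>i\<in>UNIV. g (idx i)) = (\<Sum>p<n. g p)"
  by (rule sum.reindex_bij_betw[OF idx])

text \<open>R renames indices, and M also changes the basis.\<close>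

definition R :: "mat \<Rightarrow> complex^'n^'n" where "R X = (\<chi> i j. X (idx i) (idx j))"
definition M :: "mat \<Rightarrow> complex^'n^'n" where "M X = P ** R X ** Q"

lemma R_mult: "R (mm X Y) = R X ** R Y"
  by (simp add: R_def mm_def matrix_matrix_mult_def vec_eq_iff sum_idx[of "\<lambda>r. X _ r * Y r _"])

lemma M_mult: "M (mm X Y) = M X ** M Y"
proof -
  have "M X ** M Y = P ** (R X ** (Q ** P) ** R Y) ** Q" by (simp only: M_def matrix_mul_assoc)
  then show ?thesis by (simp add: QP M_def R_mult)
qed

lemma add_mult: "(A + B) ** C = A ** C + B ** (C :: complex^'n^'n)" for A B :: "complex^'n^'n"
  by (simp add: matrix_matrix_mult_def vec_eq_iff sum.distrib distrib_right)

lemma M_add: "M (\<lambda>p q. X p q + Y p q) = M X + M Y"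
proof -
  have "R (\<lambda>p q. X p q + Y p q) = R X + R Y" by (simp add: R_def vec_eq_iff)
  then show ?thesis by (simp add: M_def matrix_add_ldistrib add_mult)
qed

lemma smult_mult: "smult_matrix c A ** B = smult_matrix c (A ** B)" "A ** smult_matrix c B = smult_matrix c (A ** B)"
  by (simp_all add: smult_matrix_def matrix_matrix_mult_def vec_eq_iff sum_distrib_left algebra_simps)

lemma M_scale: "M (\<lambda>p q. c * X p q) = smult_matrix c (M X)"
proof -
  have "R (\<lambda>p q. c * X p q) = smult_matrix c (R X)" by (simp add: R_def smult_matrix_def vec_eq_iff)
  then show ?thesis by (simp add: M_def smult_mult)
qed

lemma M_cong: "(\<And>p q. p < n \<Longrightarrow> q < n \<Longrightarrow> X p q = Y p q) \<Longrightarrow> M X = M Y"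
  by (simp add: M_def R_def idx_less)

lemma M_trace: "trace (M X) = (\<Sum>p<n. X p p)"
proof -
  have "trace (M X) = trace (Q ** (P ** R X))" unfolding M_def by (rule trace_mul_sym)
  also have "\<dots> = trace (R X)" by (simp add: matrix_mul_assoc QP)
  finally show ?thesis by (simp add: trace_def R_def sum_idx[of "\<lambda>p. X p p"])
qed

lemma M_surj: "\<exists>X. M X = A"
proof -
  define X :: mat where "X = (\<lambda>p q. (Q ** A ** P) $ inv_into UNIV idx p $ inv_into UNIV idx q)"
  have "inv_into UNIV idx (idx i) = i" for i using idx by (simp add: bij_betw_def)
  then have "R X = Q ** A ** P" by (simp add: R_def X_def vec_eq_iff)
  then have "M X = (P ** Q) ** A ** (P ** Q)" by (simp only: M_def matrix_mul_assoc)
  then show ?thesis by (auto simp: PQ)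
qed

lemma M_minus: "M (\<lambda>p q. X p q - Y p q) = M X - M Y"
proof -
  have "M (\<lambda>p q. X p q - Y p q) = M (\<lambda>p q. X p q + (- 1) * Y p q)" by simp
  then show ?thesis unfolding M_add M_scale by (simp add: smult_matrix_def vec_eq_iff)
qed

text \<open>The traceless part.  With it the representation of traceless matrices extends to all matrices, scalar matrices
  acting by 0.\<close>

definition S :: "mat \<Rightarrow> mat" where
  "S X = (\<lambda>p q. X p q + (- (\<Sum>r<n. X r r) / of_nat n) * (if p = q then 1 else 0))"

lemma n_pos: "n > 0"
  using card_n by (metis zero_less_card_finite)

lemma S_traceless: "M (S X) \<in> sl"
  using n_pos by (simp add: sl_def M_trace S_def sum.distrib sum_subtractf)

lemma S_fix: "(\<Sum>r<n. X r r) = 0 \<Longrightarrow> S X = X"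
  by (simp add: S_def fun_eq_iff)

lemma M_identity: "M (\<lambda>p q. if p = q then 1 else 0) = mat 1"
proof -
  have "R (\<lambda>p q. if p = q then 1 else 0) = mat 1" by (simp add: R_def mat_def vec_eq_iff idx_eq)
  then show ?thesis by (simp add: M_def PQ)
qed

lemma S_bracket: "M (S (\<lambda>p q. mm X Y p q - mm Y X p q)) = lie_bracket (M (S X)) (M (S Y))"
proof -
  have id: "smult_matrix a (mat 1) ** A = smult_matrix a A" "A ** smult_matrix a (mat 1) = smult_matrix a A"
    for a and A :: "complex^'n^'n" by (simp_all add: smult_mult)
  have "lie_bracket (A + smult_matrix a (mat 1)) (B + smult_matrix b (mat 1)) = lie_bracket A B"
    for A B :: "complex^'n^'n" and a b
    by (simp add: lie_bracket_def matrix_add_ldistrib add_mult id) (simp add: smult_matrix_def vec_eq_iff algebra_simps)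
  then have "lie_bracket (M (S X)) (M (S Y)) = lie_bracket (M X) (M Y)"
    unfolding S_def M_add M_scale M_identity .
  moreover have "S (\<lambda>p q. mm X Y p q - mm Y X p q) = (\<lambda>p q. mm X Y p q - mm Y X p q)"
    by (rule S_fix) (rule mm_trace)
  ultimately show ?thesis by (simp only: M_minus M_mult lie_bracket_def)
qed

lemma S_add: "M (S (\<lambda>p q. X p q + Y p q)) = M (S X) + M (S Y)"
proof -
  have "S (\<lambda>p q. X p q + Y p q) = (\<lambda>p q. S X p q + S Y p q)"
    by (auto simp: S_def fun_eq_iff sum.distrib add_divide_distrib diff_divide_distrib)
  then show ?thesis by (simp add: M_add)
qed

lemma S_scale: "M (S (\<lambda>p q. c * X p q)) = smult_matrix c (M (S X))"
proof -
  have "S (\<lambda>p q. c * X p q) = (\<lambda>p q. c * S X p q)"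
    by (auto simp: S_def fun_eq_iff sum_distrib_left[symmetric] algebra_simps)
  then show ?thesis by (simp add: M_scale)
qed

lemma S_cong: "(\<And>p q. p < n \<Longrightarrow> q < n \<Longrightarrow> X p q = Y p q) \<Longrightarrow> M (S X) = M (S Y)"
  by (intro M_cong) (simp add: S_def)

lemma irreducible_rep_gl_module:
  fixes smul :: "complex \<Rightarrow> 'v::ab_group_add \<Rightarrow> 'v"
  assumes irr: "irreducible_rep sl smul \<rho>" and fd: "finite_dimensional_vector_space smul Bs" and n3: "n \<ge> 3"
  shows "gl_module smul Bs n (\<lambda>X. \<rho> (M (S X)))"
proof -
  interpret finite_dimensional_vector_space smul Bs by (rule fd)
  have rep: "lie_rep sl smul \<rho>" using irr by (simp add: irreducible_rep_def)
  show ?thesis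
  proof (intro gl_module.intro gl_module_axioms.intro fd n3)
    show "Vector_Spaces.linear smul smul (\<rho> (M (S X)))" for X using rep S_traceless by (simp add: lie_rep_def)
    show "\<rho> (M (S (\<lambda>p q. X p q + Y p q))) v = \<rho> (M (S X)) v + \<rho> (M (S Y)) v" for X Y v
      unfolding S_add using rep S_traceless by (simp add: lie_rep_def)
    show "\<rho> (M (S (\<lambda>p q. c * X p q))) v = smul c (\<rho> (M (S X)) v)" for c X v
      unfolding S_scale using rep S_traceless by (simp add: lie_rep_def)
    show "\<rho> (M (S X)) (\<rho> (M (S Y)) v) = \<rho> (M (S Y)) (\<rho> (M (S X)) v) + \<rho> (M (S (\<lambda>p q. mm X Y p q - mm Y X p q))) v" for X Y v
      unfolding S_bracket using rep S_traceless by (simp add: lie_rep_def)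
    show "\<rho> (M (S X)) v = \<rho> (M (S Y)) v" if "\<And>p q. p < n \<Longrightarrow> q < n \<Longrightarrow> X p q = Y p q" for X Y v
      using S_cong[OF that] by simp
    show "\<exists>v::'v. v \<noteq> 0" using irr by (auto simp: irreducible_rep_def irreducible_subrep_def)
    fix U assume U: "subspace U" "\<And>X. (\<Sum>p<n. X p p) = 0 \<Longrightarrow> \<rho> (M (S X)) ` U \<subseteq> U"
    have "\<rho> A ` U \<subseteq> U" if A: "A \<in> sl" for A
    proof -
      obtain X where X: "M X = A" using M_surj by blast
      then have "(\<Sum>p<n. X p p) = 0" using A M_trace[of X] by (simp add: sl_def)
      then show ?thesis using U(2)[of X] S_fix[of X] X by simp
    qed
    then have "subrep sl smul \<rho> U" using U(1) by (simp add: subrep_def)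
    then show "U = {0} \<or> U = UNIV" using irr by (auto simp: irreducible_rep_def irreducible_subrep_def)
  qed
qed

end

text \<open>The columns of P are the vectors of \<open>principal_basis\<close>.\<close>

lemma principal_frame:
  fixes \<phi> :: "complex^2^2 \<Rightarrow> complex^'n^'n"
  assumes rep: "lie_rep sl (*s) (\<lambda>X v. \<phi> X *v v)"
    and F: "is_F (CARD('n) - 1) sl (*s) (\<lambda>X v. \<phi> X *v v) UNIV"
  shows "\<exists>(idx :: 'n \<Rightarrow> nat) P Q. matrix_frame CARD('n) idx P Q
    \<and> \<phi> E2 = matrix_frame.M idx P Q (\<lambda>p q. tensor_rank.raise q p)
    \<and> \<phi> H2 = matrix_frame.M idx P Q (\<lambda>p q. - tensor_rank.grade CARD('n) q p)"
proof -
  define n where "n = CARD('n)"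
  obtain B :: "nat \<Rightarrow> complex^'n" where B: "\<And>c k. (\<Sum>k<n. c k *s B k) = 0 \<Longrightarrow> k < n \<Longrightarrow> c k = 0"
     "\<phi> E2 *v B 0 = 0" "\<And>k. Suc k < n \<Longrightarrow> \<phi> E2 *v B (Suc k) = B k"
     "\<And>k. k < n \<Longrightarrow> \<phi> H2 *v B k = (of_nat n - 1 - 2 * of_nat k) *s B k"
    using principal_basis[OF assms] unfolding n_def by blast
  obtain idx :: "'n \<Rightarrow> nat" where idx: "bij_betw idx UNIV {..<n}"
    using ex_bij_betw_finite_nat[of "UNIV :: 'n set"] unfolding n_def atLeast0LessThan by auto
  define P :: "complex^'n^'n" where "P = (\<chi> i j. B (idx j) $ i)"
  have col: "column j P = B (idx j)" for j by (simp add: column_def P_def vec_eq_iff)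
  have less: "idx i < n" for i using idx by (auto simp: bij_betw_def)
  have inv: "inv_into UNIV idx (idx i) = i" for i using idx by (simp add: bij_betw_def)
  have "\<exists>Q. Q ** P = mat 1"
    unfolding matrix_left_invertible_independent_columns
  proof (intro allI impI)
    fix c i assume "(\<Sum>j\<in>UNIV. c j *s column j P) = 0"
    then have "(\<Sum>j\<in>UNIV. c (inv_into UNIV idx (idx j)) *s B (idx j)) = 0" by (simp add: inv col)
    then have "(\<Sum>k<n. c (inv_into UNIV idx k) *s B k) = 0"
      using sum.reindex_bij_betw[OF idx, of "\<lambda>k. c (inv_into UNIV idx k) *s B k"] by simp
    from B(1)[OF this less[of i]] show "c i = 0" by (simp add: inv)
  qed
  then obtain Q where Q: "Q ** P = mat 1" by blast
  interpret fr: matrix_frame n idx P Q by unfold_locales (use idx Q in auto)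
  have M: "A = fr.M X" if "\<And>j i. (A *v B (idx j)) $ i = (\<Sum>p<n. X p (idx j) * B p $ i)" for A X
  proof -
    have "A ** P = P ** fr.R X"
    proof (simp only: vec_eq_iff, intro allI)
      fix i j
      have "(A ** P) $ i $ j = (A *v B (idx j)) $ i"
        by (simp add: matrix_matrix_mult_def matrix_vector_mult_def P_def)
      also have "\<dots> = (\<Sum>k\<in>UNIV. X (idx k) (idx j) * B (idx k) $ i)"
        unfolding that by (rule fr.sum_idx[symmetric])
      also have "\<dots> = (P ** fr.R X) $ i $ j"
        by (simp add: matrix_matrix_mult_def P_def fr.R_def mult.commute)
      finally show "(A ** P) $ i $ j = (P ** fr.R X) $ i $ j" .
    qed
    then have "A ** (P ** Q) = P ** fr.R X ** Q" by (simp add: matrix_mul_assoc)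
    then show ?thesis by (simp add: fr.PQ fr.M_def)
  qed
  have "\<phi> E2 = fr.M (\<lambda>p q. fr.raise q p)"
  proof (rule M)
    fix i j
    have "(\<Sum>p<n. fr.raise (idx j) p * B p $ i) = (\<phi> E2 *v B (idx j)) $ i"
    proof (cases "idx j")
      case 0
      then show ?thesis using B(2) by (simp add: fr.raise_def)
    next
      case (Suc k)
      then have "Suc k < n" using less[of j] by simp
      moreover have "(\<Sum>p<n. fr.raise (idx j) p * B p $ i) = (\<Sum>p<n. if p = k then B k $ i else 0)"
        by (intro sum.cong refl) (auto simp: fr.raise_def Suc)
      ultimately show ?thesis using B(3) by (simp add: Suc)
    qed
    then show "(\<phi> E2 *v B (idx j)) $ i = (\<Sum>p<n. fr.raise (idx j) p * B p $ i)" by simp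
  qed
  moreover have "\<phi> H2 = fr.M (\<lambda>p q. - fr.grade q p)"
  proof (rule M)
    fix i j
    have "(\<Sum>p<n. - fr.grade (idx j) p * B p $ i)
       = (\<Sum>p<n. if p = idx j then (of_nat n - 1 - 2 * of_nat (idx j)) * B (idx j) $ i else 0)"
      by (intro sum.cong refl) (auto simp: fr.grade_def algebra_simps)
    also have "\<dots> = (of_nat n - 1 - 2 * of_nat (idx j)) * B (idx j) $ i" using less[of j] by simp
    finally show "(\<phi> H2 *v B (idx j)) $ i = (\<Sum>p<n. - fr.grade (idx j) p * B p $ i)"
      unfolding B(4)[OF less] vector_smult_component by (rule sym)
  qed
  ultimately show ?thesis using fr.matrix_frame_axioms unfolding n_def by blast
qed

section \<open>Restriction to a principal subalgebra\<close>

lemma subrep_image: "subrep (\<phi> ` L) smul \<rho> W \<longleftrightarrow> subrep L smul (\<lambda>X. \<rho> (\<phi> X)) W"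
  by (simp add: subrep_def)

lemma contains_F_image:
  "contains_F_in_decomposition d (\<phi> ` L) smul \<rho> \<longleftrightarrow> contains_F_in_decomposition d L smul (\<lambda>X. \<rho> (\<phi> X))"
  by (simp add: contains_F_in_decomposition_def is_F_def irreducible_subrep_def subrep_image)

text \<open>The map \<phi> has traceless values because E2, F2 and H2 are multiples of commutators.\<close>

lemma restricted_rep:
  fixes \<phi> :: "complex^2^2 \<Rightarrow> complex^'n^'n"
  assumes \<phi>: "lie_rep sl (*s) (\<lambda>X v. \<phi> X *v v)" and \<rho>: "lie_rep sl smul \<rho>"
  shows "lie_rep sl smul (\<lambda>X. \<rho> (\<phi> X))"
proof -
  have add: "\<phi> (X + Y) = \<phi> X + \<phi> Y" if "X \<in> sl" "Y \<in> sl" for X Y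
    using \<phi> that unfolding matrix_eq[of "\<phi> (X + Y)"] lie_rep_def by (simp add: matrix_vector_mult_add_rdistrib)
  have sv: "smult_matrix c A *v v = c *s (A *v v)" for c and A :: "complex^'n^'n" and v
    by (simp add: smult_matrix_def matrix_vector_mult_def vec_eq_iff sum_distrib_left algebra_simps)
  have sc: "\<phi> (smult_matrix c X) = smult_matrix c (\<phi> X)" if "X \<in> sl" for c X
    using \<phi> that unfolding matrix_eq[of "\<phi> (smult_matrix c X)"] lie_rep_def by (simp add: sv)
  have br: "\<phi> (lie_bracket X Y) = lie_bracket (\<phi> X) (\<phi> Y)" if "X \<in> sl" "Y \<in> sl" for X Y
    using \<phi> that unfolding matrix_eq[of "\<phi> (lie_bracket X Y)"] lie_rep_def
    by (simp add: lie_bracket_def matrix_vector_mult_diff_rdistrib matrix_vector_mul_assoc)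
  have half: "X = smult_matrix (inverse c) (smult_matrix c X)" if "c \<noteq> 0" for c and X :: "complex^'n^'n"
    using that by (simp add: smult_matrix_def vec_eq_iff)
  have E: "\<phi> H2 \<in> sl" "\<phi> E2 \<in> sl" "\<phi> F2 \<in> sl"
  proof -
    show "\<phi> H2 \<in> sl" using br[of E2 F2] by (simp add: sl2_basis bracket_in_sl)
    have "smult_matrix 2 (\<phi> E2) \<in> sl" using br[of H2 E2] sc[of E2 2] by (simp add: sl2_basis bracket_in_sl)
    then show "\<phi> E2 \<in> sl" by (subst half[of 2]) (simp_all add: smult_in_sl)
    have "smult_matrix (- 2) (\<phi> F2) \<in> sl" using br[of H2 F2] sc[of F2 "- 2"] by (simp add: sl2_basis bracket_in_sl)
    then show "\<phi> F2 \<in> sl" by (subst half[of "- 2"]) (simp_all add: smult_in_sl)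
  qed
  have sl: "\<phi> X \<in> sl" if "X \<in> sl" for X
  proof -
    have "\<phi> X = smult_matrix (X$1$2) (\<phi> E2) + smult_matrix (X$2$1) (\<phi> F2) + smult_matrix (X$1$1) (\<phi> H2)"
      by (subst sl2_coordinates[OF that]) (simp add: add sc smult_in_sl add_in_sl sl2_basis)
    then show ?thesis using E by (simp add: smult_in_sl add_in_sl)
  qed
  show ?thesis using \<rho> sl add sc br unfolding lie_rep_def by simp
qed

theorem theorem1:
  fixes \<ss> :: "(complex^'n^'n) set"
    and smul :: "complex \<Rightarrow> 'v::ab_group_add \<Rightarrow> 'v"
    and \<rho> :: "complex^'n^'n \<Rightarrow> 'v \<Rightarrow> 'v"
  assumes "CARD('n) \<ge> 3"
    and "principal_sl2 \<ss>"
    and "irreducible_rep sl smul \<rho>"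
  shows "\<exists>d. d < CARD('n) \<and> contains_F_in_decomposition d \<ss> smul \<rho>"
proof -
  obtain \<phi> :: "complex^2^2 \<Rightarrow> complex^'n^'n" where \<phi>: "lie_rep sl (*s) (\<lambda>X v. \<phi> X *v v)"
     "is_F (CARD('n) - 1) sl (*s) (\<lambda>X v. \<phi> X *v v) UNIV" "\<ss> = \<phi> ` sl"
    using assms(2) unfolding principal_sl2_def by blast
  obtain idx :: "'n \<Rightarrow> nat" and P Q where fr: "matrix_frame CARD('n) idx P Q"
     "\<phi> E2 = matrix_frame.M idx P Q (\<lambda>p q. tensor_rank.raise q p)"
     "\<phi> H2 = matrix_frame.M idx P Q (\<lambda>p q. - tensor_rank.grade CARD('n) q p)"
    using principal_frame[OF \<phi>(1,2)] by blast
  interpret fr: matrix_frame "CARD('n)" idx P Q by (rule fr(1))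
  have rep: "lie_rep sl smul \<rho>" using assms(3) by (simp add: irreducible_rep_def)
  obtain Bs where fd: "finite_dimensional_vector_space smul Bs" using rep by (auto simp: lie_rep_def)
  interpret g: gl_module smul Bs "CARD('n)" "\<lambda>X. \<rho> (fr.M (fr.S X))"
    by (rule fr.irreducible_rep_gl_module[OF assms(3) fd assms(1)])
  have "fr.S (\<lambda>p q. fr.raise q p) = (\<lambda>p q. fr.raise q p)" by (rule fr.S_fix) (simp add: fr.raise_def)
  then have e: "fr.M (fr.S (\<lambda>p q. fr.raise q p)) = \<phi> E2" by (simp only: fr(2))
  have "fr.S (\<lambda>p q. - fr.grade q p) = (\<lambda>p q. - fr.grade q p)"
    by (rule fr.S_fix) (simp add: sum_negf fr.grade_trace)
  then have h: "fr.M (fr.S (\<lambda>p q. - fr.grade q p)) = \<phi> H2" by (simp only: fr(3))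
  obtain \<xi> w v0 where \<xi>: "w < int CARD('n)" "\<And>x y. \<xi> (x + y) = \<xi> x + \<xi> y"
     "\<And>a x. \<xi> (smul a x) = a * (\<xi> x :: complex)" "\<And>v. \<xi> (\<rho> (\<phi> E2) v) = 0"
     "\<And>v. \<xi> (\<rho> (\<phi> H2) v) = - (of_int w * \<xi> v)" "\<xi> v0 \<noteq> 0"
    using g.small_functional unfolding e h by blast
  obtain d where "int d = w" "contains_F_in_decomposition d sl smul (\<lambda>X. \<rho> (\<phi> X))"
    using functional_detects_F[OF restricted_rep[OF \<phi>(1) rep] \<xi>(2-6)] by blast
  then show ?thesis using \<xi>(1) unfolding \<phi>(3) contains_F_image by auto
qed

end
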